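(* Let $M$ be a finitely generated graded $S$-module, let $r$ be an integer, and let $M_1,\ldots,M_d$ be an approximation system for $M$ of degree $t$. Suppose that $y\in S_1$ is a linear form which is a filter-regular element for $M$ and for every $M_i$ simultaneously. If $\operatorname{reg}(M_i)\leq r-t$ for all $i$ and $\operatorname{reg}(M/yM)\leq r-t+1$, then $\operatorname{reg}(M)\leq r$.
   Context: $S=k[x_0,\ldots,x_n]$ is the standard graded polynomial ring over an infinite field $k$, and $\mathfrak m=(x_0,\ldots,x_n)$. All modules are finitely generated graded $S$-modules and morphisms are graded. Regularity: a finitely generated graded module $M$ with minimal graded free resolution $0\to F_l\to\cdots\to F_0\to M\to 0$ is $r$-regular if each $F_i$ is generated by elements of degree $\leq r+i$. $\operatorname{reg}(M)$ is the least integer $r$ such that $M$ is $r$-regular ($-\infty$ for $M=0$). Filter-regular element: a homogeneous element $z\in S$ is filter-regular for $M$ if the multiplication map $z:M_{i-\deg(z)}\to M_i$ is injective for all $i\gg0$. Approximation: a finitely generated graded module $M'$ is an approximation of $M$ if there is a surjective morphism $\phi:M\to M'$ with $\ker\phi$ annihilated by a proper homogeneous ideal of $S$. Approximation system: finitely generated graded modules $M_1,\dots,M_d$ form an approximation system for $M$ of degree $t$ if there are surjective morphisms $\phi_i:M\to M_i$ and proper homogeneous ideals $I_1,\dots,I_d$ of $S$ with $I_i\cdot\ker\phi_i=0$ for each $i$, and $\sum_i I_i\supseteq\mathfrak m^t$, where $t$ is an integer (necessarily $t\ge 1$, since the $I_i$ are proper). *)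

theory Defs
  imports
    Complex_Main
    "HOL-Library.Poly_Mapping"
    "HOL-Library.Extended_Real"
    "HOL-Algebra.Algebra"
begin

section \<open>The standard graded polynomial ring\<close>

text \<open>A polynomial maps exponent vectors (finitely supported functions on the variable
  indices) to coefficients; \<open>poly_ring n\<close> is \<open>S = k[x\<^sub>0,\<dots>,x\<^sub>n]\<close>, cut out of the polynomials
  in countably many variables.\<close>

type_synonym 'k mpoly = "(nat \<Rightarrow>\<^sub>0 nat) \<Rightarrow>\<^sub>0 'k"

definition poly_ring :: "nat \<Rightarrow> 'k::field mpoly ring" where
  "poly_ring n =
     \<lparr>carrier = {p. \<forall>e \<in> Poly_Mapping.keys p. Poly_Mapping.keys e \<subseteq> {..n}},
      monoid.mult = (*), one = 1, ring.zero = 0, add = (+)\<rparr>"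

definition monom_degree :: "(nat \<Rightarrow>\<^sub>0 nat) \<Rightarrow> nat" where
  "monom_degree e = (\<Sum>i \<in> Poly_Mapping.keys e. Poly_Mapping.lookup e i)"

text \<open>\<open>S\<^sub>j\<close>, for every integer \<open>j\<close>; it is \<open>{0}\<close> for negative \<open>j\<close>.\<close>

definition poly_part :: "nat \<Rightarrow> int \<Rightarrow> 'k::field mpoly set" where
  "poly_part n j =
     {p \<in> carrier (poly_ring n). \<forall>e \<in> Poly_Mapping.keys p. int (monom_degree e) = j}"

definition poly_var :: "nat \<Rightarrow> 'k::field mpoly" where
  "poly_var i = Poly_Mapping.single (Poly_Mapping.single i 1) 1"

definition max_ideal :: "nat \<Rightarrow> 'k::field mpoly set" where
  "max_ideal n = Idl\<^bsub>poly_ring n\<^esub> (poly_var ` {..n})"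

definition homogeneous_ideal :: "nat \<Rightarrow> 'k::field mpoly set \<Rightarrow> bool" where
  "homogeneous_ideal n I \<longleftrightarrow>
     ideal I (poly_ring n) \<and> (\<exists>A \<subseteq> (\<Union>j. poly_part n j). I = Idl\<^bsub>poly_ring n\<^esub> A)"


section \<open>Graded modules\<close>

text \<open>The ring multiplication and unit that the library's module records carry along are
  never used.\<close>

record ('a, 'b) gmodule = "('a, 'b) module" +
  part :: "int \<Rightarrow> 'b set"

definition graded_module :: "nat \<Rightarrow> ('k::field mpoly, 'm) gmodule \<Rightarrow> bool" where
  "graded_module n M \<longleftrightarrow>
     module (poly_ring n) M \<and>
     (\<forall>j. additive_subgroup (part M j) M) \<and>
     (\<forall>i j. \<forall>a \<in> poly_part n i. \<forall>x \<in> part M j. a \<odot>\<^bsub>M\<^esub> x \<in> part M (i + j)) \<and>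
     (\<forall>x \<in> carrier M. \<exists>!c. (\<forall>j. c j \<in> part M j) \<and> finite {j. c j \<noteq> \<zero>\<^bsub>M\<^esub>} \<and>
        x = (\<Oplus>\<^bsub>M\<^esub>j \<in> {j. c j \<noteq> \<zero>\<^bsub>M\<^esub>}. c j))"

definition span_in :: "nat \<Rightarrow> ('k::field mpoly, 'm) gmodule \<Rightarrow> 'm set \<Rightarrow> 'm set" where
  "span_in n M A = \<Inter>{N. submodule N (poly_ring n) M \<and> A \<subseteq> N}"

definition fg_graded_module :: "nat \<Rightarrow> ('k::field mpoly, 'm) gmodule \<Rightarrow> bool" where
  "fg_graded_module n M \<longleftrightarrow>
     graded_module n M \<and> (\<exists>A \<subseteq> carrier M. finite A \<and> span_in n M A = carrier M)"

definition graded_hom ::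
  "nat \<Rightarrow> ('k::field mpoly, 'm) gmodule \<Rightarrow> ('k mpoly, 'p) gmodule \<Rightarrow> ('m \<Rightarrow> 'p) \<Rightarrow> bool" where
  "graded_hom n M N f \<longleftrightarrow>
     f \<in> carrier M \<rightarrow> carrier N \<and>
     (\<forall>x \<in> carrier M. \<forall>y \<in> carrier M. f (x \<oplus>\<^bsub>M\<^esub> y) = f x \<oplus>\<^bsub>N\<^esub> f y) \<and>
     (\<forall>a \<in> carrier (poly_ring n). \<forall>x \<in> carrier M. f (a \<odot>\<^bsub>M\<^esub> x) = a \<odot>\<^bsub>N\<^esub> f x) \<and>
     (\<forall>j. f ` part M j \<subseteq> part N j)"

definition graded_epi ::
  "nat \<Rightarrow> ('k::field mpoly, 'm) gmodule \<Rightarrow> ('k mpoly, 'p) gmodule \<Rightarrow> ('m \<Rightarrow> 'p) \<Rightarrow> bool" where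
  "graded_epi n M N f \<longleftrightarrow> graded_hom n M N f \<and> f ` carrier M = carrier N"

text \<open>The quotient \<open>M/N\<close>, as a module of cosets with the images of the homogeneous parts
  of \<open>M\<close>.\<close>

definition quot_module :: "('a, 'm) gmodule \<Rightarrow> 'm set \<Rightarrow> ('a, 'm set) gmodule" where
  "quot_module M N =
     \<lparr>carrier = a_rcosets\<^bsub>M\<^esub> N, monoid.mult = undefined, one = undefined,
      ring.zero = N, add = (\<lambda>C D. C <+>\<^bsub>M\<^esub> D),
      smult = (\<lambda>a C. \<Union>x \<in> C. N +>\<^bsub>M\<^esub> (a \<odot>\<^bsub>M\<^esub> x)),
      part = (\<lambda>j. (\<lambda>x. N +>\<^bsub>M\<^esub> x) ` part M j)\<rparr>"

definition mult_image :: "('a, 'm) gmodule \<Rightarrow> 'a \<Rightarrow> 'm set" where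
  "mult_image M y = (\<lambda>x. y \<odot>\<^bsub>M\<^esub> x) ` carrier M"


section \<open>Minimal graded free resolutions and regularity\<close>

text \<open>\<open>free_gmodule n as\<close> is \<open>\<Oplus>\<^sub>j S(-as!j)\<close>: column vectors indexed by \<open>j < length as\<close> (padded
  with zeros), the \<open>j\<close>-th basis vector being of degree \<open>as!j\<close>. Up to isomorphism these are
  all the finitely generated graded free modules.\<close>

definition free_gmodule :: "nat \<Rightarrow> int list \<Rightarrow> ('k::field mpoly, nat \<Rightarrow> 'k mpoly) gmodule" where
  "free_gmodule n as =
     \<lparr>carrier = {f. (\<forall>j < length as. f j \<in> carrier (poly_ring n)) \<and> (\<forall>j \<ge> length as. f j = 0)},
      monoid.mult = undefined, one = undefined,
      ring.zero = (\<lambda>_. 0), add = (\<lambda>f g j. f j + g j),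
      smult = (\<lambda>a f j. a * f j),
      part = (\<lambda>d. {f. (\<forall>j < length as. f j \<in> poly_part n (d - as ! j)) \<and>
                      (\<forall>j \<ge> length as. f j = 0)})\<rparr>"

text \<open>\<open>0 \<rightarrow> F\<^sub>l \<rightarrow> \<dots> \<rightarrow> F\<^sub>0 \<rightarrow> M \<rightarrow> 0\<close> with \<open>F\<^sub>i = free_gmodule n (as i)\<close>, augmentation
  \<open>\<epsilon> : F\<^sub>0 \<rightarrow> M\<close> and differentials \<open>\<delta> i : F\<^sub>i\<^sub>+\<^sub>1 \<rightarrow> F\<^sub>i\<close>. Beyond \<open>l\<close> the sequence is continued by
  zero modules, so that the exactness condition at \<open>F\<^sub>l\<close> says that the map out of \<open>F\<^sub>l\<close> is
  injective. Minimality is the condition \<open>\<delta> i (F\<^sub>i\<^sub>+\<^sub>1) \<subseteq> \<mm> F\<^sub>i\<close>.\<close>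

definition minimal_graded_free_resolution ::
  "nat \<Rightarrow> ('k::field mpoly, 'm) gmodule \<Rightarrow> nat \<Rightarrow> (nat \<Rightarrow> int list) \<Rightarrow>
   (nat \<Rightarrow> (nat \<Rightarrow> 'k mpoly) \<Rightarrow> nat \<Rightarrow> 'k mpoly) \<Rightarrow> ((nat \<Rightarrow> 'k mpoly) \<Rightarrow> 'm) \<Rightarrow> bool" where
  "minimal_graded_free_resolution n M l as \<delta> \<epsilon> \<longleftrightarrow>
     (let F = \<lambda>i. free_gmodule n (as i) :: ('k mpoly, nat \<Rightarrow> 'k mpoly) gmodule in
       (\<forall>i > l. as i = []) \<and>
       graded_epi n (F 0) M \<epsilon> \<and>
       (\<forall>i. graded_hom n (F (Suc i)) (F i) (\<delta> i)) \<and>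
       \<delta> 0 ` carrier (F 1) = a_kernel (F 0) M \<epsilon> \<and>
       (\<forall>i. \<delta> (Suc i) ` carrier (F (Suc (Suc i))) = a_kernel (F (Suc i)) (F i) (\<delta> i)) \<and>
       (\<forall>i. \<delta> i ` carrier (F (Suc i)) \<subseteq>
          span_in n (F i) {a \<odot>\<^bsub>F i\<^esub> f | a f. a \<in> max_ideal n \<and> f \<in> carrier (F i)}))"

definition generated_in_degrees_le :: "nat \<Rightarrow> ('k::field mpoly, 'm) gmodule \<Rightarrow> int \<Rightarrow> bool" where
  "generated_in_degrees_le n M r \<longleftrightarrow> span_in n M (\<Union>j \<in> {..r}. part M j) = carrier M"

definition regular :: "nat \<Rightarrow> int \<Rightarrow> ('k::field mpoly, 'm) gmodule \<Rightarrow> bool" where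
  "regular n r M \<longleftrightarrow>
     (\<exists>l as \<delta> \<epsilon>. minimal_graded_free_resolution n M l as \<delta> \<epsilon> \<and>
        (\<forall>i \<le> l. generated_in_degrees_le n
                 (free_gmodule n (as i) :: ('k mpoly, nat \<Rightarrow> 'k mpoly) gmodule) (r + int i)))"

text \<open>The infimum is a minimum for \<open>M \<noteq> 0\<close>, and it is \<open>-\<infinity>\<close> for \<open>M = 0\<close>.\<close>

definition reg :: "nat \<Rightarrow> ('k::field mpoly, 'm) gmodule \<Rightarrow> ereal" where
  "reg n M = Inf {ereal (real_of_int r) | r. regular n r M}"


section \<open>Filter-regular elements and approximation systems\<close>

text \<open>The degree \<open>e\<close> is determined by \<open>z\<close> unless \<open>z = 0\<close>, in which case the condition does
  not depend on \<open>e\<close>.\<close>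

definition filter_regular :: "nat \<Rightarrow> ('k::field mpoly, 'm) gmodule \<Rightarrow> 'k mpoly \<Rightarrow> bool" where
  "filter_regular n M z \<longleftrightarrow>
     (\<exists>e. z \<in> poly_part n e \<and>
        (\<forall>\<^sub>F i in at_top. inj_on (\<lambda>x. z \<odot>\<^bsub>M\<^esub> x) (part M (i - e))))"

definition approximation_via ::
  "nat \<Rightarrow> ('k::field mpoly, 'm) gmodule \<Rightarrow> ('k mpoly, 'p) gmodule \<Rightarrow> ('m \<Rightarrow> 'p) \<Rightarrow>
   'k mpoly set \<Rightarrow> bool" where
  "approximation_via n M M' \<phi> I \<longleftrightarrow>
     fg_graded_module n M' \<and> graded_epi n M M' \<phi> \<and>
     homogeneous_ideal n I \<and> I \<noteq> carrier (poly_ring n) \<and>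
     (\<forall>a \<in> I. \<forall>x \<in> a_kernel M M' \<phi>. a \<odot>\<^bsub>M\<^esub> x = \<zero>\<^bsub>M\<^esub>)"

text \<open>Powers and sums of ideals are taken in the library's semiring of ideals
  \<open>ideals_set\<close>. The modules are \<open>Ms 1, \<dots>, Ms d\<close>.\<close>

definition approximation_system ::
  "nat \<Rightarrow> ('k::field mpoly, 'm) gmodule \<Rightarrow> nat \<Rightarrow> (nat \<Rightarrow> ('k mpoly, 'p) gmodule) \<Rightarrow> nat \<Rightarrow> bool"
  where
  "approximation_system n M d Ms t \<longleftrightarrow>
     (\<exists>\<phi> I. (\<forall>i \<in> {1..d}. approximation_via n M (Ms i) (\<phi> i) (I i)) \<and>
        max_ideal n [^]\<^bsub>ideals_set (poly_ring n)\<^esub> t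
          \<subseteq> (\<Oplus>\<^bsub>ideals_set (poly_ring n)\<^esub>i \<in> {1..d}. I i))"

end

theory Submission
  imports Defs
begin

text \<open>Write \<open>H\<^sub>p(M)\<close> for the homology of the Koszul complex of \<open>x\<^sub>0, \<dots>, x\<^sub>n\<close> with coefficients in
  \<open>M\<close>. Since it computes \<open>Tor\<^sub>p(M, k)\<close>, the module \<open>M\<close> is \<open>r\<close>-regular exactly when, for every \<open>p\<close>,
  the part of \<open>H\<^sub>p(M)\<close> with coefficients in \<open>M\<^sub>j\<close> vanishes for all \<open>j > r\<close>. Both directions are
  dimension shifting along \<open>0 \<rightarrow> K \<rightarrow> F \<rightarrow> M \<rightarrow> 0\<close> with \<open>F\<close> free (\<open>vanishes_of_kernel\<close>,
  \<open>kernel_vanishes\<close>), based on the acyclicity of the Koszul complex of \<open>F\<close> in positive degrees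
  (\<open>free_koszul_exact\<close>). From a resolution one shifts down its syzygies
  (\<open>regular_koszul_vanishes\<close>). Conversely (\<open>regular_of_koszul_vanishes\<close>) the vanishing produces a
  finite minimal resolution step by step: it bounds the degrees of the generators of each syzygy module, so that finite generation is a matter of finite-dimensional
  vector spaces, and as \<open>H\<^sub>p\<close> is zero for \<open>p > n + 1\<close> the process stops.

  Now let \<open>y\<close> be the linear form. Multiplication by \<open>y\<close> is zero on Koszul homology, hence if \<open>y\<close> is
  injective on \<open>M\<^sub>j\<close> and \<open>H\<^sub>p\<^sub>+\<^sub>1(M/yM)\<close> vanishes in coefficient degree \<open>j\<close>, then \<open>H\<^sub>p(M)\<close> vanishes
  there too (\<open>vanishes_from_section\<close>). The ideals of the system are proper and homogeneous, so \<open>t \<ge> 1\<close>, and the bound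
  on \<open>M/yM\<close> provides the second condition for all \<open>j > r\<close>. It remains to show that \<open>yz = 0\<close> with
  \<open>z \<in> M\<^sub>j\<close>, \<open>j > r\<close>, forces \<open>z = 0\<close>.

  As \<open>y\<close> is filter-regular, such a \<open>z\<close> is torsion, i.e. killed by a power of \<open>\<mm>\<close>. Torsion vanishes in degrees above the
  regularity (\<open>torsion_zero\<close>), because \<open>H\<^sub>n\<^sub>+\<^sub>1\<close> is the socle. For \<open>M/yM\<close> this says that torsion
  elements of \<open>M\<close> of degree greater than \<open>r - t + 1\<close> are multiples of \<open>y\<close>, and filter-regularity makes the
  quotient torsion again; so \<open>z = y\<^sup>t z'\<close> with \<open>z'\<close> torsion of degree \<open>j - t > r - t\<close>
  (\<open>torsion_divisible\<close>). By the bounds on the approximations, \<open>z'\<close> becomes zero in each of them and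
  is therefore killed by every ideal of the system, hence by \<open>y\<^sup>t \<in> \<mm>\<^sup>t\<close>. Thus \<open>z = 0\<close>.\<close>

section \<open>Polynomials, monomials and homogeneous components\<close>

abbreviation "lookup \<equiv> Poly_Mapping.lookup"
abbreviation "keys \<equiv> Poly_Mapping.keys"
abbreviation "single \<equiv> Poly_Mapping.single"

lemma poly_ring_simps [simp]:
  "monoid.mult (poly_ring n) = (*)" "one (poly_ring n) = 1"
  "ring.zero (poly_ring n) = 0" "add (poly_ring n) = (+)"
  by (simp_all add: poly_ring_def)

lemma carrier_poly_ring:
  "p \<in> carrier (poly_ring n) \<longleftrightarrow> (\<forall>e \<in> keys p. keys e \<subseteq> {..n})"
  by (simp add: poly_ring_def)

lemma keys_add_exponent:
  "keys (a + b) = keys a \<union> keys (b :: nat \<Rightarrow>\<^sub>0 nat)"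
  by (auto simp: in_keys_iff lookup_add)

lemma monom_degree_superset:
  "finite A \<Longrightarrow> keys e \<subseteq> A \<Longrightarrow> monom_degree e = (\<Sum>i \<in> A. lookup e i)"
  unfolding monom_degree_def by (rule sum.mono_neutral_left) (auto simp: in_keys_iff)

lemma monom_degree_add: "monom_degree (a + b) = monom_degree a + monom_degree b"
proof -
  let ?A = "keys a \<union> keys b"
  have "monom_degree x = (\<Sum>i \<in> ?A. lookup x i)" if "x \<in> {a, b, a + b}" for x
    using that by (intro monom_degree_superset) (auto simp: keys_add_exponent)
  then show ?thesis
    by (simp add: lookup_add sum.distrib)
qed

lemma monom_degree_zero [simp]: "monom_degree 0 = 0"
  by (simp add: monom_degree_def)

lemma monom_degree_single [simp]: "monom_degree (single i k) = k"
  by (simp add: monom_degree_def)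

lemma monom_degree_eq_0_iff [simp]: "monom_degree e = 0 \<longleftrightarrow> e = 0"
  by (auto simp: monom_degree_def in_keys_iff intro!: poly_mapping_eqI)

lemma carrier_poly_closed:
  fixes p q :: "'k::field mpoly"
  assumes "p \<in> carrier (poly_ring n)" "q \<in> carrier (poly_ring n)"
  shows "p + q \<in> carrier (poly_ring n)" "p * q \<in> carrier (poly_ring n)"
    "- p \<in> carrier (poly_ring n)" "p - q \<in> carrier (poly_ring n)"
proof -
  have 1: "p + q \<in> carrier (poly_ring n)" if "p \<in> carrier (poly_ring n)" "q \<in> carrier (poly_ring n)"
    for p q :: "'k mpoly"
    using that Poly_Mapping.keys_add[of p q] by (auto simp: carrier_poly_ring)
  have 2: "- p \<in> carrier (poly_ring n)" if "p \<in> carrier (poly_ring n)" for p :: "'k mpoly"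
    using that by (simp add: carrier_poly_ring in_keys_iff)
  show "p + q \<in> carrier (poly_ring n)" "- p \<in> carrier (poly_ring n)"
    using 1 2 assms by blast+
  show "p - q \<in> carrier (poly_ring n)"
    using 1[OF assms(1) 2[OF assms(2)]] by simp
  show "p * q \<in> carrier (poly_ring n)"
    unfolding carrier_poly_ring
  proof
    fix e assume "e \<in> keys (p * q)"
    then obtain a b where "a \<in> keys p" "b \<in> keys q" "e = a + b"
      using keys_mult by blast
    then show "keys e \<subseteq> {..n}"
      using assms by (auto simp: carrier_poly_ring keys_add_exponent)
  qed
qed

lemma carrier_poly_zero [simp]: "0 \<in> carrier (poly_ring n)"
  by (simp add: carrier_poly_ring)

lemma carrier_poly_const [simp]: "single 0 c \<in> carrier (poly_ring n)"
  by (simp add: carrier_poly_ring)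

lemma carrier_poly_one [simp]: "1 \<in> carrier (poly_ring n)"
  by (simp add: carrier_poly_ring)

lemma poly_ring_cring: "cring (poly_ring n :: 'k::field mpoly ring)"
proof (intro cringI abelian_groupI comm_monoidI)
  fix x :: "'k mpoly" assume "x \<in> carrier (poly_ring n)"
  then show "\<exists>y \<in> carrier (poly_ring n). y \<oplus>\<^bsub>poly_ring n\<^esub> x = \<zero>\<^bsub>poly_ring n\<^esub>"
    by (intro bexI[of _ "- x"]) (simp_all add: carrier_poly_closed)
qed (auto simp: carrier_poly_closed algebra_simps)

lemma poly_part_iff:
  "p \<in> poly_part n j \<longleftrightarrow>
     (\<forall>e \<in> keys p. keys e \<subseteq> {..n} \<and> int (monom_degree e) = j)"
  by (auto simp: poly_part_def carrier_poly_ring)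

lemma poly_part_carrier: "p \<in> poly_part n j \<Longrightarrow> p \<in> carrier (poly_ring n)"
  by (simp add: poly_part_def)

lemma poly_part_closed:
  fixes p q :: "'k::field mpoly"
  shows "p \<in> poly_part n i \<Longrightarrow> q \<in> poly_part n i \<Longrightarrow> p + q \<in> poly_part n i"
    "p \<in> poly_part n i \<Longrightarrow> - p \<in> poly_part n i"
    "0 \<in> poly_part n i"
    "p \<in> poly_part n i \<Longrightarrow> q \<in> poly_part n j \<Longrightarrow> p * q \<in> poly_part n (i + j)"
proof -
  show "p \<in> poly_part n i \<Longrightarrow> q \<in> poly_part n i \<Longrightarrow> p + q \<in> poly_part n i"
    using Poly_Mapping.keys_add[of p q] by (auto simp: poly_part_iff)
  show "p \<in> poly_part n i \<Longrightarrow> - p \<in> poly_part n i"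
    by (auto simp: poly_part_iff in_keys_iff)
  show "0 \<in> poly_part n i"
    by (simp add: poly_part_iff)
  show "p * q \<in> poly_part n (i + j)" if pq: "p \<in> poly_part n i" "q \<in> poly_part n j"
    unfolding poly_part_iff
  proof
    fix e assume "e \<in> keys (p * q)"
    then obtain a b where "a \<in> keys p" "b \<in> keys q" "e = a + b"
      using keys_mult by blast
    then show "keys e \<subseteq> {..n} \<and> int (monom_degree e) = i + j"
      using pq by (auto simp: poly_part_iff keys_add_exponent monom_degree_add)
  qed
qed

lemma poly_part_const [simp]: "single 0 c \<in> poly_part n 0"
  by (simp add: poly_part_iff)

lemma poly_part_one [simp]: "1 \<in> poly_part n 0"
  by (simp add: poly_part_iff)

lemma poly_var_part: "i \<le> n \<Longrightarrow> poly_var i \<in> poly_part n 1"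
  by (simp add: poly_part_iff poly_var_def)

lemma poly_part_neg: "j < 0 \<Longrightarrow> p \<in> poly_part n j \<Longrightarrow> p = 0"
  by (force simp: poly_part_iff)

lemma poly_part_0_const:
  assumes "p \<in> poly_part n 0" shows "p = single 0 (lookup p 0)"
proof (rule poly_mapping_eqI)
  fix e show "lookup p e =
    lookup (single 0 (lookup p 0)) e"
    using assms by (cases "e = 0") (auto simp: poly_part_iff in_keys_iff lookup_single_not_eq)
qed

lemma poly_part_const_term: "j \<noteq> 0 \<Longrightarrow> p \<in> poly_part n j \<Longrightarrow> lookup p 0 = 0"
  using monom_degree_zero by (force simp: poly_part_iff in_keys_iff)

definition pfilter :: "('a \<Rightarrow> bool) \<Rightarrow> ('a \<Rightarrow>\<^sub>0 'k::zero) \<Rightarrow> ('a \<Rightarrow>\<^sub>0 'k)" where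
  "pfilter P p = Poly_Mapping.mapp (\<lambda>e c. if P e then c else 0) p"

lemma lookup_pfilter [simp]:
  "lookup (pfilter P p) e = (if P e then lookup p e else 0)"
  by (auto simp: pfilter_def lookup_mapp in_keys_iff when_def)

lemma keys_pfilter [simp]: "keys (pfilter P p) = {e \<in> keys p. P e}"
  by (auto simp: in_keys_iff split: if_splits)

definition poly_component :: "int \<Rightarrow> 'k::field mpoly \<Rightarrow> 'k mpoly" where
  "poly_component d = pfilter (\<lambda>e. int (monom_degree e) = d)"

lemma poly_component_part: "p \<in> carrier (poly_ring n) \<Longrightarrow> poly_component d p \<in> poly_part n d"
  by (auto simp: poly_component_def poly_part_iff carrier_poly_ring)

lemma poly_component_add: "poly_component d (p + q) = poly_component d p + poly_component d q"
  by (auto simp: poly_component_def lookup_add intro!: poly_mapping_eqI)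

lemma poly_component_same: "p \<in> poly_part n d \<Longrightarrow> poly_component d p = p"
  by (auto simp: poly_component_def poly_part_iff in_keys_iff intro!: poly_mapping_eqI)

lemma poly_component_other: "p \<in> poly_part n d \<Longrightarrow> d \<noteq> d' \<Longrightarrow> poly_component d' p = 0"
  by (auto simp: poly_component_def poly_part_iff in_keys_iff intro!: poly_mapping_eqI)

lemma finite_poly_component: "finite {d. poly_component d p \<noteq> 0}"
proof (rule finite_subset)
  show "{d. poly_component d p \<noteq> 0} \<subseteq> (\<lambda>e. int (monom_degree e)) ` keys p"
    by (auto simp: poly_component_def poly_mapping_eq_iff fun_eq_iff in_keys_iff image_iff split: if_splits)
qed simp

lemma sum_poly_component:
  assumes "finite A" "\<And>d. d \<notin> A \<Longrightarrow> poly_component d p = 0"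
  shows "(\<Sum>d \<in> A. poly_component d p) = p"
proof (rule poly_mapping_eqI)
  fix e
  have "lookup (\<Sum>d \<in> A. poly_component d p) e =
      (\<Sum>d \<in> A. if d = int (monom_degree e) then lookup p e else 0)"
    unfolding lookup_sum by (intro sum.cong) (auto simp: poly_component_def)
  also have "\<dots> = (if int (monom_degree e) \<in> A then lookup p e else 0)"
    using assms(1) by (subst sum.delta) auto
  also have "\<dots> = lookup p e"
    using assms(2)[of "int (monom_degree e)"]
    by (auto simp: poly_component_def poly_mapping_eq_iff fun_eq_iff split: if_splits)
  finally show "lookup (\<Sum>d \<in> A. poly_component d p) e = lookup p e" .
qed


subsection \<open>Ideals generated by variables\<close>

text \<open>Membership in the ideal generated by the variables with index in \<open>K\<close>, read off the exponents.
  For \<open>K = {..n}\<close> it describes the maximal ideal of \<open>S\<close> (\<open>in_var_ideal_all_iff\<close>).\<close>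

definition in_var_ideal :: "nat set \<Rightarrow> 'k::field mpoly \<Rightarrow> bool" where
  "in_var_ideal K p \<longleftrightarrow> (\<forall>e \<in> keys p. keys e \<inter> K \<noteq> {})"

lemma in_var_ideal_zero [simp]: "in_var_ideal K 0"
  by (simp add: in_var_ideal_def)

lemma in_var_ideal_add: "in_var_ideal K p \<Longrightarrow> in_var_ideal K q \<Longrightarrow> in_var_ideal K (p + q)"
  using Poly_Mapping.keys_add[of p q] by (auto simp: in_var_ideal_def)

lemma in_var_ideal_uminus [simp]: "in_var_ideal K (- p) \<longleftrightarrow> in_var_ideal K p"
  by (auto simp: in_var_ideal_def in_keys_iff)

lemma in_var_ideal_mono: "in_var_ideal K p \<Longrightarrow> K \<subseteq> L \<Longrightarrow> in_var_ideal L p"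
  by (auto simp: in_var_ideal_def)

lemma in_var_ideal_mult: "in_var_ideal K q \<Longrightarrow> in_var_ideal K (p * q)"
  unfolding in_var_ideal_def using keys_mult[of p q] by (fastforce simp: keys_add_exponent)

lemma in_var_ideal_var: "k \<in> K \<Longrightarrow> in_var_ideal K (poly_var k :: 'k::field mpoly)"
  by (simp add: in_var_ideal_def poly_var_def)

lemma in_var_ideal_all_iff:
  assumes "p \<in> carrier (poly_ring n)"
  shows "in_var_ideal {..n} p \<longleftrightarrow> lookup p 0 = 0"
proof
  assume "in_var_ideal {..n} p"
  then have "0 \<notin> keys p"
    unfolding in_var_ideal_def by fastforce
  then show "lookup p 0 = 0"
    by (simp add: in_keys_iff)
next
  assume "lookup p 0 = 0"
  then have "e \<noteq> 0" if "e \<in> keys p" for e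
    using that by (auto simp: in_keys_iff)
  then show "in_var_ideal {..n} p"
    using assms unfolding in_var_ideal_def carrier_poly_ring
    by (metis inf.absorb1 keys_eq_empty)
qed

lemma lookup_poly_var_mult:
  "lookup (poly_var k * p) (single k 1 + e) = lookup p e"
proof -
  have "lookup (poly_var k * p) (single k 1 + e) =
     (\<Sum>l. (1 when single k 1 = l) *
        (\<Sum>q. lookup p q when single k 1 + e = l + q))"
    by (simp add: lookup_mult poly_var_def lookup_single)
  also have "\<dots> = (\<Sum>l. (\<Sum>q. lookup p q when single k 1 + e = l + q)
        when l = single k 1)"
    by (intro Sum_any.cong) (auto simp: when_def)
  also have "\<dots> = (\<Sum>q. lookup p q when e = q)"
    by simp
  finally show ?thesis by simp
qed

text \<open>Multiplying by a variable outside \<open>K\<close> shifts exponents without touching the coordinates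
  in \<open>K\<close>; this is why the variables form a regular sequence.\<close>

lemma in_var_ideal_regular:
  assumes "in_var_ideal K (poly_var k * p)" "k \<notin> K"
  shows "in_var_ideal K p"
  unfolding in_var_ideal_def
proof
  fix e assume "e \<in> keys p"
  then have "single k 1 + e \<in> keys (poly_var k * p)"
    unfolding in_keys_iff lookup_poly_var_mult .
  then have "(keys (single k (1::nat)) \<union> keys e) \<inter> K \<noteq> {}"
    using assms(1) unfolding in_var_ideal_def keys_add_exponent[symmetric] by blast
  then show "keys e \<inter> K \<noteq> {}"
    using assms(2) by auto
qed

lemma poly_expansion: "p = (\<Sum>e \<in> keys p. single e (lookup p e))"
proof (rule poly_mapping_eqI)
  fix e
  have "lookup (\<Sum>e \<in> keys p. single e (lookup p e)) e
    = (\<Sum>e' \<in> keys p. if e' = e then lookup p e else 0)"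
    unfolding lookup_sum by (intro sum.cong) (auto simp: lookup_single when_def)
  also have "\<dots> = lookup p e"
    by (auto simp: in_keys_iff)
  finally show "lookup p e = lookup
    (\<Sum>e \<in> keys p. single e (lookup p e)) e" by simp
qed

text \<open>The monomials divisible by \<open>x\<^sub>k\<close> are collected in \<open>x\<^sub>k q\<close>. Iterating this writes an element of
  an ideal of variables as a linear combination of them without leaving its degree.\<close>

lemma split_off_variable:
  fixes p :: "'k::field mpoly"
  obtains q where "p = poly_var k * q + pfilter (\<lambda>e. k \<notin> keys e) p"
    "\<And>n. p \<in> carrier (poly_ring n) \<Longrightarrow> q \<in> carrier (poly_ring n)"
    "\<And>n j. p \<in> poly_part n j \<Longrightarrow> q \<in> poly_part n (j - 1)"
proof
  define A where "A = {e \<in> keys p. k \<in> keys e}"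
  define q where "q = (\<Sum>e \<in> A. single (e - single k 1) (lookup p e))"
  have shift: "single k 1 + (e - single k 1) = e" if "e \<in> A" for e
    using that by (auto intro!: poly_mapping_eqI simp: A_def lookup_add lookup_minus lookup_single
      when_def in_keys_iff)
  have fA: "finite A" unfolding A_def by simp
  have "poly_var k * q = (\<Sum>e \<in> A. single e (lookup p e))"
    unfolding q_def sum_distrib_left poly_var_def
    by (intro sum.cong refl) (simp only: mult_single shift mult_1_left)
  moreover have "pfilter (\<lambda>e. k \<notin> keys e) p =
      (\<Sum>e \<in> keys p - A. single e (lookup p e))"
    by (subst poly_expansion) (auto simp: A_def intro!: sum.cong)
  moreover have "p = (\<Sum>e \<in> keys p - A. single e (lookup p e)) +
      (\<Sum>e \<in> A. single e (lookup p e))"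
    by (subst poly_expansion, rule sum.subset_diff) (auto simp: A_def)
  ultimately show "p = poly_var k * q + pfilter (\<lambda>e. k \<notin> keys e) p"
    by (simp add: add.commute)
  have kq: "\<exists>e \<in> A. e' = e - single k 1" if "e' \<in> keys q" for e'
    using that keys_sum[of "\<lambda>e. single (e - single k 1) (lookup p e)" A]
    unfolding q_def by (auto split: if_splits)
  have ks: "keys (e - single k 1) \<subseteq> keys e" for e :: "nat \<Rightarrow>\<^sub>0 nat"
    by (auto simp: in_keys_iff lookup_minus)
  show "q \<in> carrier (poly_ring n)" if "p \<in> carrier (poly_ring n)" for n
    using that kq ks unfolding carrier_poly_ring A_def by fast
  show "q \<in> poly_part n (j - 1)" if "p \<in> poly_part n j" for n j
    unfolding poly_part_iff
  proof
    fix e' assume "e' \<in> keys q"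
    then obtain e where e: "e \<in> A" "e' = e - single k 1" using kq by blast
    have "monom_degree e = 1 + monom_degree e'"
      using shift[OF e(1)] monom_degree_add[of "single k 1" e'] e(2) by simp
    then show "keys e' \<subseteq> {..n} \<and> int (monom_degree e') = j - 1"
      using that e ks[of e] unfolding poly_part_iff A_def by auto
  qed
qed

lemma pfilter_part: "p \<in> poly_part n j \<Longrightarrow> pfilter P p \<in> poly_part n j"
  by (auto simp: poly_part_iff)

lemma pfilter_carrier: "p \<in> carrier (poly_ring n) \<Longrightarrow> pfilter P p \<in> carrier (poly_ring n)"
  by (auto simp: carrier_poly_ring)

lemma pfilter_in_var_ideal:
  "in_var_ideal (insert k K) p \<Longrightarrow> in_var_ideal K (pfilter (\<lambda>e. k \<notin> keys e) p)"
  by (auto simp: in_var_ideal_def)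

lemma in_var_ideal_in_ideal:
  assumes "ideal I (poly_ring n)" "poly_var ` set ks \<subseteq> I"
    "p \<in> carrier (poly_ring n)" "in_var_ideal (set ks) p"
  shows "p \<in> I"
  using assms(2-)
proof (induction ks arbitrary: p)
  case Nil
  then have "keys p = {}" by (auto simp: in_var_ideal_def)
  then have "p = \<zero>\<^bsub>poly_ring n\<^esub>" by simp
  then show ?case
    using additive_subgroup.zero_closed[OF ideal.axioms(1)[OF assms(1)]] by simp
next
  case (Cons k ks)
  obtain q where q: "p = poly_var k * q + pfilter (\<lambda>e. k \<notin> keys e) p"
    "q \<in> carrier (poly_ring n)"
    using split_off_variable[of p k] Cons.prems(2) by metis
  have "poly_var k * q \<in> I"
    using ideal.I_r_closed[OF assms(1), of "poly_var k" q] q(2) Cons.prems(1) by simp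
  moreover have "pfilter (\<lambda>e. k \<notin> keys e) p \<in> I"
    using Cons.prems by (intro Cons.IH) (auto intro: pfilter_carrier pfilter_in_var_ideal)
  ultimately show ?case
    using additive_subgroup.a_closed[OF ideal.axioms(1)[OF assms(1)]] q(1) by (metis poly_ring_simps(4))
qed

lemma poly_var_carrier: "i \<le> n \<Longrightarrow> poly_var i \<in> carrier (poly_ring n)"
  using poly_var_part poly_part_carrier by blast

lemma max_ideal_ideal: "ideal (max_ideal n) (poly_ring n :: 'k::field mpoly ring)"
  unfolding max_ideal_def
  by (rule ring.genideal_ideal[OF cring.axioms(1)[OF poly_ring_cring]]) (auto simp: poly_var_carrier)

lemma max_ideal_I:
  fixes p :: "'k::field mpoly"
  assumes "p \<in> carrier (poly_ring n)" "lookup p 0 = 0"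
  shows "p \<in> max_ideal n"
proof (rule in_var_ideal_in_ideal[OF max_ideal_ideal _ assms(1)])
  have "set [0..<Suc n] = {..n}" by auto
  then show "in_var_ideal (set [0..<Suc n]) p"
    using assms in_var_ideal_all_iff[OF assms(1)] by simp
  have "poly_var ` {..n} \<subseteq> (max_ideal n :: 'k mpoly set)"
    unfolding max_ideal_def
    by (rule ring.genideal_self[OF cring.axioms(1)[OF poly_ring_cring]]) (auto simp: poly_var_carrier)
  then show "poly_var ` set [0..<Suc n] \<subseteq> (max_ideal n :: 'k mpoly set)"
    by auto
qed

lemma const_free_ideal: "ideal {p \<in> carrier (poly_ring n). lookup p 0 = 0}
    (poly_ring n :: 'k::field mpoly ring)" (is "ideal ?J _")
proof (rule idealI[OF cring.axioms(1)[OF poly_ring_cring]])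
  interpret cring "poly_ring n :: 'k mpoly ring" by (rule poly_ring_cring)
  have J: "p \<in> ?J \<longleftrightarrow> p \<in> carrier (poly_ring n) \<and> in_var_ideal {..n} p" for p :: "'k mpoly"
    using in_var_ideal_all_iff by auto
  have inv: "\<ominus>\<^bsub>poly_ring n\<^esub> p = - p" if "p \<in> carrier (poly_ring n)" for p :: "'k mpoly"
    using that by (intro minus_equality) (auto simp: carrier_poly_closed)
  show "subgroup ?J (add_monoid (poly_ring n))"
    by (rule add.subgroupI) (auto simp: inv carrier_poly_closed lookup_add intro!: exI[of _ 0])
  fix a x :: "'k mpoly" assume a: "a \<in> ?J" "x \<in> carrier (poly_ring n)"
  then show "x \<otimes>\<^bsub>poly_ring n\<^esub> a \<in> ?J" "a \<otimes>\<^bsub>poly_ring n\<^esub> x \<in> ?J"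
    unfolding J using in_var_ideal_mult[of "{..n}" a x] by (auto simp: carrier_poly_closed mult.commute)
qed

text \<open>The coefficients define the homotopy by which \<open>y\<close> acts as zero on Koszul homology.\<close>

lemma linear_form_expansion:
  assumes "y \<in> poly_part n 1" "in_var_ideal (set ks) y"
  shows "\<exists>as. length as = length ks \<and> set as \<subseteq> poly_part n 0 \<and>
    y = sum_list (map2 (*) as (map poly_var ks))"
  using assms
proof (induction ks arbitrary: y)
  case Nil
  then have "y = 0" by (auto simp: in_var_ideal_def simp flip: keys_eq_empty)
  then show ?case by simp
next
  case (Cons k ks)
  obtain q where q: "y = poly_var k * q + pfilter (\<lambda>e. k \<notin> keys e) y"
    "q \<in> poly_part n (1 - 1)"
    using split_off_variable[of y k] Cons.prems(1) by metis
  obtain as where as: "length as = length ks" "set as \<subseteq> poly_part n 0"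
    "pfilter (\<lambda>e. k \<notin> keys e) y = sum_list (map2 (*) as (map poly_var ks))"
    using Cons.IH[of "pfilter (\<lambda>e. k \<notin> keys e) y"] Cons.prems
    by (auto intro: pfilter_part pfilter_in_var_ideal)
  show ?case
    using q as by (intro exI[of _ "q # as"]) (auto simp: mult.commute)
qed

lemma finite_bounded_exponents:
  "finite {e. keys e \<subseteq> {..n} \<and> monom_degree e \<le> d}"
proof (induction d)
  case 0
  show ?case by (rule finite_subset[of _ "{0}"]) auto
next
  case (Suc d)
  let ?E = "\<lambda>d. {e. keys e \<subseteq> {..n} \<and> monom_degree e \<le> d}"
  have "?E (Suc d) \<subseteq> insert 0 (\<Union>i \<in> {..n}. (\<lambda>e. single i 1 + e) ` ?E d)"
  proof
    fix e assume e: "e \<in> ?E (Suc d)"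
    show "e \<in> insert 0 (\<Union>i \<in> {..n}. (\<lambda>e. single i 1 + e) ` ?E d)"
    proof (cases "e = 0")
      case False
      then obtain i where i: "i \<in> keys e" by (metis ex_in_conv keys_eq_empty)
      define e' where "e' = e - single i 1"
      have e': "e = single i 1 + e'"
        using i by (auto intro!: poly_mapping_eqI simp: e'_def lookup_add lookup_minus lookup_single
          when_def in_keys_iff)
      have "e' \<in> ?E d"
        using e arg_cong[OF e', of monom_degree] arg_cong[OF e', of keys]
        by (auto simp: keys_add_exponent monom_degree_add)
      then show ?thesis using e' i e by auto
    qed simp
  qed
  then show ?case
    by (rule finite_subset) (use Suc.IH in auto)
qed

section \<open>Graded modules and their homogeneous components\<close>

lemma abelian_group_hom_finsum:
  assumes "abelian_group_hom G H h" "c \<in> A \<rightarrow> carrier G"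
  shows "h (finsum G c A) = finsum H (\<lambda>i. h (c i)) A"
proof -
  interpret abelian_group_hom G H h by fact
  show ?thesis using assms(2)
  proof (induction A rule: infinite_finite_induct)
    case (insert x F)
    then show ?case by (auto simp: Pi_def)
  qed (simp_all add: G.finsum_infinite H.finsum_infinite)
qed

lemma abelian_group_hom_by_add:
  assumes "abelian_group G" "abelian_group H" "h \<in> carrier G \<rightarrow> carrier H"
    "\<And>x y. x \<in> carrier G \<Longrightarrow> y \<in> carrier G \<Longrightarrow> h (x \<oplus>\<^bsub>G\<^esub> y) = h x \<oplus>\<^bsub>H\<^esub> h y"
  shows "abelian_group_hom G H h"
  using assms
  by (intro abelian_group_homI group_hom.intro group_hom_axioms.intro)
    (auto simp: hom_def abelian_group.a_group)

definition component :: "('k::field mpoly, 'm) gmodule \<Rightarrow> 'm \<Rightarrow> int \<Rightarrow> 'm" where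
  "component M x = (THE c. (\<forall>j. c j \<in> part M j) \<and> finite {j. c j \<noteq> \<zero>\<^bsub>M\<^esub>} \<and>
        x = (\<Oplus>\<^bsub>M\<^esub>j \<in> {j. c j \<noteq> \<zero>\<^bsub>M\<^esub>}. c j))"

locale gmod = module "poly_ring n" M for n :: nat and M :: "('k::field mpoly, 'm) gmodule" (structure) +
  assumes graded: "graded_module n M"

lemma gmodI: "graded_module n M \<Longrightarrow> gmod n M"
  by (simp add: gmod_def gmod_axioms_def graded_module_def)

context gmod
begin

lemma part_subgroup: "additive_subgroup (part M j) M"
  using graded by (simp add: graded_module_def)

lemma part_carrier: "x \<in> part M j \<Longrightarrow> x \<in> carrier M"
  using additive_subgroup.a_subset[OF part_subgroup] by blast

lemma part_closed:
  "\<zero> \<in> part M j"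
  "x \<in> part M j \<Longrightarrow> y \<in> part M j \<Longrightarrow> x \<oplus> y \<in> part M j"
  "x \<in> part M j \<Longrightarrow> \<ominus> x \<in> part M j"
  "a \<in> poly_part n i \<Longrightarrow> x \<in> part M j \<Longrightarrow> a \<odot> x \<in> part M (i + j)"
  using additive_subgroup.zero_closed[OF part_subgroup] additive_subgroup.a_closed[OF part_subgroup]
    additive_subgroup.a_inv_closed[OF part_subgroup] M.abelian_group_axioms graded
  by (simp_all add: graded_module_def)

lemma part_closed_diff: "x \<in> part M j \<Longrightarrow> y \<in> part M j \<Longrightarrow> x \<ominus> y \<in> part M j"
  by (simp add: a_minus_def part_closed)

lemma finsum_support:
  assumes "finite A" "\<And>j. c j \<in> carrier M" "{j. c j \<noteq> \<zero>} \<subseteq> A"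
  shows "finsum M c {j. c j \<noteq> \<zero>} = finsum M c A"
  using assms by (intro M.add.finprod_mono_neutral_cong_left) auto

lemma component_ex1:
  "x \<in> carrier M \<Longrightarrow> \<exists>!c. (\<forall>j. c j \<in> part M j) \<and> finite {j. c j \<noteq> \<zero>} \<and>
        x = (\<Oplus>\<^bsub>M\<^esub>j \<in> {j. c j \<noteq> \<zero>}. c j)"
  using graded by (simp add: graded_module_def)

lemma component_props:
  assumes "x \<in> carrier M"
  shows "component M x j \<in> part M j" "finite {j. component M x j \<noteq> \<zero>}"
    "x = finsum M (component M x) {j. component M x j \<noteq> \<zero>}"
  using theI'[OF component_ex1[OF assms]] unfolding component_def by blast+

lemma component_carrier: "x \<in> carrier M \<Longrightarrow> component M x j \<in> carrier M"
  using component_props(1) part_carrier by blast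

lemma component_unique:
  assumes "finite A" "\<And>j. c j \<in> part M j" "\<And>j. j \<notin> A \<Longrightarrow> c j = \<zero>" "x = finsum M c A"
  shows "component M x = c"
proof -
  have A: "{j. c j \<noteq> \<zero>} \<subseteq> A" using assms(3) by blast
  have x: "x \<in> carrier M"
    using assms(2,4) part_carrier by (auto intro!: finsum_closed)
  show ?thesis
    unfolding component_def
  proof (rule the1_equality[OF component_ex1[OF x]], intro conjI allI)
    show "finite {j. c j \<noteq> \<zero>}" by (rule finite_subset[OF A assms(1)])
    show "x = finsum M c {j. c j \<noteq> \<zero>}"
      using finsum_support[OF assms(1) _ A] part_carrier[OF assms(2)] assms(4) by simp
  qed (rule assms(2))
qed

lemma component_sum:
  assumes "x \<in> carrier M" "finite A" "\<And>j. j \<notin> A \<Longrightarrow> component M x j = \<zero>"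
  shows "x = finsum M (component M x) A"
  using component_props(3)[OF assms(1)] finsum_support[OF assms(2), of "component M x"] assms component_carrier
  by (metis (mono_tags, lifting) mem_Collect_eq subsetI)

lemma component_part: "x \<in> part M j \<Longrightarrow> component M x = (\<lambda>i. if i = j then x else \<zero>)"
  by (rule component_unique[of "{j}"]) (auto simp: part_closed part_carrier)

lemma component_add:
  assumes "x \<in> carrier M" "y \<in> carrier M"
  shows "component M (x \<oplus> y) j = component M x j \<oplus> component M y j"
proof -
  let ?A = "{j. component M x j \<noteq> \<zero>} \<union> {j. component M y j \<noteq> \<zero>}"
  have fin: "finite ?A" using assms component_props(2) by blast
  have "component M (x \<oplus> y) = (\<lambda>j. component M x j \<oplus> component M y j)"
  proof (rule component_unique[OF fin])
    have "x = finsum M (component M x) ?A" "y = finsum M (component M y) ?A"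
      by (rule component_sum; use assms fin in auto)+
    then show "x \<oplus> y = (\<Oplus>\<^bsub>M\<^esub>j \<in> ?A. component M x j \<oplus> component M y j)"
      using assms component_carrier by (subst M.finsum_addf) auto
  qed (use assms in \<open>auto intro!: part_closed component_props\<close>)
  then show ?thesis by simp
qed

lemma component_smult:
  assumes a: "a \<in> poly_part n i" and x: "x \<in> carrier M"
  shows "component M (a \<odot> x) j = a \<odot> component M x (j - i)"
proof -
  let ?A = "{j. component M x j \<noteq> \<zero>}"
  have ac: "a \<in> carrier (poly_ring n)" using a by (rule poly_part_carrier)
  have "component M (a \<odot> x) = (\<lambda>j. a \<odot> component M x (j - i))"
  proof (rule component_unique)
    show "finite ((\<lambda>j. j + i) ` ?A)" using component_props(2)[OF x] by simp
    show "a \<odot> component M x (j - i) \<in> part M j" for j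
      using part_closed(4)[OF a component_props(1)[OF x], of "j - i"] by simp
    show "a \<odot> component M x (j - i) = \<zero>" if "j \<notin> (\<lambda>j. j + i) ` ?A" for j
    proof -
      have "j - i \<notin> ?A" using that imageI[of "j - i" ?A "\<lambda>j. j + i"] by auto
      then show ?thesis using ac by simp
    qed
    have "a \<odot> x = (\<Oplus>\<^bsub>M\<^esub>j \<in> ?A. a \<odot> component M x j)"
      using finsum_smult_ldistr[OF component_props(2)[OF x] ac, of "component M x"] component_carrier[OF x]
        component_props(3)[OF x] by (simp add: Pi_def)
    also have "\<dots> = (\<Oplus>\<^bsub>M\<^esub>j \<in> (\<lambda>j. j + i) ` ?A. a \<odot> component M x (j - i))"
      using component_carrier[OF x] ac by (subst M.finsum_reindex) (auto simp: inj_on_def)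
    finally show "a \<odot> x = (\<Oplus>\<^bsub>M\<^esub>j \<in> (\<lambda>j. j + i) ` ?A. a \<odot> component M x (j - i))" .
  qed
  then show ?thesis by simp
qed

lemma submodule_of_parts:
  assumes "submodule N (poly_ring n) M" "\<And>j. part M j \<subseteq> N"
  shows "carrier M \<subseteq> N"
proof
  fix x assume x: "x \<in> carrier M"
  note N = submoduleE[OF assms(1)]
  have fs: "finsum M (component M x) A \<in> N" for A
  proof (induction A rule: infinite_finite_induct)
    case (insert j A)
    then show ?case
      using x assms(2)[of j] N(5) component_props(1)[OF x, of j] component_carrier[OF x] by (subst finsum_insert) auto
  next
    case (infinite A)
    then show ?case using assms(2) part_closed(1) by (auto simp: M.finsum_infinite)
  next
    case empty
    then show ?case using assms(2) part_closed(1) by (auto simp: M.finsum_empty)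
  qed
  then show "x \<in> N"
    using component_props(3)[OF x] by metis
qed

end

lemma graded_hom_group_hom:
  assumes "module R M" "module R N" "graded_hom n M N f"
  shows "abelian_group_hom M N f"
  using assms by (intro abelian_group_hom_by_add) (auto simp: graded_hom_def module_def)

lemma graded_homD:
  assumes "graded_hom n M N f"
  shows "x \<in> carrier M \<Longrightarrow> f x \<in> carrier N"
    "x \<in> carrier M \<Longrightarrow> y \<in> carrier M \<Longrightarrow> f (x \<oplus>\<^bsub>M\<^esub> y) = f x \<oplus>\<^bsub>N\<^esub> f y"
    "a \<in> carrier (poly_ring n) \<Longrightarrow> x \<in> carrier M \<Longrightarrow> f (a \<odot>\<^bsub>M\<^esub> x) = a \<odot>\<^bsub>N\<^esub> f x"
    "x \<in> part M j \<Longrightarrow> f x \<in> part N j"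
proof -
  show "x \<in> part M j \<Longrightarrow> f x \<in> part N j"
    using assms unfolding graded_hom_def by blast
qed (use assms in \<open>auto simp: graded_hom_def\<close>)

lemma component_hom:
  assumes "gmod n M" "gmod n N" "graded_hom n M N f" "x \<in> carrier M"
  shows "component N (f x) j = f (component M x j)"
proof -
  interpret M: gmod n M by fact
  interpret N: gmod n N by fact
  interpret f: abelian_group_hom M N f
    by (rule graded_hom_group_hom[OF M.module_axioms N.module_axioms assms(3)])
  have "component N (f x) = (\<lambda>j. f (component M x j))"
  proof (rule N.component_unique[OF M.component_props(2)[OF assms(4)]])
    show "f (component M x j) \<in> part N j" for j
      by (rule graded_homD(4)[OF assms(3) M.component_props(1)[OF assms(4)]])
    show "f x = (\<Oplus>\<^bsub>N\<^esub>j \<in> {j. component M x j \<noteq> \<zero>\<^bsub>M\<^esub>}. f (component M x j))"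
      using abelian_group_hom_finsum[OF f.is_abelian_group_hom, of "component M x" "{j. component M x j \<noteq> \<zero>\<^bsub>M\<^esub>}"]
        M.component_props(3)[OF assms(4)] M.component_carrier[OF assms(4)] by (simp add: Pi_def)
  qed auto
  then show ?thesis by simp
qed

text \<open>An arbitrary preimage can be replaced by its component, since components are unique.\<close>

lemma graded_epi_part:
  assumes "gmod n M" "gmod n N" "graded_epi n M N f" "z \<in> part N j"
  obtains x where "x \<in> part M j" "f x = z"
proof -
  interpret M: gmod n M by fact
  interpret N: gmod n N by fact
  have h: "graded_hom n M N f" and "f ` carrier M = carrier N"
    using assms(3) by (auto simp: graded_epi_def)
  then obtain x where x: "x \<in> carrier M" "f x = z"
    using N.part_carrier[OF assms(4)] by (metis imageE)
  have "f (component M x j) = z"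
    using component_hom[OF assms(1,2) h x(1), of j] x(2) N.component_part[OF assms(4)] by simp
  then show thesis using that M.component_props(1)[OF x(1)] by blast
qed

text \<open>The unique decomposition amounts to additive projections onto the parts, because a projection
  applied to any decomposition recovers its component. For submodules, quotients and free modules
  such projections are at hand.\<close>

lemma graded_module_by_projections:
  assumes M: "module (poly_ring n) M"
    and sub: "\<And>j. additive_subgroup (part M j) M"
    and sm: "\<And>i j a x. a \<in> poly_part n i \<Longrightarrow> x \<in> part M j \<Longrightarrow> a \<odot>\<^bsub>M\<^esub> x \<in> part M (i + j)"
    and pr: "\<And>j x. x \<in> carrier M \<Longrightarrow> pr j x \<in> part M j"
    and pr_add: "\<And>j x y. x \<in> carrier M \<Longrightarrow> y \<in> carrier M \<Longrightarrow> pr j (x \<oplus>\<^bsub>M\<^esub> y) = pr j x \<oplus>\<^bsub>M\<^esub> pr j y"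
    and pr_same: "\<And>j x. x \<in> part M j \<Longrightarrow> pr j x = x"
    and pr_other: "\<And>i j x. x \<in> part M j \<Longrightarrow> i \<noteq> j \<Longrightarrow> pr i x = \<zero>\<^bsub>M\<^esub>"
    and pr_fin: "\<And>x. x \<in> carrier M \<Longrightarrow> finite {j. pr j x \<noteq> \<zero>\<^bsub>M\<^esub>}"
    and pr_sum: "\<And>x. x \<in> carrier M \<Longrightarrow> x = (\<Oplus>\<^bsub>M\<^esub>j \<in> {j. pr j x \<noteq> \<zero>\<^bsub>M\<^esub>}. pr j x)"
  shows "graded_module n M" "x \<in> carrier M \<Longrightarrow> component M x j = pr j x"
proof -
  interpret module "poly_ring n" M by fact
  have pc: "x \<in> carrier M" if "x \<in> part M j" for x j
    using that additive_subgroup.a_subset[OF sub] by blast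
  have uniq: "c = (\<lambda>j. pr j x)"
    if c: "\<forall>j. c j \<in> part M j" "finite {j. c j \<noteq> \<zero>\<^bsub>M\<^esub>}" "x = finsum M c {j. c j \<noteq> \<zero>\<^bsub>M\<^esub>}" for c x
  proof
    fix i
    interpret p: abelian_group_hom M M "pr i"
      by (rule abelian_group_hom_by_add) (use pr pc pr_add M.abelian_group_axioms in auto)
    let ?A = "{j. c j \<noteq> \<zero>\<^bsub>M\<^esub>}"
    have "pr i x = (\<Oplus>\<^bsub>M\<^esub>j \<in> ?A. pr i (c j))"
      using abelian_group_hom_finsum[OF p.is_abelian_group_hom, of c ?A] c pc by (auto simp: Pi_def)
    also have "\<dots> = (\<Oplus>\<^bsub>M\<^esub>j \<in> ?A. if i = j then c j else \<zero>\<^bsub>M\<^esub>)"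
    proof (intro M.finsum_cong')
      show "(\<lambda>j. if i = j then c j else \<zero>\<^bsub>M\<^esub>) \<in> ?A \<rightarrow> carrier M"
        using c(1) pc by (auto split: if_splits) blast+
      show "pr i (c j) = (if i = j then c j else \<zero>\<^bsub>M\<^esub>)" for j
        using c(1) pr_same[of "c j" j] pr_other[of "c j" j i] by (cases "i = j") auto
    qed simp
    also have "\<dots> = c i"
    proof (cases "i \<in> ?A")
      case True
      then show ?thesis using c pc by (intro M.finsum_singleton) auto
    next
      case False
      then have "(\<Oplus>\<^bsub>M\<^esub>j \<in> ?A. if i = j then c j else \<zero>\<^bsub>M\<^esub>) = (\<Oplus>\<^bsub>M\<^esub>j \<in> ?A. \<zero>\<^bsub>M\<^esub>)"
        by (intro M.finsum_cong') auto
      with False show ?thesis by simp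
    qed
    finally show "c i = pr i x" by simp
  qed
  have ex: "\<exists>!c. (\<forall>j. c j \<in> part M j) \<and> finite {j. c j \<noteq> \<zero>\<^bsub>M\<^esub>} \<and>
      x = (\<Oplus>\<^bsub>M\<^esub>j \<in> {j. c j \<noteq> \<zero>\<^bsub>M\<^esub>}. c j)" if x: "x \<in> carrier M" for x
  proof (rule ex1I[of _ "\<lambda>j. pr j x"])
    show "(\<forall>j. pr j x \<in> part M j) \<and> finite {j. pr j x \<noteq> \<zero>\<^bsub>M\<^esub>} \<and>
      x = (\<Oplus>\<^bsub>M\<^esub>j \<in> {j. pr j x \<noteq> \<zero>\<^bsub>M\<^esub>}. pr j x)"
      using pr[OF x] pr_fin[OF x] pr_sum[OF x] by blast
    show "c = (\<lambda>j. pr j x)" if c: "(\<forall>j. c j \<in> part M j) \<and> finite {j. c j \<noteq> \<zero>\<^bsub>M\<^esub>} \<and>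
      x = (\<Oplus>\<^bsub>M\<^esub>j \<in> {j. c j \<noteq> \<zero>\<^bsub>M\<^esub>}. c j)" for c
      using uniq[of c x] c by (elim conjE)
  qed
  show "graded_module n M"
    unfolding graded_module_def by (intro conjI allI ballI M sub sm ex)
  show "component M x j = pr j x" if "x \<in> carrier M"
    using theI'[OF ex[OF that], folded component_def] uniq[of "component M x" x] by metis
qed

subsection \<open>Graded submodules\<close>

definition restrict_gm :: "('k::field mpoly, 'm) gmodule \<Rightarrow> 'm set \<Rightarrow> ('k mpoly, 'm) gmodule" where
  "restrict_gm M N = M\<lparr>carrier := N, part := \<lambda>j. part M j \<inter> N\<rparr>"

lemma restrict_gm_simps [simp]:
  "carrier (restrict_gm M N) = N" "\<zero>\<^bsub>restrict_gm M N\<^esub> = \<zero>\<^bsub>M\<^esub>" "add (restrict_gm M N) = add M"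
  "smult (restrict_gm M N) = smult M" "part (restrict_gm M N) j = part M j \<inter> N"
  by (simp_all add: restrict_gm_def)

lemma restrict_gm_module:
  assumes "module R M" "submodule N R M"
  shows "module R (restrict_gm M N)"
proof -
  interpret module R M by fact
  note N = submoduleE[OF assms(2)]
  have z: "\<zero>\<^bsub>M\<^esub> \<in> N"
    using subgroup.one_closed[OF submodule.axioms(1)[OF assms(2)]] by simp
  show ?thesis
  proof (intro moduleI abelian_groupI)
    show "\<exists>y \<in> carrier (restrict_gm M N). y \<oplus>\<^bsub>restrict_gm M N\<^esub> x = \<zero>\<^bsub>restrict_gm M N\<^esub>"
      if "x \<in> carrier (restrict_gm M N)" for x
      using that N(1) N(3)[of x] M.l_neg[of x] by (intro bexI[of _ "\<ominus>\<^bsub>M\<^esub> x"]) auto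
    show "cring R" by (rule R.cring_axioms)
  qed (use z N in \<open>auto simp: subset_eq M.a_ac smult_l_distr smult_r_distr smult_assoc1\<close>)
qed

lemma restrict_gm_graded:
  assumes "gmod n M" "submodule N (poly_ring n) M" "\<And>x j. x \<in> N \<Longrightarrow> component M x j \<in> N"
  shows "graded_module n (restrict_gm M N)"
proof -
  interpret M: gmod n M by fact
  note N = M.submoduleE[OF assms(2)]
  have z: "\<zero>\<^bsub>M\<^esub> \<in> N"
    using subgroup.one_closed[OF submodule.axioms(1)[OF assms(2)]] by simp
  have m: "module (poly_ring n) (restrict_gm M N)"
    by (rule restrict_gm_module[OF M.module_axioms assms(2)])
  interpret N: module "poly_ring n" "restrict_gm M N" by fact
  interpret i: abelian_group_hom "restrict_gm M N" M "\<lambda>x. x"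
    by (rule abelian_group_hom_by_add) (use N M.abelian_group_axioms N.abelian_group_axioms in auto)
  have inv: "\<ominus>\<^bsub>restrict_gm M N\<^esub> x = \<ominus>\<^bsub>M\<^esub> x" if "x \<in> N" for x
    using i.hom_a_inv[of x] that by simp
  have fs: "finsum (restrict_gm M N) c A = finsum M c A" if "c \<in> A \<rightarrow> N" for c and A :: "int set"
    using abelian_group_hom_finsum[OF i.is_abelian_group_hom, of c A] that by simp
  have xM: "x \<in> N \<Longrightarrow> x \<in> carrier M" for x using N by blast
  show ?thesis
  proof (rule graded_module_by_projections(1)[OF m, where pr = "\<lambda>j x. component M x j"])
    show "additive_subgroup (part (restrict_gm M N) j) (restrict_gm M N)" for j
    proof (rule additive_subgroupI, rule N.add.subgroupI)
      show "part (restrict_gm M N) j \<noteq> {}"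
        using z M.part_closed(1) by auto
      show "\<ominus>\<^bsub>restrict_gm M N\<^esub> a \<in> part (restrict_gm M N) j"
        if "a \<in> part (restrict_gm M N) j" for a
        using that inv[of a] N(3)[of a] M.part_closed(3)[of a j] by simp
    qed (auto simp: N M.part_closed)
    show "x = (\<Oplus>\<^bsub>restrict_gm M N\<^esub>j \<in> {j. component M x j \<noteq> \<zero>\<^bsub>restrict_gm M N\<^esub>}. component M x j)"
      if "x \<in> carrier (restrict_gm M N)" for x
    proof -
      have "component M x \<in> {j. component M x j \<noteq> \<zero>\<^bsub>M\<^esub>} \<rightarrow> N" using assms(3) that by auto
      then show ?thesis using fs M.component_props(3)[OF xM, of x] that by simp
    qed
  qed (use N assms(3) in \<open>auto simp: M.part_closed poly_part_carrier M.component_props xM M.component_add M.component_part\<close>)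
qed

lemma kernel_submodule:
  assumes "module (poly_ring n) M" "module (poly_ring n) N" "graded_hom n M N f"
  shows "submodule (a_kernel M N f) (poly_ring n) M"
proof -
  interpret M: module "poly_ring n" M by fact
  interpret N: module "poly_ring n" N by fact
  interpret f: abelian_group_hom M N f
    by (rule graded_hom_group_hom[OF assms])
  show ?thesis
  proof (rule M.submoduleI)
    have K: "x \<in> a_kernel M N f \<longleftrightarrow> x \<in> carrier M \<and> f x = \<zero>\<^bsub>N\<^esub>" for x
      unfolding a_kernel_def' by blast
    show "a_kernel M N f \<subseteq> carrier M" "\<zero>\<^bsub>M\<^esub> \<in> a_kernel M N f"
      using f.hom_zero M.M.zero_closed unfolding a_kernel_def' by blast+
    show "\<ominus>\<^bsub>M\<^esub> a \<in> a_kernel M N f" if "a \<in> a_kernel M N f" for a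
      using that f.hom_a_inv[of a] f.hom_a_inv[of "\<zero>\<^bsub>M\<^esub>"] unfolding K by simp
    show "a \<oplus>\<^bsub>M\<^esub> b \<in> a_kernel M N f" if "a \<in> a_kernel M N f" "b \<in> a_kernel M N f" for a b
      using that f.hom_add[of a b] unfolding K by simp
    show "a \<odot>\<^bsub>M\<^esub> x \<in> a_kernel M N f" if "a \<in> carrier (poly_ring n)" "x \<in> a_kernel M N f" for a x
      using that graded_homD(3)[OF assms(3), of a x] unfolding K by simp
  qed
qed

lemma kernel_graded:
  assumes "gmod n M" "gmod n N" "graded_hom n M N f"
  shows "graded_module n (restrict_gm M (a_kernel M N f))"
proof -
  interpret M: gmod n M by fact
  interpret N: gmod n N by fact
  show ?thesis
  proof (rule restrict_gm_graded[OF assms(1) kernel_submodule[OF M.module_axioms N.module_axioms assms(3)]])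
    fix x j assume "x \<in> a_kernel M N f"
    then show "component M x j \<in> a_kernel M N f"
      using component_hom[OF assms, of x j] N.component_part[OF N.part_closed(1), of 0] M.component_carrier[of x j]
      by (simp add: a_kernel_def')
  qed
qed

subsection \<open>Quotients\<close>

lemma epi_image_module:
  assumes "module R M"
    and surj: "\<pi> ` carrier M = carrier Q"
    and hadd: "\<And>x y. x \<in> carrier M \<Longrightarrow> y \<in> carrier M \<Longrightarrow> \<pi> (x \<oplus>\<^bsub>M\<^esub> y) = \<pi> x \<oplus>\<^bsub>Q\<^esub> \<pi> y"
    and hsm: "\<And>a x. a \<in> carrier R \<Longrightarrow> x \<in> carrier M \<Longrightarrow> \<pi> (a \<odot>\<^bsub>M\<^esub> x) = a \<odot>\<^bsub>Q\<^esub> \<pi> x"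
    and hzero: "\<pi> \<zero>\<^bsub>M\<^esub> = \<zero>\<^bsub>Q\<^esub>"
  shows "module R Q"
proof -
  interpret module R M by fact
  have rep: "\<exists>x \<in> carrier M. q = \<pi> x" if "q \<in> carrier Q" for q
    using that surj by blast
  have cl: "\<pi> x \<in> carrier Q" if "x \<in> carrier M" for x
    using that surj by blast
  show ?thesis
  proof (intro moduleI abelian_groupI)
    show "cring R" by (rule R.cring_axioms)
    show "\<zero>\<^bsub>Q\<^esub> \<in> carrier Q" using cl[of "\<zero>\<^bsub>M\<^esub>"] hzero by simp
  next
    fix x assume "x \<in> carrier Q"
    then obtain u where u: "u \<in> carrier M" "x = \<pi> u" using rep by blast
    show "\<zero>\<^bsub>Q\<^esub> \<oplus>\<^bsub>Q\<^esub> x = x"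
      using u by (simp add: hzero[symmetric] flip: hadd)
    show "\<exists>y \<in> carrier Q. y \<oplus>\<^bsub>Q\<^esub> x = \<zero>\<^bsub>Q\<^esub>"
      using u by (intro bexI[of _ "\<pi> (\<ominus>\<^bsub>M\<^esub> u)"]) (auto simp: cl hzero[symmetric] M.l_neg simp flip: hadd)
    show "\<one>\<^bsub>R\<^esub> \<odot>\<^bsub>Q\<^esub> x = x" using u by (simp flip: hsm)
    show "a \<odot>\<^bsub>Q\<^esub> x \<in> carrier Q" if "a \<in> carrier R" for a
      using u that by (auto simp: cl simp flip: hsm)
    show "(a \<oplus>\<^bsub>R\<^esub> b) \<odot>\<^bsub>Q\<^esub> x = a \<odot>\<^bsub>Q\<^esub> x \<oplus>\<^bsub>Q\<^esub> b \<odot>\<^bsub>Q\<^esub> x" if "a \<in> carrier R" "b \<in> carrier R" for a b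
      using u that by (simp add: smult_l_distr flip: hsm hadd)
    show "(a \<otimes>\<^bsub>R\<^esub> b) \<odot>\<^bsub>Q\<^esub> x = a \<odot>\<^bsub>Q\<^esub> (b \<odot>\<^bsub>Q\<^esub> x)" if "a \<in> carrier R" "b \<in> carrier R" for a b
      using u that by (simp add: smult_assoc1 flip: hsm)
    fix y assume "y \<in> carrier Q"
    then obtain v where v: "v \<in> carrier M" "y = \<pi> v" using rep by blast
    show "x \<oplus>\<^bsub>Q\<^esub> y \<in> carrier Q" using u v by (auto simp: cl simp flip: hadd)
    show "x \<oplus>\<^bsub>Q\<^esub> y = y \<oplus>\<^bsub>Q\<^esub> x" using u v by (simp add: M.a_comm flip: hadd)
    show "a \<odot>\<^bsub>Q\<^esub> (x \<oplus>\<^bsub>Q\<^esub> y) = a \<odot>\<^bsub>Q\<^esub> x \<oplus>\<^bsub>Q\<^esub> a \<odot>\<^bsub>Q\<^esub> y" if "a \<in> carrier R" for a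
      using u v that by (simp add: smult_r_distr flip: hsm hadd)
    fix z assume "z \<in> carrier Q"
    then obtain w where w: "w \<in> carrier M" "z = \<pi> w" using rep by blast
    show "(x \<oplus>\<^bsub>Q\<^esub> y) \<oplus>\<^bsub>Q\<^esub> z = x \<oplus>\<^bsub>Q\<^esub> (y \<oplus>\<^bsub>Q\<^esub> z)"
      using u v w by (simp add: M.a_assoc flip: hadd)
  qed
qed

text \<open>The components of an element of the image are the images of the components of a
  representative; they do not depend on it because the kernel is homogeneous.\<close>

lemma epi_image_graded:
  assumes "gmod n M"
    and surj: "\<pi> ` carrier M = carrier Q"
    and hadd: "\<And>x y. x \<in> carrier M \<Longrightarrow> y \<in> carrier M \<Longrightarrow> \<pi> (x \<oplus>\<^bsub>M\<^esub> y) = \<pi> x \<oplus>\<^bsub>Q\<^esub> \<pi> y"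
    and hsm: "\<And>a x. a \<in> carrier (poly_ring n) \<Longrightarrow> x \<in> carrier M \<Longrightarrow> \<pi> (a \<odot>\<^bsub>M\<^esub> x) = a \<odot>\<^bsub>Q\<^esub> \<pi> x"
    and hzero: "\<pi> \<zero>\<^bsub>M\<^esub> = \<zero>\<^bsub>Q\<^esub>"
    and part: "\<And>j. part Q j = \<pi> ` part M j"
    and ker: "\<And>x j. x \<in> carrier M \<Longrightarrow> \<pi> x = \<zero>\<^bsub>Q\<^esub> \<Longrightarrow> \<pi> (component M x j) = \<zero>\<^bsub>Q\<^esub>"
  shows "graded_module n Q" "graded_epi n M Q \<pi>"
proof -
  interpret M: gmod n M by fact
  have m: "module (poly_ring n) Q"
    by (rule epi_image_module[OF M.module_axioms surj hadd hsm hzero])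
  interpret Q: module "poly_ring n" Q by fact
  interpret p: abelian_group_hom M Q \<pi>
    by (rule abelian_group_hom_by_add)
      (use M.abelian_group_axioms Q.abelian_group_axioms surj hadd in auto)
  define pr where "pr j q = \<pi> (component M (SOME x. x \<in> carrier M \<and> \<pi> x = q) j)" for j q
  have pr: "pr j (\<pi> x) = \<pi> (component M x j)" if x: "x \<in> carrier M" for x j
  proof -
    define x' where "x' = (SOME x'. x' \<in> carrier M \<and> \<pi> x' = \<pi> x)"
    have x': "x' \<in> carrier M" "\<pi> x' = \<pi> x"
      using someI[of "\<lambda>x'. x' \<in> carrier M \<and> \<pi> x' = \<pi> x" x] x unfolding x'_def by auto
    define w where "w = x' \<ominus>\<^bsub>M\<^esub> x"
    have w: "w \<in> carrier M" "\<pi> w = \<zero>\<^bsub>Q\<^esub>" "x' = x \<oplus>\<^bsub>M\<^esub> w"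
      using x x' by (simp_all add: w_def a_minus_def Q.r_neg M.a_ac M.r_neg2 M.r_neg1 M.r_neg)
    have "pr j (\<pi> x) = \<pi> (component M (x \<oplus>\<^bsub>M\<^esub> w) j)"
      unfolding pr_def x'_def[symmetric] w(3)[symmetric] ..
    also have "\<dots> = \<pi> (component M x j)"
      using x w by (simp add: M.component_add ker M.component_carrier)
    finally show ?thesis .
  qed
  have rep: "\<exists>x \<in> carrier M. q = \<pi> x" if "q \<in> carrier Q" for q
    using that surj by blast
  show "graded_module n Q"
  proof (rule graded_module_by_projections(1)[OF m, where pr = pr])
    show "additive_subgroup (part Q j) Q" for j
    proof (rule additive_subgroupI, rule Q.add.subgroupI)
      show "part Q j \<subseteq> carrier Q"
        unfolding part using M.part_carrier surj by auto
      show "part Q j \<noteq> {}"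
        unfolding part using M.part_closed(1) by auto
      show "\<ominus>\<^bsub>Q\<^esub> a \<in> part Q j" if a: "a \<in> part Q j" for a
      proof -
        obtain x where "x \<in> part M j" "a = \<pi> x" using a unfolding part by blast
        then have "\<ominus>\<^bsub>Q\<^esub> a = \<pi> (\<ominus>\<^bsub>M\<^esub> x)" by (simp add: M.part_carrier)
        then show ?thesis
          using M.part_closed(3)[OF \<open>x \<in> part M j\<close>] unfolding part by auto
      qed
      show "a \<oplus>\<^bsub>Q\<^esub> b \<in> part Q j" if ab: "a \<in> part Q j" "b \<in> part Q j" for a b
      proof -
        obtain x y where "x \<in> part M j" "a = \<pi> x" "y \<in> part M j" "b = \<pi> y"
          using ab unfolding part by blast
        then have "a \<oplus>\<^bsub>Q\<^esub> b = \<pi> (x \<oplus>\<^bsub>M\<^esub> y)" "x \<oplus>\<^bsub>M\<^esub> y \<in> part M j"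
          by (simp_all add: M.part_carrier M.part_closed)
        then show ?thesis unfolding part by simp
      qed
    qed
    show "a \<odot>\<^bsub>Q\<^esub> x \<in> part Q (i + j)" if a: "a \<in> poly_part n i" and x: "x \<in> part Q j" for a x i j
    proof -
      obtain u where "u \<in> part M j" "x = \<pi> u" using x unfolding part by blast
      then show ?thesis
        using a hsm[OF poly_part_carrier[OF a], of u] M.part_closed(4)[OF a, of u j]
        unfolding part by (metis M.part_carrier imageI)
    qed
    show "pr j x \<in> part Q j" if "x \<in> carrier Q" for x j
      using rep[OF that] pr M.component_props(1) unfolding part by auto
    show "pr j (x \<oplus>\<^bsub>Q\<^esub> y) = pr j x \<oplus>\<^bsub>Q\<^esub> pr j y" if xy: "x \<in> carrier Q" "y \<in> carrier Q" for x y j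
    proof -
      obtain u v where uv: "u \<in> carrier M" "x = \<pi> u" "v \<in> carrier M" "y = \<pi> v"
        using rep xy by blast
      then have "pr j (x \<oplus>\<^bsub>Q\<^esub> y) = pr j (\<pi> (u \<oplus>\<^bsub>M\<^esub> v))" by simp
      also have "\<dots> = pr j x \<oplus>\<^bsub>Q\<^esub> pr j y"
        using uv by (subst pr) (auto simp: M.component_add pr M.component_carrier)
      finally show ?thesis .
    qed
    show "pr j x = x" if "x \<in> part Q j" for x j
      using that unfolding part by (auto simp: pr M.part_carrier M.component_part)
    show "pr i x = \<zero>\<^bsub>Q\<^esub>" if "x \<in> part Q j" "i \<noteq> j" for x i j
      using that unfolding part by (auto simp: pr M.part_carrier M.component_part)
    fix x assume "x \<in> carrier Q"
    then obtain u where u: "u \<in> carrier M" "x = \<pi> u" using rep by blast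
    let ?A = "{j. component M u j \<noteq> \<zero>\<^bsub>M\<^esub>}" and ?B = "{j. pr j x \<noteq> \<zero>\<^bsub>Q\<^esub>}"
    have sub: "?B \<subseteq> ?A" using u pr by auto
    show "finite ?B" using finite_subset[OF sub] M.component_props(2)[OF u(1)] .
    have "x = \<pi> (finsum M (component M u) ?A)" using M.component_props(3)[OF u(1)] u(2) by metis
    also have "\<dots> = (\<Oplus>\<^bsub>Q\<^esub>j \<in> ?A. pr j x)"
      unfolding u(2) pr[OF u(1)]
      by (rule abelian_group_hom_finsum[OF p.is_abelian_group_hom]) (use M.component_carrier u in auto)
    also have "\<dots> = (\<Oplus>\<^bsub>Q\<^esub>j \<in> ?B. pr j x)"
      using sub M.component_props(2)[OF u(1)] u pr M.component_carrier
      by (intro Q.M.add.finprod_mono_neutral_cong_right) auto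
    finally show "x = (\<Oplus>\<^bsub>Q\<^esub>j \<in> ?B. pr j x)" .
  qed
  show "graded_epi n M Q \<pi>"
    unfolding graded_epi_def graded_hom_def using surj part by (auto simp: hsm)
qed

lemma quot_module_graded:
  assumes "gmod n M" "submodule N (poly_ring n) M" "\<And>x j. x \<in> N \<Longrightarrow> component M x j \<in> N"
  shows "graded_module n (quot_module M N)"
    "graded_epi n M (quot_module M N) (\<lambda>x. N +>\<^bsub>M\<^esub> x)"
    "\<And>x. x \<in> carrier M \<Longrightarrow> N +>\<^bsub>M\<^esub> x = \<zero>\<^bsub>quot_module M N\<^esub> \<longleftrightarrow> x \<in> N"
proof -
  interpret M: gmod n M by fact
  have sg: "subgroup N (add_monoid M)" by (rule submodule.axioms(1)[OF assms(2)])
  interpret N: abelian_subgroup N M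
    by (rule abelian_subgroupI3[OF additive_subgroupI[OF sg] M.abelian_group_axioms])
  show ker: "N +>\<^bsub>M\<^esub> x = \<zero>\<^bsub>quot_module M N\<^esub> \<longleftrightarrow> x \<in> N" if "x \<in> carrier M" for x
    using N.a_rcos_self[OF that] N.a_rcos_const by (auto simp: quot_module_def)
  have sm: "N +>\<^bsub>M\<^esub> (a \<odot>\<^bsub>M\<^esub> x) = a \<odot>\<^bsub>quot_module M N\<^esub> (N +>\<^bsub>M\<^esub> x)"
    if a: "a \<in> carrier (poly_ring n)" and x: "x \<in> carrier M" for a x
  proof -
    have "N +>\<^bsub>M\<^esub> (a \<odot>\<^bsub>M\<^esub> x') = N +>\<^bsub>M\<^esub> (a \<odot>\<^bsub>M\<^esub> x)" if x': "x' \<in> N +>\<^bsub>M\<^esub> x" for x'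
    proof -
      have xc: "x' \<in> carrier M" using N.a_elemrcos_carrier[OF x x'] .
      have "x' \<oplus>\<^bsub>M\<^esub> \<ominus>\<^bsub>M\<^esub> x \<in> N" using N.a_rcos_module_imp[OF x x'] .
      then have "a \<odot>\<^bsub>M\<^esub> (x' \<oplus>\<^bsub>M\<^esub> \<ominus>\<^bsub>M\<^esub> x) \<in> N"
        using M.submoduleE(4)[OF assms(2) a] by blast
      then have "a \<odot>\<^bsub>M\<^esub> x' \<oplus>\<^bsub>M\<^esub> \<ominus>\<^bsub>M\<^esub> (a \<odot>\<^bsub>M\<^esub> x) \<in> N"
        using a x xc by (simp add: M.smult_r_distr M.smult_r_minus)
      then have "a \<odot>\<^bsub>M\<^esub> x' \<in> N +>\<^bsub>M\<^esub> (a \<odot>\<^bsub>M\<^esub> x)"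
        using N.a_rcos_module_rev[of "a \<odot>\<^bsub>M\<^esub> x" "a \<odot>\<^bsub>M\<^esub> x'"] a x xc by simp
      then show ?thesis
        using N.a_repr_independence'[of "a \<odot>\<^bsub>M\<^esub> x'" "a \<odot>\<^bsub>M\<^esub> x"] a x by simp
    qed
    then have "(\<Union>x' \<in> N +>\<^bsub>M\<^esub> x. N +>\<^bsub>M\<^esub> (a \<odot>\<^bsub>M\<^esub> x')) = N +>\<^bsub>M\<^esub> (a \<odot>\<^bsub>M\<^esub> x)"
      using N.a_rcos_self[OF x] by blast
    then show ?thesis
      by (simp add: quot_module_def)
  qed
  have surj: "(\<lambda>x. N +>\<^bsub>M\<^esub> x) ` carrier M = carrier (quot_module M N)"
    by (auto simp: quot_module_def A_RCOSETS_def')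
  have add: "N +>\<^bsub>M\<^esub> (x \<oplus>\<^bsub>M\<^esub> y) = (N +>\<^bsub>M\<^esub> x) \<oplus>\<^bsub>quot_module M N\<^esub> (N +>\<^bsub>M\<^esub> y)"
    if "x \<in> carrier M" "y \<in> carrier M" for x y
    using N.a_rcos_sum[OF that] by (simp add: quot_module_def)
  have zero: "N +>\<^bsub>M\<^esub> \<zero>\<^bsub>M\<^esub> = \<zero>\<^bsub>quot_module M N\<^esub>"
    using ker[of "\<zero>\<^bsub>M\<^esub>"] N.zero_closed by simp
  have part: "part (quot_module M N) j = (\<lambda>x. N +>\<^bsub>M\<^esub> x) ` part M j" for j
    by (simp add: quot_module_def)
  have component: "N +>\<^bsub>M\<^esub> component M x j = \<zero>\<^bsub>quot_module M N\<^esub>"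
    if "x \<in> carrier M" "N +>\<^bsub>M\<^esub> x = \<zero>\<^bsub>quot_module M N\<^esub>" for x j
    using that(2) assms(3)[of x j] ker[OF that(1)] ker[OF M.component_carrier[OF that(1)]] by simp
  note E = epi_image_graded[OF assms(1) surj add sm zero part component]
  show "graded_module n (quot_module M N)" "graded_epi n M (quot_module M N) (\<lambda>x. N +>\<^bsub>M\<^esub> x)"
    by (rule E; assumption)+
qed

text \<open>Multiplication by a homogeneous element shifts components, so its image is a graded submodule.\<close>

lemma (in gmod) mult_image_submodule:
  assumes "y \<in> poly_part n i"
  shows "submodule (mult_image M y) (poly_ring n) M"
    "x \<in> mult_image M y \<Longrightarrow> component M x j \<in> mult_image M y"
proof -
  have y: "y \<in> carrier (poly_ring n)" using assms by (rule poly_part_carrier)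
  show "submodule (mult_image M y) (poly_ring n) M"
  proof (rule submoduleI)
    show "\<zero> \<in> mult_image M y"
      unfolding mult_image_def using y by (intro image_eqI[of _ _ "\<zero>"]) auto
    show "\<ominus> a \<in> mult_image M y" if a: "a \<in> mult_image M y" for a
    proof -
      obtain u where "u \<in> carrier M" "a = y \<odot> u" using a unfolding mult_image_def by blast
      then show ?thesis
        unfolding mult_image_def using y smult_r_minus[of y u] by (intro image_eqI[of _ _ "\<ominus> u"]) auto
    qed
    show "a \<oplus> b \<in> mult_image M y" if ab: "a \<in> mult_image M y" "b \<in> mult_image M y" for a b
    proof -
      obtain u v where "u \<in> carrier M" "a = y \<odot> u" "v \<in> carrier M" "b = y \<odot> v"
        using ab unfolding mult_image_def by blast
      then show ?thesis
        unfolding mult_image_def using y smult_r_distr[of y u v]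
        by (intro image_eqI[of _ _ "u \<oplus> v"]) auto
    qed
    show "a \<odot> x \<in> mult_image M y" if a: "a \<in> carrier (poly_ring n)" and x: "x \<in> mult_image M y" for a x
    proof -
      obtain u where u: "u \<in> carrier M" "x = y \<odot> u" using x unfolding mult_image_def by blast
      have "a \<odot> x = y \<odot> (a \<odot> u)"
        using smult_assoc1[OF a y u(1)] smult_assoc1[OF y a u(1)] u(2) by (simp add: mult.commute)
      then show ?thesis
        unfolding mult_image_def using a u by (intro image_eqI[of _ _ "a \<odot> u"]) auto
    qed
  qed (use y in \<open>auto simp: mult_image_def\<close>)
  show "component M x j \<in> mult_image M y" if "x \<in> mult_image M y"
    using that component_smult[OF assms] component_carrier unfolding mult_image_def by auto
qed

subsection \<open>Free modules\<close>

lemma free_gmodule_simps [simp]: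
  "f \<in> carrier (free_gmodule n as) \<longleftrightarrow>
     (\<forall>j < length as. f j \<in> carrier (poly_ring n)) \<and> (\<forall>j \<ge> length as. f j = 0)"
  "ring.zero (free_gmodule n as) = (\<lambda>_. 0)"
  "add (free_gmodule n as) = (\<lambda>f g j. f j + g j)"
  "smult (free_gmodule n as) = (\<lambda>a f j. a * f j)"
  "f \<in> part (free_gmodule n as) d \<longleftrightarrow>
     (\<forall>j < length as. f j \<in> poly_part n (d - as ! j)) \<and> (\<forall>j \<ge> length as. f j = 0)"
  by (simp_all add: free_gmodule_def)

lemma free_gmodule_module: "module (poly_ring n) (free_gmodule n as :: ('k::field mpoly, _) gmodule)"
proof (intro moduleI abelian_groupI poly_ring_cring)
  fix x assume "x \<in> carrier (free_gmodule n as :: ('k::field mpoly, _) gmodule)"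
  then show "\<exists>y \<in> carrier (free_gmodule n as). y \<oplus>\<^bsub>free_gmodule n as\<^esub> x = \<zero>\<^bsub>free_gmodule n as\<^esub>"
    by (intro bexI[of _ "\<lambda>j. - x j"]) (auto simp: carrier_poly_closed)
qed (auto simp: carrier_poly_closed algebra_simps)

lemma free_gmodule_uminus:
  "f \<in> carrier (free_gmodule n as) \<Longrightarrow> \<ominus>\<^bsub>free_gmodule n as\<^esub> f = (\<lambda>j. - f j)"
proof -
  interpret module "poly_ring n" "free_gmodule n as" by (rule free_gmodule_module)
  show "f \<in> carrier (free_gmodule n as) \<Longrightarrow> \<ominus>\<^bsub>free_gmodule n as\<^esub> f = (\<lambda>j. - f j)"
    by (intro M.minus_equality) (auto simp: carrier_poly_closed)
qed

lemma free_gmodule_finsum: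
  "finite A \<Longrightarrow> c \<in> A \<rightarrow> carrier (free_gmodule n as) \<Longrightarrow>
     finsum (free_gmodule n as) c A = (\<lambda>i. \<Sum>j \<in> A. c j i)"
proof (induction A rule: finite_induct)
  interpret module "poly_ring n" "free_gmodule n as" by (rule free_gmodule_module)
  { case empty show ?case by (simp add: fun_eq_iff) }
  { case (insert x F)
    then show ?case by (subst M.finsum_insert) (auto simp: fun_eq_iff) }
qed

lemma
  shows free_gmodule_graded: "graded_module n (free_gmodule n as :: ('k::field mpoly, _) gmodule)"
    and component_free_gmodule: "f \<in> carrier (free_gmodule n as :: ('k::field mpoly, _) gmodule) \<Longrightarrow>
      component (free_gmodule n as) f d = (\<lambda>i. if i < length as then poly_component (d - as ! i) (f i) else 0)"
proof -
  let ?F = "free_gmodule n as :: ('k mpoly, _) gmodule"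
  let ?pr = "\<lambda>d (f :: nat \<Rightarrow> 'k mpoly) i. if i < length as then poly_component (d - as ! i) (f i) else 0"
  interpret module "poly_ring n" ?F by (rule free_gmodule_module)
  have sg: "additive_subgroup (part ?F j) ?F" for j
  proof (rule additive_subgroupI, rule add.subgroupI)
    have "(\<lambda>_. 0) \<in> part ?F j" by (simp add: poly_part_closed)
    then show "part ?F j \<noteq> {}" by blast
    show "\<ominus>\<^bsub>?F\<^esub> a \<in> part ?F j" if "a \<in> part ?F j" for a
      using that
      by (subst free_gmodule_uminus) (auto simp: poly_part_closed poly_part_carrier)
    show "part ?F j \<subseteq> carrier ?F" using poly_part_carrier by fastforce
  qed (auto simp: poly_part_closed)
  have sm: "a \<odot>\<^bsub>?F\<^esub> x \<in> part ?F (i + j)" if "a \<in> poly_part n i" "x \<in> part ?F j" for a x i j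
    using that poly_part_closed(4)[of a n i _ "j - _"] by (auto simp: add_diff_eq)
  have pr: "?pr j x \<in> part ?F j" if "x \<in> carrier ?F" for j x
    using that by (simp add: poly_component_part)
  have add: "?pr j (x \<oplus>\<^bsub>?F\<^esub> y) = ?pr j x \<oplus>\<^bsub>?F\<^esub> ?pr j y" for j x y
    by (simp add: fun_eq_iff poly_component_add)
  have same: "?pr j x = x" if "x \<in> part ?F j" for j x
    using that by (auto simp: fun_eq_iff poly_component_same)
  have other: "?pr i x = \<zero>\<^bsub>?F\<^esub>" if "x \<in> part ?F j" "i \<noteq> j" for i j x
    using that by (auto simp: fun_eq_iff intro!: poly_component_other)
  have fin: "finite {j. ?pr j x \<noteq> \<zero>\<^bsub>?F\<^esub>}" for x
  proof (rule finite_subset)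
    show "{j. ?pr j x \<noteq> \<zero>\<^bsub>?F\<^esub>} \<subseteq> (\<Union>i < length as. (\<lambda>d. d + as ! i) ` {d. poly_component d (x i) \<noteq> 0})"
    proof
      fix j assume "j \<in> {j. ?pr j x \<noteq> \<zero>\<^bsub>?F\<^esub>}"
      then obtain i where "i < length as" "poly_component (j - as ! i) (x i) \<noteq> 0"
        by (auto simp: fun_eq_iff split: if_splits)
      then show "j \<in> (\<Union>i < length as. (\<lambda>d. d + as ! i) ` {d. poly_component d (x i) \<noteq> 0})"
        by (intro UN_I[of i] image_eqI[of _ _ "j - as ! i"]) auto
    qed
  qed (simp add: finite_poly_component)
  have sum: "x = (\<Oplus>\<^bsub>?F\<^esub>j \<in> {j. ?pr j x \<noteq> \<zero>\<^bsub>?F\<^esub>}. ?pr j x)" if x: "x \<in> carrier ?F" for x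
  proof
    fix i
    let ?A = "{j. ?pr j x \<noteq> \<zero>\<^bsub>?F\<^esub>}"
    have "(\<Oplus>\<^bsub>?F\<^esub>j \<in> ?A. ?pr j x) i = (\<Sum>j \<in> ?A. ?pr j x i)"
      by (subst free_gmodule_finsum[OF fin]) (use x in \<open>auto simp: poly_part_carrier[OF poly_component_part]\<close>)
    also have "\<dots> = x i"
    proof (cases "i < length as")
      case True
      have "(\<Sum>j \<in> ?A. ?pr j x i) = (\<Sum>d \<in> (\<lambda>j. j - as ! i) ` ?A. poly_component d (x i))"
        using True by (subst sum.reindex) (auto simp: inj_on_def)
      also have "\<dots> = x i"
      proof (rule sum_poly_component)
        show "finite ((\<lambda>j. j - as ! i) ` ?A)" using fin by blast
        show "poly_component d (x i) = 0" if d: "d \<notin> (\<lambda>j. j - as ! i) ` ?A" for d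
        proof (rule ccontr)
          assume nz: "poly_component d (x i) \<noteq> 0"
          have "?pr (d + as ! i) x \<noteq> \<zero>\<^bsub>?F\<^esub>"
          proof
            assume "?pr (d + as ! i) x = \<zero>\<^bsub>?F\<^esub>"
            from fun_cong[OF this, of i] show False using True nz by simp
          qed
          then have "d + as ! i \<in> ?A" by (rule CollectI)
          then have "(d + as ! i) - as ! i \<in> (\<lambda>j. j - as ! i) ` ?A" by (rule imageI)
          then show False using d unfolding add_diff_cancel_right' by contradiction
        qed
      qed
      finally show ?thesis .
    qed (use x in simp)
    finally show "x i = (\<Oplus>\<^bsub>?F\<^esub>j \<in> ?A. ?pr j x) i" by simp
  qed
  note P = graded_module_by_projections[OF free_gmodule_module sg sm pr add same other fin sum]
  show "graded_module n ?F" by (rule P(1))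
  show "component ?F f d = ?pr d f" if "f \<in> carrier ?F" using that by (intro P(2))
qed

section \<open>Koszul complexes\<close>

text \<open>Adding an element \<open>x\<close> to the sequence \<open>xs\<close> turns the Koszul complex \<open>K(xs)\<close> into the mapping cone
  of \<open>x\<close> on it: chains are pairs \<open>(c\<^sub>0, c\<^sub>1)\<close> with differential \<open>(d c\<^sub>0 + x c\<^sub>1, - d c\<^sub>1)\<close>. A basis element of
  the exterior algebra is coded by the list of booleans telling which \<open>e\<^sub>i\<close> occur in it, so a pair is
  one function whose halves are selected by the head of the list. Only the values at lists
  as long as \<open>xs\<close> matter.\<close>

fun koszul_d :: "('a, 'm) gmodule \<Rightarrow> 'a list \<Rightarrow> (bool list \<Rightarrow> 'm) \<Rightarrow> bool list \<Rightarrow> 'm" where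
  "koszul_d M [] c bs = \<zero>\<^bsub>M\<^esub>"
| "koszul_d M (x # xs) c [] = \<zero>\<^bsub>M\<^esub>"
| "koszul_d M (x # xs) c (False # bs) = koszul_d M xs (\<lambda>bs. c (False # bs)) bs \<oplus>\<^bsub>M\<^esub> x \<odot>\<^bsub>M\<^esub> c (True # bs)"
| "koszul_d M (x # xs) c (True # bs) = \<ominus>\<^bsub>M\<^esub> koszul_d M xs (\<lambda>bs. c (True # bs)) bs"

text \<open>Left multiplication by \<open>\<Sum> a\<^sub>i e\<^sub>i\<close> in the exterior algebra.\<close>

fun koszul_h :: "('a, 'm) gmodule \<Rightarrow> 'a list \<Rightarrow> (bool list \<Rightarrow> 'm) \<Rightarrow> bool list \<Rightarrow> 'm" where
  "koszul_h M [] c bs = \<zero>\<^bsub>M\<^esub>"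
| "koszul_h M (a # as) c [] = \<zero>\<^bsub>M\<^esub>"
| "koszul_h M (a # as) c (False # bs) = koszul_h M as (\<lambda>bs. c (False # bs)) bs"
| "koszul_h M (a # as) c (True # bs) = a \<odot>\<^bsub>M\<^esub> c (False # bs) \<ominus>\<^bsub>M\<^esub> koszul_h M as (\<lambda>bs. c (True # bs)) bs"

lemma bool_list_cases:
  obtains "bs = []" | bs' where "bs = False # bs'" | bs' where "bs = True # bs'"
  by (metis (full_types) neq_Nil_conv)

context gmod
begin

lemma koszul_d_closed:
  assumes "set xs \<subseteq> carrier (poly_ring n)" "\<And>bs. c bs \<in> carrier M"
  shows "koszul_d M xs c bs \<in> carrier M"
  using assms
proof (induction xs arbitrary: c bs)
  case (Cons x xs)
  show ?case by (rule bool_list_cases[of bs]) (use Cons in auto)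
qed simp

lemma koszul_h_closed:
  assumes "set as \<subseteq> carrier (poly_ring n)" "\<And>bs. c bs \<in> carrier M"
  shows "koszul_h M as c bs \<in> carrier M"
  using assms
proof (induction as arbitrary: c bs)
  case (Cons x xs)
  show ?case by (rule bool_list_cases[of bs]) (use Cons in auto)
qed simp

lemma koszul_d_hom:
  assumes "abelian_group_hom M N f" "set xs \<subseteq> carrier (poly_ring n)" "\<And>bs. c bs \<in> carrier M"
    "\<And>x m. x \<in> set xs \<Longrightarrow> m \<in> carrier M \<Longrightarrow> f (x \<odot> m) = x \<odot>\<^bsub>N\<^esub> f m"
  shows "f (koszul_d M xs c bs) = koszul_d N xs (\<lambda>bs. f (c bs)) bs"
proof -
  interpret f: abelian_group_hom M N f by fact
  show ?thesis using assms(2-4)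
  proof (induction xs arbitrary: c bs)
    case (Cons x xs)
    show ?case
      by (rule bool_list_cases[of bs])
        (use Cons.prems in \<open>auto simp: koszul_d_closed Cons.IH\<close>)
  qed simp
qed

lemma koszul_h_hom:
  assumes "abelian_group_hom M N f" "set xs \<subseteq> carrier (poly_ring n)" "\<And>bs. c bs \<in> carrier M"
    "\<And>x m. x \<in> set xs \<Longrightarrow> m \<in> carrier M \<Longrightarrow> f (x \<odot> m) = x \<odot>\<^bsub>N\<^esub> f m"
  shows "f (koszul_h M xs c bs) = koszul_h N xs (\<lambda>bs. f (c bs)) bs"
proof -
  interpret f: abelian_group_hom M N f by fact
  show ?thesis using assms(2-4)
  proof (induction xs arbitrary: c bs)
    case (Cons x xs)
    show ?case
      by (rule bool_list_cases[of bs])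
        (use Cons.prems in \<open>auto simp: koszul_h_closed Cons.IH a_minus_def\<close>)
  qed simp
qed

lemma smult_group_hom: "a \<in> carrier (poly_ring n) \<Longrightarrow> abelian_group_hom M M (\<lambda>m. a \<odot> m)"
  by (rule abelian_group_hom_by_add) (auto simp: smult_r_distr M.abelian_group_axioms)

lemma uminus_group_hom: "abelian_group_hom M M (\<lambda>m. \<ominus> m)"
  by (rule abelian_group_hom_by_add) (auto simp: M.minus_add M.abelian_group_axioms)

lemma smult_smult_swap:
  "a \<in> carrier (poly_ring n) \<Longrightarrow> b \<in> carrier (poly_ring n) \<Longrightarrow> m \<in> carrier M \<Longrightarrow>
    a \<odot> (b \<odot> m) = b \<odot> (a \<odot> m)"
  using smult_assoc1[of a b m] smult_assoc1[of b a m] by (simp add: mult.commute)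

lemma koszul_d_smult:
  assumes "a \<in> carrier (poly_ring n)" "set xs \<subseteq> carrier (poly_ring n)" "\<And>bs. c bs \<in> carrier M"
  shows "koszul_d M xs (\<lambda>bs. a \<odot> c bs) bs = a \<odot> koszul_d M xs c bs"
  by (rule koszul_d_hom[OF smult_group_hom, symmetric]) (use assms in \<open>auto intro!: smult_smult_swap\<close>)

lemma koszul_h_smult:
  assumes "a \<in> carrier (poly_ring n)" "set xs \<subseteq> carrier (poly_ring n)" "\<And>bs. c bs \<in> carrier M"
  shows "koszul_h M xs (\<lambda>bs. a \<odot> c bs) bs = a \<odot> koszul_h M xs c bs"
  by (rule koszul_h_hom[OF smult_group_hom, symmetric]) (use assms in \<open>auto intro!: smult_smult_swap\<close>)

lemma koszul_d_uminus:
  assumes "set xs \<subseteq> carrier (poly_ring n)" "\<And>bs. c bs \<in> carrier M"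
  shows "koszul_d M xs (\<lambda>bs. \<ominus> c bs) bs = \<ominus> koszul_d M xs c bs"
  by (rule koszul_d_hom[OF uminus_group_hom, symmetric]) (use assms in \<open>auto simp: smult_r_minus\<close>)

lemma koszul_h_uminus:
  assumes "set xs \<subseteq> carrier (poly_ring n)" "\<And>bs. c bs \<in> carrier M"
  shows "koszul_h M xs (\<lambda>bs. \<ominus> c bs) bs = \<ominus> koszul_h M xs c bs"
  by (rule koszul_h_hom[OF uminus_group_hom, symmetric]) (use assms in \<open>auto simp: smult_r_minus\<close>)

lemma koszul_d_add:
  assumes "set xs \<subseteq> carrier (poly_ring n)" "\<And>bs. c bs \<in> carrier M" "\<And>bs. c' bs \<in> carrier M"
  shows "koszul_d M xs (\<lambda>bs. c bs \<oplus> c' bs) bs = koszul_d M xs c bs \<oplus> koszul_d M xs c' bs"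
  using assms
proof (induction xs arbitrary: c c' bs)
  case (Cons x xs)
  show ?case
    by (rule bool_list_cases[of bs])
      (use Cons.prems in \<open>auto simp: koszul_d_closed Cons.IH smult_r_distr M.minus_add M.a_ac\<close>)
qed simp

lemma koszul_h_add:
  assumes "set xs \<subseteq> carrier (poly_ring n)" "\<And>bs. c bs \<in> carrier M" "\<And>bs. c' bs \<in> carrier M"
  shows "koszul_h M xs (\<lambda>bs. c bs \<oplus> c' bs) bs = koszul_h M xs c bs \<oplus> koszul_h M xs c' bs"
  using assms
proof (induction xs arbitrary: c c' bs)
  case (Cons x xs)
  show ?case
    by (rule bool_list_cases[of bs])
      (use Cons.prems in \<open>auto simp: koszul_h_closed Cons.IH smult_r_distr M.minus_add M.a_ac a_minus_def\<close>)
qed simp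

lemma koszul_d_diff:
  assumes "set xs \<subseteq> carrier (poly_ring n)" "\<And>bs. c bs \<in> carrier M" "\<And>bs. c' bs \<in> carrier M"
  shows "koszul_d M xs (\<lambda>bs. c bs \<ominus> c' bs) bs = koszul_d M xs c bs \<ominus> koszul_d M xs c' bs"
  unfolding a_minus_def using assms by (simp add: koszul_d_add koszul_d_uminus)

lemma koszul_d_zero: "set xs \<subseteq> carrier (poly_ring n) \<Longrightarrow> koszul_d M xs (\<lambda>_. \<zero>) bs = \<zero>"
proof (induction xs arbitrary: bs)
  case (Cons x xs)
  show ?case by (rule bool_list_cases[of bs]) (use Cons in auto)
qed simp

lemma koszul_d_annihilated:
  assumes "\<And>x bs. x \<in> set xs \<Longrightarrow> x \<odot> c bs = \<zero>"
  shows "koszul_d M xs c bs = \<zero>"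
  using assms
proof (induction xs arbitrary: c bs)
  case (Cons x xs)
  show ?case by (rule bool_list_cases[of bs]) (use Cons in auto)
qed simp

lemma koszul_d_in_submodule:
  assumes "submodule N (poly_ring n) M" "\<And>x bs. x \<in> set xs \<Longrightarrow> x \<odot> c bs \<in> N"
  shows "koszul_d M xs c bs \<in> N"
  using assms(2)
proof (induction xs arbitrary: c bs)
  have z: "\<zero> \<in> N"
    using subgroup.one_closed[OF submodule.axioms(1)[OF assms(1)]] by simp
  { case Nil then show ?case using z by simp }
  case (Cons x xs)
  show ?case
    by (rule bool_list_cases[of bs]) (use Cons z submoduleE[OF assms(1)] in auto)
qed

lemma koszul_d_d:
  assumes "set xs \<subseteq> carrier (poly_ring n)" "\<And>bs. c bs \<in> carrier M"
  shows "koszul_d M xs (koszul_d M xs c) bs = \<zero>"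
  using assms
proof (induction xs arbitrary: c bs)
  case (Cons x xs)
  have x: "x \<in> carrier (poly_ring n)" and xs: "set xs \<subseteq> carrier (poly_ring n)"
    using Cons.prems by auto
  show ?case
  proof (rule bool_list_cases[of bs])
    fix bs' assume bs: "bs = False # bs'"
    have "koszul_d M xs (\<lambda>bs. koszul_d M xs (\<lambda>bs. c (False # bs)) bs \<oplus> x \<odot> c (True # bs)) bs' =
        x \<odot> koszul_d M xs (\<lambda>bs. c (True # bs)) bs'"
      using Cons.prems x xs by (simp add: koszul_d_add koszul_d_smult koszul_d_closed Cons.IH)
    then show ?thesis
      using Cons.prems x xs bs by (simp add: koszul_d_closed smult_r_minus M.r_neg)
  next
    fix bs' assume "bs = True # bs'"
    then show ?thesis
      using Cons.prems x xs by (simp add: koszul_d_closed koszul_d_uminus Cons.IH)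
  qed simp
qed simp

lemma add_diff_add_cancel:
  assumes "A \<in> carrier M" "B \<in> carrier M" "Y \<in> carrier M" "U \<in> carrier M"
  shows "(A \<oplus> (Y \<ominus> U)) \<oplus> (B \<oplus> U) = Y \<oplus> (A \<oplus> B)"
proof -
  have "(A \<oplus> (Y \<oplus> Z)) \<oplus> (B \<oplus> U) = (Y \<oplus> (A \<oplus> B)) \<oplus> (Z \<oplus> U)"
    if "Z \<in> carrier M" for Z
    using assms that by (simp add: M.a_ac)
  then show ?thesis
    using assms by (simp add: a_minus_def M.l_neg)
qed

text \<open>Hence \<open>\<Sum> a\<^sub>i x\<^sub>i\<close> acts as zero on Koszul homology.\<close>

lemma koszul_homotopy:
  assumes "length as = length xs" "set as \<subseteq> carrier (poly_ring n)" "set xs \<subseteq> carrier (poly_ring n)"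
    "\<And>bs. c bs \<in> carrier M" "length bs = length xs"
  shows "koszul_d M xs (koszul_h M as c) bs \<oplus> koszul_h M as (koszul_d M xs c) bs =
    sum_list (map2 (*) as xs) \<odot> c bs"
  using assms
proof (induction as xs arbitrary: c bs rule: list_induct2)
  case Nil
  then show ?case using smult_l_null[of "c bs"] by simp
next
  case (Cons a as x xs)
  let ?s = "sum_list (map2 (*) as xs)"
  have as: "a \<in> carrier (poly_ring n)" "set as \<subseteq> carrier (poly_ring n)"
    and xs: "x \<in> carrier (poly_ring n)" "set xs \<subseteq> carrier (poly_ring n)"
    using Cons.prems by auto
  have s: "?s \<in> carrier (poly_ring n)"
    using Cons.hyps as(2) xs(2)
    by (induction as xs rule: list_induct2) (auto simp: carrier_poly_closed)
  have c: "c bs \<in> carrier M" for bs using Cons.prems by blast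
  have split: "(a * x + ?s) \<odot> m = a \<odot> (x \<odot> m) \<oplus> ?s \<odot> m" if "m \<in> carrier M" for m
    using smult_l_distr[of "a * x" ?s m] smult_assoc1[of a x m] that as xs s
    by (simp add: carrier_poly_closed)
  obtain b bs' where bs: "bs = b # bs'" "length bs' = length xs"
    using Cons.prems(4) by (cases bs) auto
  note closed = koszul_d_closed[OF xs(2)] koszul_h_closed[OF as(2)]
  show ?case
  proof (cases b)
    case False
    let ?c0 = "\<lambda>bs. c (False # bs)" and ?c1 = "\<lambda>bs. c (True # bs)"
    let ?A = "koszul_d M xs (koszul_h M as ?c0) bs'" and ?B = "koszul_h M as (koszul_d M xs ?c0) bs'"
      and ?X = "x \<odot> koszul_h M as ?c1 bs'" and ?Y = "a \<odot> (x \<odot> c (False # bs'))"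
    have mem: "?A \<in> carrier M" "?B \<in> carrier M" "?X \<in> carrier M" "?Y \<in> carrier M"
      using c as xs by (auto intro!: closed)
    have "koszul_h M as (\<lambda>bs. koszul_d M xs ?c0 bs \<oplus> x \<odot> ?c1 bs) bs' = ?B \<oplus> ?X"
      using c as xs by (simp add: koszul_h_add koszul_h_smult closed)
    moreover have "x \<odot> (a \<odot> c (False # bs') \<ominus> koszul_h M as ?c1 bs') = ?Y \<ominus> ?X"
      using c as xs
      by (simp add: a_minus_def smult_r_distr smult_r_minus closed smult_smult_swap[of a x])
    moreover have "?A \<oplus> ?B = ?s \<odot> c (False # bs')"
      using Cons.IH[OF as(2) xs(2), of ?c0 bs'] c bs by simp
    moreover have "(?A \<oplus> (?Y \<ominus> ?X)) \<oplus> (?B \<oplus> ?X) = ?Y \<oplus> (?A \<oplus> ?B)"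
      using mem(1,2,4,3) by (rule add_diff_add_cancel)
    ultimately show ?thesis
      using False bs c split by simp
  next
    case True
    let ?c0 = "\<lambda>bs. c (False # bs)" and ?c1 = "\<lambda>bs. c (True # bs)"
    let ?A = "koszul_d M xs (koszul_h M as ?c1) bs'" and ?B = "koszul_h M as (koszul_d M xs ?c1) bs'"
      and ?X = "a \<odot> koszul_d M xs ?c0 bs'" and ?Y = "a \<odot> (x \<odot> c (True # bs'))"
    have mem: "?A \<in> carrier M" "?B \<in> carrier M" "?X \<in> carrier M" "?Y \<in> carrier M"
      using c as xs by (auto intro!: closed)
    have "koszul_d M xs (\<lambda>bs. a \<odot> ?c0 bs \<ominus> koszul_h M as ?c1 bs) bs' = ?X \<ominus> ?A"
      using c as xs by (simp add: koszul_d_diff koszul_d_smult closed)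
    moreover have "a \<odot> (koszul_d M xs ?c0 bs' \<oplus> x \<odot> c (True # bs')) = ?X \<oplus> ?Y"
      using c as xs by (simp add: smult_r_distr closed)
    moreover have "koszul_h M as (\<lambda>bs. \<ominus> koszul_d M xs ?c1 bs) bs' = \<ominus> ?B"
      using c as xs by (simp add: koszul_h_uminus closed)
    moreover have "?A \<oplus> ?B = ?s \<odot> c (True # bs')"
      using Cons.IH[OF as(2) xs(2), of ?c1 bs'] c bs by simp
    moreover have "\<ominus> (?X \<ominus> ?A) \<oplus> ((?X \<oplus> ?Y) \<ominus> \<ominus> ?B) = ?Y \<oplus> (?A \<oplus> ?B)"
      using add_diff_add_cancel[OF mem(1,2,4,3)] mem by (simp add: a_minus_def M.minus_add M.a_ac)
    ultimately show ?thesis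
      using True bs c split by simp
  qed
qed

end

subsection \<open>Homogeneous chains\<close>

text \<open>Chains of homological degree \<open>p\<close> with coefficients in \<open>M\<^sub>j\<close>. The differential goes to
  homological degree \<open>p - 1\<close> and coefficient degree \<open>j + 1\<close>. As \<open>p\<close> is an integer, chains of
  degree \<open>-1\<close> exist and are zero, so that cycles of degree \<open>0\<close> are no special case.\<close>

definition koszul_chains :: "nat \<Rightarrow> ('k::field mpoly, 'm) gmodule \<Rightarrow> int \<Rightarrow> int \<Rightarrow> (bool list \<Rightarrow> 'm) set" where
  "koszul_chains m M p j = {c. (\<forall>bs. c bs \<in> part M j) \<and>
     (\<forall>bs. length bs \<noteq> m \<or> int (count_list bs True) \<noteq> p \<longrightarrow> c bs = \<zero>\<^bsub>M\<^esub>)}"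

lemma chainsI:
  assumes "\<And>bs. c bs \<in> part M j" "\<And>bs. length bs \<noteq> m \<or> int (count_list bs True) \<noteq> p \<Longrightarrow> c bs = \<zero>\<^bsub>M\<^esub>"
  shows "c \<in> koszul_chains m M p j"
  using assms by (simp add: koszul_chains_def)

lemma chainsD:
  assumes "c \<in> koszul_chains m M p j"
  shows "c bs \<in> part M j" "length bs \<noteq> m \<or> int (count_list bs True) \<noteq> p \<Longrightarrow> c bs = \<zero>\<^bsub>M\<^esub>"
  using assms by (auto simp: koszul_chains_def)

lemma chains_tails:
  assumes "c \<in> koszul_chains (Suc m) M p j"
  shows "(\<lambda>bs. c (False # bs)) \<in> koszul_chains m M p j" "(\<lambda>bs. c (True # bs)) \<in> koszul_chains m M (p - 1) j"
  using assms by (auto simp: koszul_chains_def)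

lemma chains_trivial:
  assumes "c \<in> koszul_chains m M p j" "p < 0 \<or> int m < p"
  shows "c = (\<lambda>_. \<zero>\<^bsub>M\<^esub>)"
proof
  fix bs
  have "length bs \<noteq> m \<or> int (count_list bs True) \<noteq> p"
    using assms(2) count_le_length[of bs True] by auto
  then show "c bs = \<zero>\<^bsub>M\<^esub>" using chainsD(2)[OF assms(1)] by blast
qed

context gmod
begin

lemma chains_carrier: "c \<in> koszul_chains m M p j \<Longrightarrow> c bs \<in> carrier M"
  using chainsD(1) part_carrier by blast

lemma chains_zero: "(\<lambda>_. \<zero>) \<in> koszul_chains m M p j"
  by (simp add: koszul_chains_def part_closed)

lemma chains_add: "c \<in> koszul_chains m M p j \<Longrightarrow> c' \<in> koszul_chains m M p j \<Longrightarrow> (\<lambda>bs. c bs \<oplus> c' bs) \<in> koszul_chains m M p j"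
  by (rule chainsI) (auto simp: chainsD part_closed)

lemma chains_diff: "c \<in> koszul_chains m M p j \<Longrightarrow> c' \<in> koszul_chains m M p j \<Longrightarrow> (\<lambda>bs. c bs \<ominus> c' bs) \<in> koszul_chains m M p j"
  by (rule chainsI) (auto simp: chainsD part_closed a_minus_def M.r_neg)

lemma chains_uminus: "c \<in> koszul_chains m M p j \<Longrightarrow> (\<lambda>bs. \<ominus> c bs) \<in> koszul_chains m M p j"
  by (rule chainsI) (auto simp: chainsD part_closed)

lemma chains_smult: "a \<in> poly_part n i \<Longrightarrow> c \<in> koszul_chains m M p j \<Longrightarrow> (\<lambda>bs. a \<odot> c bs) \<in> koszul_chains m M p (i + j)"
  by (rule chainsI) (auto simp: chainsD part_closed poly_part_carrier)

lemma koszul_d_chains: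
  assumes "set xs \<subseteq> poly_part n 1" "c \<in> koszul_chains (length xs) M p j"
  shows "koszul_d M xs c \<in> koszul_chains (length xs) M (p - 1) (j + 1)"
  using assms
proof (induction xs arbitrary: c p)
  case Nil
  then show ?case by (intro chainsI) (auto simp: part_closed)
next
  case (Cons x xs)
  have c: "c \<in> koszul_chains (Suc (length xs)) M p j" using Cons.prems by simp
  have x: "x \<in> poly_part n 1" using Cons.prems by simp
  note t = chains_tails[OF c]
  have d: "koszul_d M xs (\<lambda>bs. c (False # bs)) \<in> koszul_chains (length xs) M (p - 1) (j + 1)"
    "koszul_d M xs (\<lambda>bs. c (True # bs)) \<in> koszul_chains (length xs) M (p - 1 - 1) (j + 1)"
    using Cons.prems t by (intro Cons.IH; simp)+
  have s: "(\<lambda>bs. x \<odot> c (True # bs)) \<in> koszul_chains (length xs) M (p - 1) (j + 1)"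
    using chains_smult[OF x t(2)] by (simp add: add.commute)
  show ?case
  proof (rule chainsI)
    fix bs
    show "koszul_d M (x # xs) c bs \<in> part M (j + 1)"
      by (rule bool_list_cases[of bs])
        (auto simp: part_closed chainsD[OF d(1)] chainsD[OF d(2)] chainsD[OF s])
    assume "length bs \<noteq> length (x # xs) \<or> int (count_list bs True) \<noteq> p - 1"
    then show "koszul_d M (x # xs) c bs = \<zero>"
      by (rule_tac bool_list_cases[of bs])
        (auto simp: chainsD(2)[OF d(1)] chainsD(2)[OF d(2)] chainsD(2)[OF s])
  qed
qed

lemma koszul_h_chains:
  assumes "set as \<subseteq> poly_part n 0" "c \<in> koszul_chains (length as) M p j"
  shows "koszul_h M as c \<in> koszul_chains (length as) M (p + 1) j"
  using assms
proof (induction as arbitrary: c p)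
  case Nil
  then show ?case by (intro chainsI) (auto simp: part_closed)
next
  case (Cons x xs)
  have c: "c \<in> koszul_chains (Suc (length xs)) M p j" using Cons.prems by simp
  have x: "x \<in> poly_part n 0" using Cons.prems by simp
  note t = chains_tails[OF c]
  have d: "koszul_h M xs (\<lambda>bs. c (False # bs)) \<in> koszul_chains (length xs) M (p + 1) j"
    "koszul_h M xs (\<lambda>bs. c (True # bs)) \<in> koszul_chains (length xs) M (p - 1 + 1) j"
    using Cons.prems t by (intro Cons.IH; simp)+
  have s: "(\<lambda>bs. x \<odot> c (False # bs)) \<in> koszul_chains (length xs) M p j"
    using chains_smult[OF x t(1)] by simp
  show ?case
  proof (rule chainsI)
    fix bs
    show "koszul_h M (x # xs) c bs \<in> part M j"
      by (rule bool_list_cases[of bs])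
        (auto simp: part_closed part_closed_diff chainsD[OF d(1)] chainsD[OF d(2)] chainsD[OF s])
    assume "length bs \<noteq> length (x # xs) \<or> int (count_list bs True) \<noteq> p + 1"
    then show "koszul_h M (x # xs) c bs = \<zero>"
      by (rule_tac bool_list_cases[of bs])
        (auto simp: chainsD(2)[OF d(1)] chainsD(2)[OF d(2)] chainsD(2)[OF s] a_minus_def M.r_neg)
  qed
qed

end

lemma chains_hom:
  assumes "gmod n M" "gmod n N" "graded_hom n M N f" "c \<in> koszul_chains m M p j"
  shows "(\<lambda>bs. f (c bs)) \<in> koszul_chains m N p j"
proof -
  interpret M: gmod n M by fact
  interpret N: gmod n N by fact
  interpret f: abelian_group_hom M N f
    by (rule graded_hom_group_hom[OF M.module_axioms N.module_axioms assms(3)])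
  show ?thesis
    by (rule chainsI) (auto simp: chainsD[OF assms(4)] graded_homD(4)[OF assms(3)])
qed

text \<open>Zero coefficients are lifted to zero, so that the support condition survives.\<close>

lemma chains_lift:
  assumes "gmod n M" "gmod n N" "graded_epi n M N f" "z \<in> koszul_chains m N p j"
  obtains c where "c \<in> koszul_chains m M p j" "\<And>bs. f (c bs) = z bs"
proof -
  interpret M: gmod n M by fact
  interpret N: gmod n N by fact
  interpret f: abelian_group_hom M N f
    by (rule graded_hom_group_hom[OF M.module_axioms N.module_axioms])
      (rule conjunct1[OF assms(3)[unfolded graded_epi_def]])
  have "\<exists>x. x \<in> part M j \<and> f x = z bs \<and> (z bs = \<zero>\<^bsub>N\<^esub> \<longrightarrow> x = \<zero>\<^bsub>M\<^esub>)" for bs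
    using graded_epi_part[OF assms(1-3) chainsD(1)[OF assms(4)], of bs] M.part_closed(1) f.hom_zero
    by metis
  then obtain c where c: "\<And>bs. c bs \<in> part M j" "\<And>bs. f (c bs) = z bs"
    "\<And>bs. z bs = \<zero>\<^bsub>N\<^esub> \<Longrightarrow> c bs = \<zero>\<^bsub>M\<^esub>"
    by metis
  show thesis
    by (rule that[of c]) (use c chainsD(2)[OF assms(4)] in \<open>auto intro!: chainsI\<close>)
qed

definition vars :: "nat \<Rightarrow> 'k::field mpoly list" where
  "vars n = map poly_var [0..<Suc n]"

lemma vars_simps: "length (vars n) = Suc n" "set (vars n) = poly_var ` {..n}"
  "set (vars n) \<subseteq> poly_part n 1" "set (vars n) \<subseteq> carrier (poly_ring n)"
  by (auto simp: vars_def poly_var_part poly_var_carrier simp del: upt_Suc)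

lemma koszul_d_graded_hom:
  assumes "gmod n M" "gmod n N" "graded_hom n M N f" "\<And>bs. c bs \<in> carrier M"
  shows "f (koszul_d M (vars n) c bs) = koszul_d N (vars n) (\<lambda>bs. f (c bs)) bs"
proof -
  interpret M: gmod n M by fact
  interpret N: gmod n N by fact
  show ?thesis
    by (rule M.koszul_d_hom[OF graded_hom_group_hom[OF M.module_axioms N.module_axioms assms(3)]])
      (use assms(4) vars_simps(4)[of n] graded_homD(3)[OF assms(3)] in auto)
qed

subsection \<open>Acyclicity for free modules\<close>

lemma koszul_d_free_in_var_ideal:
  assumes "\<And>bs. c bs \<in> carrier (free_gmodule n as)" "set ks \<subseteq> {..n}"
  shows "in_var_ideal (set ks) (koszul_d (free_gmodule n as) (map poly_var ks) c bs i)"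
  using assms
proof (induction ks arbitrary: c bs)
  case (Cons k ks)
  interpret gmod n "free_gmodule n as" by (rule gmodI[OF free_gmodule_graded])
  have IH: "in_var_ideal (set (k # ks)) (koszul_d (free_gmodule n as) (map poly_var ks) (\<lambda>bs. c (b # bs)) bs' i)"
    for b bs'
    by (rule in_var_ideal_mono[OF Cons.IH]) (use Cons.prems in auto)
  have cl: "koszul_d (free_gmodule n as) (map poly_var ks) (\<lambda>bs. c (b # bs)) bs' \<in> carrier (free_gmodule n as)"
    for b bs'
    by (rule koszul_d_closed) (use Cons.prems in \<open>auto intro!: poly_var_carrier\<close>)
  have kk: "in_var_ideal (set (k # ks)) (poly_var k * c (True # bs') i)" for bs'
    using in_var_ideal_mult[OF in_var_ideal_var[of k "set (k # ks)"], of "c (True # bs') i"]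
    by (simp add: mult.commute)
  show ?case
  proof (rule bool_list_cases[of bs])
    show ?thesis if "bs = []" using that by simp
    show ?thesis if "bs = False # bs'" for bs'
      using that IH[of False bs'] kk[of bs'] by (simp add: in_var_ideal_add del: list.set)
    show ?thesis if "bs = True # bs'" for bs'
      using that IH[of True bs'] by (simp add: free_gmodule_uminus[OF cl] del: list.set)
  qed
qed simp

lemma free_split_off_variable:
  fixes as :: "int list" and f :: "nat \<Rightarrow> 'k::field mpoly"
  assumes "f \<in> part (free_gmodule n as) j" "\<And>i. in_var_ideal (insert k K) (f i)"
  obtains q f' where "q \<in> part (free_gmodule n as) (j - 1)" "f' \<in> part (free_gmodule n as) j"
    "\<And>i. in_var_ideal K (f' i)" "f = (\<lambda>i. f' i + poly_var k * q i)"
    "f = (\<lambda>_. 0) \<Longrightarrow> q = (\<lambda>_. 0)" "f = (\<lambda>_. 0) \<Longrightarrow> f' = (\<lambda>_. 0)"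
proof -
  have "\<exists>q. f i = pfilter (\<lambda>e. k \<notin> keys e) (f i) + poly_var k * q \<and>
     (i < length as \<longrightarrow> q \<in> poly_part n (j - as ! i - 1)) \<and> (f i = 0 \<longrightarrow> q = 0)" for i
  proof (cases "f i = 0")
    case True
    then show ?thesis by (intro exI[of _ 0]) (auto simp: poly_part_closed intro!: poly_mapping_eqI)
  next
    case False
    then have i: "i < length as" using assms(1) by (meson free_gmodule_simps(5) not_le)
    obtain q where "f i = poly_var k * q + pfilter (\<lambda>e. k \<notin> keys e) (f i)"
      "\<And>n j. f i \<in> poly_part n j \<Longrightarrow> q \<in> poly_part n (j - 1)"
      using split_off_variable[of "f i" k] by metis
    then show ?thesis using False assms(1) i by (auto simp: add.commute)
  qed
  then obtain q where q: "\<And>i. f i = pfilter (\<lambda>e. k \<notin> keys e) (f i) + poly_var k * q i"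
    "\<And>i. i < length as \<Longrightarrow> q i \<in> poly_part n (j - as ! i - 1)" "\<And>i. f i = 0 \<Longrightarrow> q i = 0"
    by metis
  show thesis
  proof (rule that[of q "\<lambda>i. pfilter (\<lambda>e. k \<notin> keys e) (f i)"])
    have "j - as ! i - 1 = j - 1 - as ! i" for i by simp
    then show "q \<in> part (free_gmodule n as) (j - 1)"
      using q assms(1) by (metis (no_types, lifting) free_gmodule_simps(5))
  qed (use q assms in \<open>auto simp: pfilter_part intro: pfilter_in_var_ideal intro!: poly_mapping_eqI\<close>)
qed

text \<open>Induction on the mapping cone. For a cycle \<open>(c\<^sub>0, c\<^sub>1)\<close> one has \<open>d c\<^sub>1 = 0\<close> and \<open>x c\<^sub>1 = - d c\<^sub>0\<close>.
  The second equation shows, if \<open>c\<^sub>1\<close> has degree \<open>0\<close>, that \<open>x c\<^sub>1\<close> and hence \<open>c\<^sub>1\<close> lies in the ideal of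
  the earlier variables. So \<open>c\<^sub>1 = d u\<close>, then \<open>c\<^sub>0 + x u\<close> is a cycle \<open>d v\<close>, and \<open>(v, - u)\<close> bounds
  \<open>(c\<^sub>0, c\<^sub>1)\<close>. In degree \<open>0\<close> the statement is that elements of the ideal are combinations of the
  variables.\<close>

lemma free_koszul_exact_aux:
  fixes n :: nat and as :: "int list" and c :: "bool list \<Rightarrow> nat \<Rightarrow> 'k::field mpoly"
  defines "F \<equiv> free_gmodule n as"
  assumes "distinct ks" "set ks \<subseteq> {..n}" "c \<in> koszul_chains (length ks) F p j"
    "\<And>bs. koszul_d F (map poly_var ks) c bs = (\<lambda>_. 0)"
    "\<And>bs i. p = 0 \<Longrightarrow> in_var_ideal (set ks) (c bs i)"
  shows "\<exists>b \<in> koszul_chains (length ks) F (p + 1) (j - 1). koszul_d F (map poly_var ks) b = c"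
  using assms(2-)
proof (induction ks arbitrary: c p j)
  case Nil
  have "c bs i = 0" for bs i
  proof (cases "bs = [] \<and> p = 0")
    case True
    then show ?thesis using Nil(5)[of bs i] by (simp add: in_var_ideal_def flip: keys_eq_empty)
  next
    case False
    then have "c bs = \<zero>\<^bsub>F\<^esub>" by (intro chainsD(2)[OF Nil(3)]) auto
    then show ?thesis by (simp add: F_def)
  qed
  moreover have "(\<lambda>_ _. 0) \<in> koszul_chains 0 F (p + 1) (j - 1)"
    by (auto simp: koszul_chains_def F_def poly_part_closed)
  ultimately show ?case
    by (intro bexI[of _ "\<lambda>_ _. 0"]) (auto simp: fun_eq_iff F_def)
next
  case (Cons k ks)
  interpret gmod n F unfolding F_def by (rule gmodI[OF free_gmodule_graded])
  let ?m = "length ks" and ?xs = "map poly_var ks :: 'k mpoly list" and ?x = "poly_var k :: 'k mpoly"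
  define c0 where "c0 = (\<lambda>bs. c (False # bs))"
  define c1 where "c1 = (\<lambda>bs. c (True # bs))"
  have ks: "distinct ks" "set ks \<subseteq> {..n}" "k \<notin> set ks" "k \<le> n" using Cons.prems by auto
  have x: "?x \<in> poly_part n 1" "?x \<in> carrier (poly_ring n)"
    and xs: "set ?xs \<subseteq> poly_part n 1" "set ?xs \<subseteq> carrier (poly_ring n)"
    using ks by (auto intro!: poly_var_part poly_var_carrier)
  have F: "\<zero>\<^bsub>F\<^esub> = (\<lambda>_. 0)" "add F = (\<lambda>f g j. f j + g j)" "smult F = (\<lambda>a f j. a * f j)"
    by (simp_all add: F_def)
  have minus: "\<ominus>\<^bsub>F\<^esub> f = (\<lambda>j. - f j)" if "f \<in> carrier F" for f
    using that unfolding F_def by (rule free_gmodule_uminus)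
  have c: "c \<in> koszul_chains (Suc ?m) F p j" using Cons.prems(3) by simp
  have t: "c0 \<in> koszul_chains ?m F p j" "c1 \<in> koszul_chains ?m F (p - 1) j"
    using chains_tails[OF c] by (simp_all add: c0_def c1_def)
  have d1: "koszul_d F ?xs c1 bs = (\<lambda>_. 0)" for bs
  proof -
    have "\<ominus>\<^bsub>F\<^esub> koszul_d F ?xs c1 bs = \<zero>\<^bsub>F\<^esub>"
      using Cons.prems(4)[of "True # bs"] by (simp add: c1_def F)
    then have "(\<lambda>j. - koszul_d F ?xs c1 bs j) = (\<lambda>_. 0)"
      using minus[OF koszul_d_closed[OF xs(2), of c1 bs, OF chains_carrier[OF t(2)]]] F(1) by simp
    then show ?thesis by (simp add: fun_eq_iff)
  qed
  have d0: "koszul_d F ?xs c0 bs i + ?x * c1 bs i = 0" for bs i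
    using fun_cong[OF Cons.prems(4)[of "False # bs"], of i] by (simp add: c0_def c1_def F)
  have trivial: "c' bs = (\<lambda>_. 0)" if "c' \<in> koszul_chains ?m F (- 1) i" for c' i bs
    using chains_trivial[OF that] F(1) by simp
  have pair: ?case
    if vu: "v \<in> koszul_chains ?m F (p + 1) (j - 1)" "u \<in> koszul_chains ?m F p (j - 1)"
      "\<And>bs i. koszul_d F ?xs v bs i + ?x * u bs i = c0 bs i"
      "\<And>bs i. - koszul_d F ?xs u bs i = c1 bs i" for u v
  proof -
    define b where "b = (\<lambda>bs. case bs of [] \<Rightarrow> \<zero>\<^bsub>F\<^esub> | b # bs \<Rightarrow> if b then u bs else v bs)"
    have "b \<in> koszul_chains (Suc ?m) F (p + 1) (j - 1)"
    proof (rule chainsI)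
      fix bs
      show "b bs \<in> part F (j - 1)"
        by (rule bool_list_cases[of bs]) (auto simp: b_def part_closed chainsD[OF vu(1)] chainsD[OF vu(2)])
      assume "length bs \<noteq> Suc ?m \<or> int (count_list bs True) \<noteq> p + 1"
      then show "b bs = \<zero>\<^bsub>F\<^esub>"
        by (rule_tac bool_list_cases[of bs])
          (auto simp: b_def chainsD(2)[OF vu(1)] chainsD(2)[OF vu(2)])
    qed
    moreover have "koszul_d F (?x # ?xs) b bs = c bs" for bs
    proof (rule bool_list_cases[of bs])
      show ?thesis if "bs = []" using that chainsD(2)[OF c, of "[]"] by simp
      show ?thesis if bs: "bs = False # bs'" for bs'
        using bs vu(3) by (auto simp: b_def F c0_def)
      show ?thesis if bs: "bs = True # bs'" for bs'
        using bs vu(4)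
          minus[OF koszul_d_closed[OF xs(2), of u bs', OF chains_carrier[OF vu(2)]]]
        by (auto simp: b_def F c1_def)
    qed
    ultimately show ?thesis by auto
  qed
  show ?case
  proof (cases "p = 0")
    case True
    define Q where "Q bs q f' \<longleftrightarrow> q \<in> part F (j - 1) \<and> f' \<in> part F j \<and>
       (\<forall>i. in_var_ideal (set ks) (f' i)) \<and> c0 bs = (\<lambda>i. f' i + ?x * q i) \<and>
       (c0 bs = (\<lambda>_. 0) \<longrightarrow> q = (\<lambda>_. 0) \<and> f' = (\<lambda>_. 0))" for bs q f'
    have "\<exists>q f'. Q bs q f'" for bs
    proof -
      have fp: "c0 bs \<in> part (free_gmodule n as) j"
        using chainsD(1)[OF t(1), of bs] unfolding F_def .
      have iv: "in_var_ideal (insert k (set ks)) (c0 bs i)" for i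
        using Cons.prems(5)[OF True, of "False # bs" i] by (simp add: c0_def)
      show ?thesis
      proof (rule free_split_off_variable[OF fp iv, folded F_def], goal_cases)
        case (1 q f')
        have "Q bs q f'" unfolding Q_def by (intro conjI allI impI 1)
        then show ?case by blast
      qed
    qed
    then obtain q f' where Q: "\<And>bs. Q bs (q bs) (f' bs)" by metis
    have q: "\<And>bs. q bs \<in> part F (j - 1)" "\<And>bs. f' bs \<in> part F j"
      "\<And>bs i. in_var_ideal (set ks) (f' bs i)" "\<And>bs. c0 bs = (\<lambda>i. f' bs i + ?x * q bs i)"
      "\<And>bs. c0 bs = (\<lambda>_. 0) \<Longrightarrow> q bs = (\<lambda>_. 0)" "\<And>bs. c0 bs = (\<lambda>_. 0) \<Longrightarrow> f' bs = (\<lambda>_. 0)"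
      using Q unfolding Q_def by blast+
    have qc: "q \<in> koszul_chains ?m F 0 (j - 1)" and fc: "f' \<in> koszul_chains ?m F 0 j"
      using q(1,2,5,6) chainsD(2)[OF t(1)] True F(1) by (auto intro!: chainsI)
    have f0: "koszul_d F ?xs f' bs = (\<lambda>_. 0)" and q0: "koszul_d F ?xs q bs = (\<lambda>_. 0)" for bs
      using trivial koszul_d_chains[OF xs(1), of f' 0 j] koszul_d_chains[OF xs(1), of q 0 "j - 1"] qc fc by auto
    obtain v where v: "v \<in> koszul_chains ?m F 1 (j - 1)" "koszul_d F ?xs v = f'"
      using Cons.IH[OF ks(1,2) fc f0 q(3)] by auto
    have "c1 bs = (\<lambda>_. 0)" for bs using trivial t(2) True by simp
    then show ?thesis
      using v qc q0 True q(4) by (intro pair[of v q]) auto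
  next
    case False
    have "in_var_ideal (set ks) (c1 bs i)" if "p - 1 = 0" for bs i
    proof (rule in_var_ideal_regular[OF _ ks(3)])
      have "?x * c1 bs i = - koszul_d F ?xs c0 bs i"
        using d0[of bs i] by (simp add: add_eq_0_iff)
      moreover have "in_var_ideal (set ks) (koszul_d F ?xs c0 bs i)"
        using koszul_d_free_in_var_ideal[OF chains_carrier[OF t(1), unfolded F_def] ks(2)]
        unfolding F_def .
      ultimately show "in_var_ideal (set ks) (?x * c1 bs i)" by simp
    qed
    from Cons.IH[OF ks(1,2) t(2) d1 this]
    obtain u where u: "u \<in> koszul_chains ?m F p (j - 1)" "koszul_d F ?xs u = c1" by auto
    let ?c = "\<lambda>bs. c0 bs \<oplus>\<^bsub>F\<^esub> ?x \<odot>\<^bsub>F\<^esub> u bs"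
    have cc: "?c \<in> koszul_chains ?m F p j"
      using chains_add[OF t(1)] chains_smult[OF x(1) u(1)] by simp
    have "koszul_d F ?xs ?c bs = (\<lambda>_. 0)" for bs
    proof -
      have "koszul_d F ?xs ?c bs = koszul_d F ?xs c0 bs \<oplus>\<^bsub>F\<^esub> koszul_d F ?xs (\<lambda>bs. ?x \<odot>\<^bsub>F\<^esub> u bs) bs"
        by (rule koszul_d_add[OF xs(2)]) (use x(2) chains_carrier[OF t(1)] chains_carrier[OF u(1)] in blast)+
      also have "koszul_d F ?xs (\<lambda>bs. ?x \<odot>\<^bsub>F\<^esub> u bs) bs = ?x \<odot>\<^bsub>F\<^esub> koszul_d F ?xs u bs"
        by (rule koszul_d_smult[OF x(2) xs(2)]) (rule chains_carrier[OF u(1)])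
      finally show ?thesis using d0[of bs] by (simp add: F(2,3) u(2))
    qed
    from Cons.IH[OF ks(1,2) cc this] False
    obtain v where v: "v \<in> koszul_chains ?m F (p + 1) (j - 1)" "koszul_d F ?xs v = ?c" by auto
    have mu: "\<ominus>\<^bsub>F\<^esub> u bs = (\<lambda>i. - u bs i)" for bs
      by (rule minus[OF chains_carrier[OF u(1)]])
    show ?thesis
    proof (rule pair[OF v(1) chains_uminus[OF u(1)]])
      fix bs i
      show "koszul_d F ?xs v bs i + ?x * (\<ominus>\<^bsub>F\<^esub> u bs) i = c0 bs i"
        unfolding v(2) mu by (simp add: F)
      have "koszul_d F ?xs (\<lambda>bs. \<ominus>\<^bsub>F\<^esub> u bs) bs = \<ominus>\<^bsub>F\<^esub> c1 bs"
        using koszul_d_uminus[OF xs(2) chains_carrier[OF u(1)]] u(2) by simp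
      then show "- koszul_d F ?xs (\<lambda>bs. \<ominus>\<^bsub>F\<^esub> u bs) bs i = c1 bs i"
        using minus[OF chains_carrier[OF t(2)]] by simp
    qed
  qed
qed

lemma free_koszul_exact:
  assumes "c \<in> koszul_chains (Suc n) (free_gmodule n as) p j"
    "\<And>bs. koszul_d (free_gmodule n as) (vars n) c bs = (\<lambda>_. 0)"
    "\<And>bs i. p = 0 \<Longrightarrow> lookup (c bs i) 0 = 0"
  obtains b where "b \<in> koszul_chains (Suc n) (free_gmodule n as) (p + 1) (j - 1)"
    "koszul_d (free_gmodule n as) (vars n) b = c"
proof -
  interpret gmod n "free_gmodule n as" by (rule gmodI[OF free_gmodule_graded])
  have "c bs i \<in> carrier (poly_ring n)" for bs i
    using chains_carrier[OF assms(1), of bs] by (cases "i < length as") auto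
  then have I: "in_var_ideal (set [0..<Suc n]) (c bs i)" if "p = 0" for bs i
    using in_var_ideal_all_iff assms(3)[OF that] by (metis atLeast_upt lessThan_Suc_atMost)
  have "\<exists>b \<in> koszul_chains (length [0..<Suc n]) (free_gmodule n as) (p + 1) (j - 1).
      koszul_d (free_gmodule n as) (map poly_var [0..<Suc n]) b = c"
    by (rule free_koszul_exact_aux) (use assms(1,2) I in \<open>auto simp: vars_def simp del: upt_Suc\<close>)
  then show thesis
    using that unfolding vars_def by (metis length_upt diff_zero)
qed

section \<open>Vanishing of Koszul homology\<close>

text \<open>From here on the free modules are mostly handled as abstract graded modules.\<close>

declare free_gmodule_simps [simp del]

text \<open>Exactness of the Koszul complex at the chains of homological degree \<open>p\<close> with coefficients in
  \<open>M\<^sub>j\<close>.\<close>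

definition koszul_vanishes :: "nat \<Rightarrow> ('k::field mpoly, 'm) gmodule \<Rightarrow> int \<Rightarrow> int \<Rightarrow> bool" where
  "koszul_vanishes n M p j \<longleftrightarrow>
     (\<forall>z \<in> koszul_chains (Suc n) M p j. (\<forall>bs. koszul_d M (vars n) z bs = \<zero>\<^bsub>M\<^esub>) \<longrightarrow>
        (\<exists>b \<in> koszul_chains (Suc n) M (p + 1) (j - 1). koszul_d M (vars n) b = z))"

lemma koszul_vanishesD:
  assumes "koszul_vanishes n M p j" "z \<in> koszul_chains (Suc n) M p j" "\<And>bs. koszul_d M (vars n) z bs = \<zero>\<^bsub>M\<^esub>"
  obtains b where "b \<in> koszul_chains (Suc n) M (p + 1) (j - 1)" "koszul_d M (vars n) b = z"
  using assms unfolding koszul_vanishes_def by blast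

lemma (in gmod) koszul_vanishes_trivial:
  assumes "p < 0 \<or> int (Suc n) < p"
  shows "koszul_vanishes n M p j"
  unfolding koszul_vanishes_def
proof (intro ballI impI)
  fix z assume "z \<in> koszul_chains (Suc n) M p j"
  then have "z = (\<lambda>_. \<zero>)" by (rule chains_trivial[OF _ assms])
  then show "\<exists>b \<in> koszul_chains (Suc n) M (p + 1) (j - 1). koszul_d M (vars n) b = z"
    using chains_zero koszul_d_zero[OF vars_simps(4)] by (intro bexI[of _ "\<lambda>_. \<zero>"]) auto
qed

lemma (in gmod) vars_chains:
  "c \<in> koszul_chains (Suc n) M p j \<Longrightarrow> koszul_d M (vars n) c \<in> koszul_chains (Suc n) M (p - 1) (j + 1)"
  using koszul_d_chains[OF vars_simps(3), of c] by (simp add: vars_simps)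

lemma (in gmod) degree_zero_boundary:
  assumes "koszul_vanishes n M 0 j" "z \<in> part M j"
  obtains b where "b \<in> koszul_chains (Suc n) M 1 (j - 1)" "koszul_d M (vars n) b (replicate (Suc n) False) = z"
proof -
  let ?r = "replicate (Suc n) False"
  define c where "c bs = (if bs = ?r then z else \<zero>)" for bs
  have "count_list ?r True = 0" by (induction n) auto
  then have c: "c \<in> koszul_chains (Suc n) M 0 j"
    using assms(2) by (intro chainsI) (auto simp: c_def part_closed simp del: replicate_Suc)
  have "koszul_d M (vars n) c bs = \<zero>" for bs
    using chains_trivial[OF vars_chains[OF c]] by simp
  then obtain b where "b \<in> koszul_chains (Suc n) M (0 + 1) (j - 1)" "koszul_d M (vars n) b = c"
    by (rule koszul_vanishesD[OF assms(1) c])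
  then show thesis using that by (simp add: c_def)
qed

lemma restrict_chains:
  "c \<in> koszul_chains m (restrict_gm M N) p j \<longleftrightarrow> c \<in> koszul_chains m M p j \<and> (\<forall>bs. c bs \<in> N)"
  by (auto simp: koszul_chains_def)

lemma restrict_incl: "N \<subseteq> carrier M \<Longrightarrow> graded_hom n (restrict_gm M N) M (\<lambda>x. x)"
  by (auto simp: graded_hom_def)

lemma kernel_iff: "x \<in> a_kernel M N f \<longleftrightarrow> x \<in> carrier M \<and> f x = \<zero>\<^bsub>N\<^esub>"
  unfolding a_kernel_def' by blast

text \<open>The two halves of dimension shifting along \<open>0 \<rightarrow> K \<rightarrow> F \<rightarrow> M \<rightarrow> 0\<close> with \<open>F\<close> free.\<close>

locale free_cover =
  fixes n :: nat and M :: "('k::field mpoly, 'm) gmodule" and as :: "int list"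
    and \<epsilon> :: "(nat \<Rightarrow> 'k mpoly) \<Rightarrow> 'm"
  assumes M: "gmod n M" and epi: "graded_epi n (free_gmodule n as) M \<epsilon>"
begin

abbreviation "F \<equiv> free_gmodule n as :: ('k mpoly, nat \<Rightarrow> 'k mpoly) gmodule"
abbreviation "Ker \<equiv> a_kernel F M \<epsilon>"
abbreviation "K \<equiv> restrict_gm F Ker"

lemma F: "gmod n F" by (rule gmodI[OF free_gmodule_graded])

sublocale M: gmod n M by (rule M)
sublocale F: gmod n F by (rule F)

lemma hom: "graded_hom n F M \<epsilon>" using epi by (simp add: graded_epi_def)

sublocale \<epsilon>: abelian_group_hom F M \<epsilon>
  by (rule graded_hom_group_hom[OF F.module_axioms M.module_axioms hom])

lemma K: "gmod n K" by (rule gmodI[OF kernel_graded[OF F M hom]])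

sublocale K: gmod n K by (rule K)

lemma Ker_iff: "x \<in> Ker \<longleftrightarrow> x \<in> carrier F \<and> \<epsilon> x = \<zero>\<^bsub>M\<^esub>"
  by (rule kernel_iff)

lemma Ker_carrier: "Ker \<subseteq> carrier F"
  by (rule subsetI, drule iffD1[OF Ker_iff], erule conjunct1)

lemma koszul_d_K: "(\<And>bs. c bs \<in> Ker) \<Longrightarrow> koszul_d K (vars n) c bs = koszul_d F (vars n) c bs"
  using koszul_d_graded_hom[OF K F restrict_incl[OF Ker_carrier], of c bs] by simp

lemma koszul_d_\<epsilon>: "(\<And>bs. c bs \<in> carrier F) \<Longrightarrow> \<epsilon> (koszul_d F (vars n) c bs) = koszul_d M (vars n) (\<lambda>bs. \<epsilon> (c bs)) bs"
  by (rule koszul_d_graded_hom[OF F M hom])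

text \<open>The connecting map from \<open>H\<^sub>p(M)\<close> to \<open>H\<^sub>p\<^sub>-\<^sub>1(K)\<close> is injective where \<open>H\<^sub>p(F)\<close> vanishes. For \<open>p = 0\<close> this is where the bound on
  \<open>as\<close> enters: \<open>F\<^sub>j\<close> lies in \<open>\<mm> F\<close> above the degrees of the generators.\<close>

lemma vanishes_of_kernel:
  assumes "koszul_vanishes n K (p - 1) (j + 1)" "\<And>a. a \<in> set as \<Longrightarrow> a < j"
  shows "koszul_vanishes n M p j"
  unfolding koszul_vanishes_def
proof (intro ballI impI)
  fix z assume z: "z \<in> koszul_chains (Suc n) M p j" "\<forall>bs. koszul_d M (vars n) z bs = \<zero>\<^bsub>M\<^esub>"
  \<comment> \<open>A lift of the cycle is a cycle up to an element of the kernel, where boundaries exist.\<close>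
  obtain c where c: "c \<in> koszul_chains (Suc n) F p j" "\<And>bs. \<epsilon> (c bs) = z bs"
    using chains_lift[OF F M epi z(1)] by blast
  note cc = F.chains_carrier[OF c(1)]
  have dc: "koszul_d F (vars n) c \<in> koszul_chains (Suc n) K (p - 1) (j + 1)"
    unfolding restrict_chains Ker_iff
    using F.vars_chains[OF c(1)] F.koszul_d_closed[OF vars_simps(4), of c, OF cc] z(2)
    by (simp add: koszul_d_\<epsilon>[OF cc] c(2))
  have "koszul_d K (vars n) (koszul_d F (vars n) c) bs = \<zero>\<^bsub>K\<^esub>" for bs
    using dc F.koszul_d_d[OF vars_simps(4), of c, OF cc] by (subst koszul_d_K) (auto simp: restrict_chains)
  then obtain w where "w \<in> koszul_chains (Suc n) K (p - 1 + 1) (j + 1 - 1)"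
      and w: "koszul_d K (vars n) w = koszul_d F (vars n) c"
    by (rule koszul_vanishesD[OF assms(1) dc])
  then have w: "w \<in> koszul_chains (Suc n) K p j" "koszul_d K (vars n) w = koszul_d F (vars n) c" by simp_all
  have wF: "w \<in> koszul_chains (Suc n) F p j" "\<And>bs. w bs \<in> Ker"
    using w(1) by (auto simp: restrict_chains)
  note wc = F.chains_carrier[OF wF(1)]
  let ?e = "\<lambda>bs. c bs \<ominus>\<^bsub>F\<^esub> w bs"
  have e: "?e \<in> koszul_chains (Suc n) F p j" by (rule F.chains_diff[OF c(1) wF(1)])
  have "koszul_d F (vars n) ?e bs = (\<lambda>_. 0)" for bs
  proof -
    have "koszul_d F (vars n) ?e bs = koszul_d F (vars n) c bs \<ominus>\<^bsub>F\<^esub> koszul_d F (vars n) w bs"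
      by (rule F.koszul_d_diff[OF vars_simps(4) cc wc])
    also have "koszul_d F (vars n) w bs = koszul_d F (vars n) c bs"
      using koszul_d_K[of w, OF wF(2)] w(2) by simp
    finally show ?thesis
      using F.M.r_neg[OF F.koszul_d_closed[OF vars_simps(4), of c bs, OF cc]]
      by (simp add: a_minus_def free_gmodule_simps(2))
  qed
  moreover have "lookup (?e bs i) 0 = 0" for bs i
  proof (cases "i < length as")
    case True
    then have "?e bs i \<in> poly_part n (j - as ! i)" using chainsD(1)[OF e, of bs] by (simp add: free_gmodule_simps)
    moreover have "j - as ! i \<noteq> 0" using assms(2)[OF nth_mem[OF True]] by simp
    ultimately show ?thesis using poly_part_const_term by blast
  next
    case False
    then have "?e bs i = 0" using chainsD(1)[OF e, of bs] by (simp add: free_gmodule_simps)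
    then show ?thesis by simp
  qed
  ultimately obtain u where u: "u \<in> koszul_chains (Suc n) F (p + 1) (j - 1)" "koszul_d F (vars n) u = ?e"
    by (rule free_koszul_exact[OF e])
  have "koszul_d M (vars n) (\<lambda>bs. \<epsilon> (u bs)) bs = z bs" for bs
  proof -
    have "koszul_d M (vars n) (\<lambda>bs. \<epsilon> (u bs)) bs = \<epsilon> (?e bs)"
      using koszul_d_\<epsilon>[of u bs, OF F.chains_carrier[OF u(1)]] u(2) by simp
    also have "\<dots> = z bs"
      using cc[of bs] wF(2)[of bs] c(2)[of bs] M.chains_carrier[OF z(1), of bs]
      by (simp add: a_minus_def Ker_iff)
    finally show ?thesis .
  qed
  then show "\<exists>b \<in> koszul_chains (Suc n) M (p + 1) (j - 1). koszul_d M (vars n) b = z"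
    using chains_hom[OF F M hom u(1)] by blast
qed

text \<open>The connecting map from \<open>H\<^sub>p\<^sub>+\<^sub>1(M)\<close> to \<open>H\<^sub>p(K)\<close> is surjective where \<open>H\<^sub>p(K) \<rightarrow> H\<^sub>p(F)\<close> is zero. For
  \<open>p = 0\<close> this means that the kernel lies in \<open>\<mm> F\<close>, as is the case for minimal covers.\<close>

lemma kernel_vanishes:
  assumes "koszul_vanishes n M (p + 1) (j - 1)"
    "\<And>f i. f \<in> Ker \<Longrightarrow> lookup (f i) 0 = 0"
  shows "koszul_vanishes n K p j"
  unfolding koszul_vanishes_def
proof (intro ballI impI)
  fix z assume z: "z \<in> koszul_chains (Suc n) K p j" "\<forall>bs. koszul_d K (vars n) z bs = \<zero>\<^bsub>K\<^esub>"
  have zF: "z \<in> koszul_chains (Suc n) F p j" "\<And>bs. z bs \<in> Ker"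
    using z(1) by (auto simp: restrict_chains)
  have d0: "koszul_d F (vars n) z bs = (\<lambda>_. 0)" for bs
    using z(2) koszul_d_K[of z bs, OF zF(2)] by (simp add: free_gmodule_simps)
  obtain b where b: "b \<in> koszul_chains (Suc n) F (p + 1) (j - 1)" "koszul_d F (vars n) b = z"
    by (rule free_koszul_exact[OF zF(1) d0 assms(2)[OF zF(2)]])
  note bc = F.chains_carrier[OF b(1)]
  have "koszul_d M (vars n) (\<lambda>bs. \<epsilon> (b bs)) bs = \<zero>\<^bsub>M\<^esub>" for bs
    using koszul_d_\<epsilon>[of b bs, OF bc] b(2) zF(2)[of bs] by (simp add: Ker_iff)
  then obtain u where u: "u \<in> koszul_chains (Suc n) M (p + 1 + 1) (j - 1 - 1)"
    "koszul_d M (vars n) u = (\<lambda>bs. \<epsilon> (b bs))"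
    by (rule koszul_vanishesD[OF assms(1) chains_hom[OF F M hom b(1)]])
  obtain v where v: "v \<in> koszul_chains (Suc n) F (p + 1 + 1) (j - 1 - 1)" "\<And>bs. \<epsilon> (v bs) = u bs"
    using chains_lift[OF F M epi u(1)] by blast
  note vc = F.chains_carrier[OF v(1)]
  have dv: "koszul_d F (vars n) v \<in> koszul_chains (Suc n) F (p + 1) (j - 1)"
    using F.vars_chains[OF v(1)] by (simp add: add.commute)
  note dvc = F.chains_carrier[OF dv]
  have edv: "\<epsilon> (koszul_d F (vars n) v bs) = \<epsilon> (b bs)" for bs
    using koszul_d_\<epsilon>[of v bs, OF vc] v(2) fun_cong[OF u(2), of bs] by simp
  let ?e = "\<lambda>bs. b bs \<ominus>\<^bsub>F\<^esub> koszul_d F (vars n) v bs"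
  have e: "?e \<in> koszul_chains (Suc n) F (p + 1) (j - 1)" by (rule F.chains_diff[OF b(1) dv])
  have eK: "?e bs \<in> Ker" for bs
    unfolding Ker_iff
    using F.chains_carrier[OF e, of bs] bc[of bs] dvc[of bs] edv[of bs]
    by (simp add: a_minus_def M.M.r_neg)
  have "koszul_d K (vars n) ?e bs = z bs" for bs
  proof -
    have "koszul_d K (vars n) ?e bs = koszul_d F (vars n) ?e bs" by (rule koszul_d_K[OF eK])
    also have "\<dots> = koszul_d F (vars n) b bs \<ominus>\<^bsub>F\<^esub> koszul_d F (vars n) (koszul_d F (vars n) v) bs"
      by (rule F.koszul_d_diff[OF vars_simps(4) bc dvc])
    also have "\<dots> = z bs"
      using F.koszul_d_d[OF vars_simps(4), of v bs, OF vc] b(2) F.chains_carrier[OF zF(1), of bs]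
      by (simp add: a_minus_def)
    finally show ?thesis .
  qed
  then show "\<exists>b \<in> koszul_chains (Suc n) K (p + 1) (j - 1). koszul_d K (vars n) b = z"
    using e eK by (intro bexI[of _ ?e]) (auto simp: restrict_chains)
qed

end

section \<open>Regularity implies vanishing\<close>

definition unit_vec :: "nat \<Rightarrow> nat \<Rightarrow> 'k::field mpoly" where
  "unit_vec i = (\<lambda>j. if j = i then 1 else 0)"

lemma unit_vec_part: "i < length as \<Longrightarrow> unit_vec i \<in> part (free_gmodule n as) (as ! i)"
  by (auto simp: unit_vec_def poly_part_closed free_gmodule_simps)

text \<open>Otherwise the vectors whose \<open>i\<close>-th entry lies in \<open>\<mm>\<close>, for a generator of degree \<open>as ! i > s\<close>,
  would form a proper submodule containing all elements of degree at most \<open>s\<close>.\<close>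

lemma free_gens_le:
  assumes "generated_in_degrees_le n (free_gmodule n as :: ('k::field mpoly, _) gmodule) s" "a \<in> set as"
  shows "a \<le> s"
proof (rule ccontr)
  assume as: "\<not> a \<le> s"
  obtain i where i: "i < length as" "a = as ! i" using assms(2) by (metis in_set_conv_nth)
  let ?F = "free_gmodule n as :: ('k mpoly, _) gmodule"
  interpret gmod n ?F by (rule gmodI[OF free_gmodule_graded])
  let ?N = "{f \<in> carrier ?F. in_var_ideal {..n} (f i)}"
  have "submodule ?N (poly_ring n) ?F"
  proof (rule submoduleI)
    show "\<ominus>\<^bsub>?F\<^esub> f \<in> ?N" if "f \<in> ?N" for f
    proof -
      have "f \<in> carrier ?F" using that by blast
      then have "\<ominus>\<^bsub>?F\<^esub> f \<in> carrier ?F" "\<ominus>\<^bsub>?F\<^esub> f = (\<lambda>j. - f j)"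
        by (rule M.a_inv_closed, rule free_gmodule_uminus)
      then show ?thesis using that by simp
    qed
  qed (auto simp: free_gmodule_simps carrier_poly_closed in_var_ideal_add in_var_ideal_mult)
  moreover have "(\<Union>j \<in> {..s}. part ?F j) \<subseteq> ?N"
  proof
    fix f assume "f \<in> (\<Union>j \<in> {..s}. part ?F j)"
    then obtain j where j: "j \<le> s" "f \<in> part ?F j" by blast
    have "f i = 0" using j i as by (intro poly_part_neg[of "j - as ! i" _ n]) (auto simp: free_gmodule_simps)
    then show "f \<in> ?N" using part_carrier[OF j(2)] by simp
  qed
  ultimately have "carrier ?F \<subseteq> ?N"
    using assms(1) unfolding generated_in_degrees_le_def span_in_def by blast
  moreover have "unit_vec i \<in> carrier ?F" using part_carrier[OF unit_vec_part[OF i(1)]] .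
  ultimately have "unit_vec i \<in> ?N" by blast
  then show False by (auto simp: unit_vec_def in_var_ideal_def)
qed

text \<open>Dimension shifting along the whole resolution: the \<open>i\<close>-th syzygy module is the image of a free
  module with generators in degrees at most \<open>r + i + 1\<close>, and the syzygy modules beyond the end are zero.\<close>

lemma regular_koszul_vanishes:
  fixes M :: "('k::field mpoly, 'm) gmodule"
  assumes "gmod n M" "regular n r M" "r < j"
  shows "koszul_vanishes n M p j"
proof -
  obtain l as \<delta> \<epsilon> where res: "minimal_graded_free_resolution n M l as \<delta> \<epsilon>"
    and gen: "\<And>i. i \<le> l \<Longrightarrow> generated_in_degrees_le n
        (free_gmodule n (as i) :: ('k mpoly, nat \<Rightarrow> 'k mpoly) gmodule) (r + int i)"
    using assms(2) unfolding regular_def by blast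
  define F where "F i = (free_gmodule n (as i) :: ('k mpoly, nat \<Rightarrow> 'k mpoly) gmodule)" for i
  have F: "gmod n (F i)" for i unfolding F_def by (rule gmodI[OF free_gmodule_graded])
  have res': "\<And>i. i > l \<Longrightarrow> as i = []" "graded_epi n (F 0) M \<epsilon>"
    "\<And>i. graded_hom n (F (Suc i)) (F i) (\<delta> i)"
    "\<delta> 0 ` carrier (F 1) = a_kernel (F 0) M \<epsilon>"
    "\<And>i. \<delta> (Suc i) ` carrier (F (Suc (Suc i))) = a_kernel (F (Suc i)) (F i) (\<delta> i)"
    using res unfolding minimal_graded_free_resolution_def Let_def F_def by blast+
  have le: "a \<le> r + int i" if "a \<in> set (as i)" for a i
    using that free_gens_le[OF gen[of i] that] res'(1)[of i] by (cases "i \<le> l") auto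
  define Z where "Z i = (if i = 0 then a_kernel (F 0) M \<epsilon> else a_kernel (F i) (F (i - 1)) (\<delta> (i - 1)))" for i
  have Zgraded: "gmod n (restrict_gm (F i) (Z i))" for i
  proof (cases i)
    case 0
    then show ?thesis unfolding Z_def
      using kernel_graded[OF F assms(1)] res'(2) by (auto simp: graded_epi_def intro: gmodI)
  next
    case (Suc i')
    then show ?thesis unfolding Z_def
      using kernel_graded[OF F F res'(3)] by (auto intro: gmodI)
  qed
  have image: "\<delta> i ` carrier (F (Suc i)) = Z i" for i
    using res'(4,5) by (cases i) (auto simp: Z_def)
  \<comment> \<open>\<open>Z i\<close> is the kernel of the map out of \<open>F i\<close>; it is covered by \<open>F (Suc i)\<close>.\<close>
  have cover: "free_cover n (restrict_gm (F i) (Z i)) (as (Suc i)) (\<delta> i)" for i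
    unfolding free_cover_def graded_epi_def F_def[symmetric] graded_hom_def
    using Zgraded[of i] image[of i] res'(3)[of i] gmod.part_carrier[OF F]
    by (auto simp: graded_hom_def)
  have ker: "a_kernel (F (Suc i)) (restrict_gm (F i) (Z i)) (\<delta> i) = Z (Suc i)" for i
    by (auto simp: Z_def kernel_iff)
  have Zv: "koszul_vanishes n (restrict_gm (F i) (Z i)) p j" if "r + int i + 1 < j" "i + k = Suc l" for i k p j
    using that
  proof (induction k arbitrary: i p j)
    case 0
    interpret gmod n "restrict_gm (F i) (Z i)" by (rule Zgraded)
    have as: "as i = []" using res'(1) 0 by simp
    have z0: "z = (\<lambda>_. \<zero>\<^bsub>restrict_gm (F i) (Z i)\<^esub>)" if "z \<in> koszul_chains (Suc n) (restrict_gm (F i) (Z i)) p j" for z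
      using that by (auto simp: koszul_chains_def F_def as fun_eq_iff free_gmodule_simps)
    show ?case
      unfolding koszul_vanishes_def
    proof (intro ballI impI bexI)
      fix z assume "z \<in> koszul_chains (Suc n) (restrict_gm (F i) (Z i)) p j"
      then show "koszul_d (restrict_gm (F i) (Z i)) (vars n) (\<lambda>_. \<zero>\<^bsub>restrict_gm (F i) (Z i)\<^esub>) = z"
        using z0 koszul_d_zero[OF vars_simps(4)] by auto
    qed (rule chains_zero)
  next
    case (Suc k)
    have "koszul_vanishes n (restrict_gm (F (Suc i)) (Z (Suc i))) (p - 1) (j + 1)"
      using Suc.prems by (intro Suc.IH) auto
    then show ?case
      using Suc.prems le[of _ "Suc i"]
      by (intro free_cover.vanishes_of_kernel[OF cover]) (fastforce simp: ker[unfolded F_def] F_def)+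
  qed
  have "koszul_vanishes n (restrict_gm (F 0) (Z 0)) (p - 1) (j + 1)"
    using assms(3) Zv[of 0 "j + 1" "Suc l" "p - 1"] by simp
  then show ?thesis
    using assms(1,3) res'(2) le[of _ 0]
    by (intro free_cover.vanishes_of_kernel[where as = "as 0" and \<epsilon> = \<epsilon>])
      (fastforce simp: free_cover_def F_def Z_def)+
qed

section \<open>Torsion\<close>

text \<open>The elements killed by \<open>\<mm>\<^sup>k\<close>.\<close>

primrec torsion :: "nat \<Rightarrow> ('k::field mpoly, 'm) gmodule \<Rightarrow> nat \<Rightarrow> 'm set" where
  "torsion n M 0 = {\<zero>\<^bsub>M\<^esub>}"
| "torsion n M (Suc k) = {z \<in> carrier M. \<forall>i \<le> n. poly_var i \<odot>\<^bsub>M\<^esub> z \<in> torsion n M k}"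

context gmod
begin

text \<open>A socle element is a cycle in the top degree \<open>n + 1\<close> of the Koszul complex, where there are no
  boundaries but zero.\<close>

lemma socle_zero:
  assumes "koszul_vanishes n M (int n + 1) j" "z \<in> part M j"
    "\<And>i. i \<le> n \<Longrightarrow> poly_var i \<odot> z = \<zero>"
  shows "z = \<zero>"
proof -
  define c where "c bs = (if bs = replicate (Suc n) True then z else \<zero>)" for bs
  have "count_list (replicate (Suc n) True) True = Suc n"
    by (induction n) auto
  then have c: "c \<in> koszul_chains (Suc n) M (int n + 1) j"
    by (intro chainsI) (auto simp: c_def part_closed assms(2) simp del: replicate_Suc)
  have "koszul_d M (vars n) c bs = \<zero>" for bs
    by (rule koszul_d_annihilated) (auto simp: c_def assms(3) vars_simps poly_var_carrier)
  then obtain b where b: "b \<in> koszul_chains (Suc n) M (int n + 1 + 1) (j - 1)" "koszul_d M (vars n) b = c"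
    by (rule koszul_vanishesD[OF assms(1) c])
  have "b = (\<lambda>_. \<zero>)" by (rule chains_trivial[OF b(1)]) simp
  then have "c (replicate (Suc n) True) = \<zero>"
    using b(2) koszul_d_zero[OF vars_simps(4)] by metis
  then show ?thesis by (simp add: c_def)
qed

lemma var_smult_part: "i \<le> n \<Longrightarrow> z \<in> part M j \<Longrightarrow> poly_var i \<odot> z \<in> part M (j + 1)"
  using part_closed(4)[OF poly_var_part] by (metis add.commute)

lemma torsion_zero:
  assumes "\<And>j. r < j \<Longrightarrow> koszul_vanishes n M (int n + 1) j"
    "z \<in> torsion n M k" "z \<in> part M j" "r < j"
  shows "z = \<zero>"
  using assms(2-)
proof (induction k arbitrary: z j)
  case (Suc k)
  show ?case
  proof (rule socle_zero[OF assms(1)[OF Suc.prems(3)] Suc.prems(2)])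
    fix i assume "i \<le> n"
    then show "poly_var i \<odot> z = \<zero>"
      using Suc.prems var_smult_part by (intro Suc.IH[of _ "j + 1"]) auto
  qed
qed simp

lemma power_smult_part:
  assumes "y \<in> poly_part n 1" "z \<in> part M j"
  shows "y ^ k \<odot> z \<in> part M (j + int k)"
proof -
  have "y ^ k \<in> poly_part n (int k)"
  proof (induction k)
    case (Suc k)
    then show ?case using poly_part_closed(4)[OF assms(1) Suc.IH] by (simp add: add.commute)
  qed simp
  then show ?thesis using part_closed(4)[OF _ assms(2)] by (metis add.commute)
qed

lemma power_smult_Suc:
  "a \<in> carrier (poly_ring n) \<Longrightarrow> z \<in> carrier M \<Longrightarrow> a ^ Suc k \<odot> z = a \<odot> (a ^ k \<odot> z)"
  "a \<in> carrier (poly_ring n) \<Longrightarrow> z \<in> carrier M \<Longrightarrow> a ^ Suc k \<odot> z = a ^ k \<odot> (a \<odot> z)"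
  "a \<in> carrier (poly_ring n) \<Longrightarrow> a ^ k \<in> carrier (poly_ring n)"
  "z \<in> carrier M \<Longrightarrow> a ^ 0 \<odot> z = z"
proof -
  show pc: "a ^ k \<in> carrier (poly_ring n)" if "a \<in> carrier (poly_ring n)"
    by (induction k) (use that in \<open>auto simp: carrier_poly_closed\<close>)
  show "a ^ Suc k \<odot> z = a \<odot> (a ^ k \<odot> z)"
    "a ^ Suc k \<odot> z = a ^ k \<odot> (a \<odot> z)"
    if "a \<in> carrier (poly_ring n)" "z \<in> carrier M"
    using smult_assoc1[of a "a ^ k" z] smult_assoc1[of "a ^ k" a z] that pc by (simp_all add: mult.commute)
  show "z \<in> carrier M \<Longrightarrow> a ^ 0 \<odot> z = z" using smult_one[of z] by simp
qed

text \<open>Multiplied by enough variables, \<open>z\<close> reaches the degrees in which \<open>y\<close> is injective, where only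
  zero is killed by a power of \<open>y\<close>.\<close>

lemma filter_regular_torsion:
  assumes "filter_regular n M y" "y \<in> poly_part n 1" "z \<in> part M j" "y ^ N \<odot> z = \<zero>"
  obtains k where "z \<in> torsion n M k"
proof -
  obtain e i0 where "\<And>i. i \<ge> i0 \<Longrightarrow> inj_on (\<lambda>x. y \<odot> x) (part M (i - e))"
    using assms(1) unfolding filter_regular_def eventually_at_top_linorder by blast
  then have inj: "inj_on (\<lambda>x. y \<odot> x) (part M j)" if "j \<ge> i0 - e" for j
    using that by (metis add_diff_cancel_right' diff_le_eq)
  have y: "y \<in> carrier (poly_ring n)" using assms(2) by (rule poly_part_carrier)
  have reg: "x = \<zero>" if "x \<in> part M j" "y \<odot> x = \<zero>" "j \<ge> i0 - e" for x j
    using inj_onD[OF inj[OF that(3)], of x "\<zero>"] that y part_closed(1) by simp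
  have reg_pow: "x = \<zero>" if "x \<in> part M j" "y ^ N \<odot> x = \<zero>" "j \<ge> i0 - e" for x j N
    using that
  proof (induction N)
    case 0
    then show ?case using power_smult_Suc(4) part_carrier by metis
  next
    case (Suc N)
    then have "y \<odot> (y ^ N \<odot> x) = \<zero>"
      using power_smult_Suc(1)[OF y part_carrier[OF Suc.prems(1)], of N] by simp
    then have "y ^ N \<odot> x = \<zero>"
      using reg[OF power_smult_part[OF assms(2) Suc.prems(1)]] Suc.prems(3) by simp
    then show ?case using Suc by simp
  qed
  have "z \<in> torsion n M k" if "j + int k \<ge> i0 - e" for k
    using that assms(3,4)
  proof (induction k arbitrary: z j)
    case 0
    then show ?case using reg_pow[of z j N] by simp
  next
    case (Suc k)
    note zc = part_carrier[OF Suc.prems(2)]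
    have "poly_var i \<odot> z \<in> torsion n M k" if i: "i \<le> n" for i
    proof (rule Suc.IH[of "j + 1"])
      show "y ^ N \<odot> (poly_var i \<odot> z) = \<zero>"
        using Suc.prems(3) smult_smult_swap[OF power_smult_Suc(3)[OF y] poly_var_carrier[OF i] zc]
          i by (simp add: poly_var_carrier)
    qed (use Suc.prems var_smult_part[OF i] in auto)
    then show ?case using zc by simp
  qed
  then have "z \<in> torsion n M (nat (i0 - e - j))" by simp
  then show thesis by (rule that)
qed

end

lemma torsion_hom:
  assumes "gmod n M" "gmod n N" "graded_hom n M N f" "z \<in> torsion n M k"
  shows "f z \<in> torsion n N k"
proof -
  interpret M: gmod n M by fact
  interpret N: gmod n N by fact
  interpret f: abelian_group_hom M N f
    by (rule graded_hom_group_hom[OF M.module_axioms N.module_axioms assms(3)])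
  show ?thesis using assms(4)
  proof (induction k arbitrary: z)
    case (Suc k)
    have "poly_var i \<odot>\<^bsub>N\<^esub> f z \<in> torsion n N k" if "i \<le> n" for i
      using Suc.IH[of "poly_var i \<odot>\<^bsub>M\<^esub> z"] Suc.prems that
        graded_homD(3)[OF assms(3) poly_var_carrier[OF that], of z] by simp
    then show ?case using Suc.prems by simp
  qed simp
qed

section \<open>Regularity through a hyperplane section\<close>

locale hyperplane = gmod n M for n :: nat and M :: "('k::field mpoly, 'm) gmodule" (structure) +
  fixes y :: "'k mpoly"
  assumes y: "y \<in> poly_part n 1"
begin

abbreviation "Q \<equiv> quot_module M (mult_image M y)"
abbreviation "\<pi> \<equiv> \<lambda>x. mult_image M y +>\<^bsub>M\<^esub> x"

lemma Q: "gmod n Q" "graded_epi n M Q \<pi>" "x \<in> carrier M \<Longrightarrow> \<pi> x = \<zero>\<^bsub>Q\<^esub> \<longleftrightarrow> x \<in> mult_image M y"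
  using quot_module_graded[OF gmod_axioms mult_image_submodule[OF y]] by (auto intro: gmodI)

lemma \<pi>_hom: "graded_hom n M Q \<pi>" using Q(2) by (simp add: graded_epi_def)

lemma y_carrier: "y \<in> carrier (poly_ring n)" using y by (rule poly_part_carrier)

lemma mult_image_part:
  assumes "x \<in> part M j" "x \<in> mult_image M y"
  obtains x' where "x' \<in> part M (j - 1)" "x = y \<odot> x'" "x = \<zero> \<Longrightarrow> x' = \<zero>"
proof (cases "x = \<zero>")
  case True
  then show thesis using that[of "\<zero>"] part_closed(1) y_carrier by simp
next
  case False
  obtain u where u: "u \<in> carrier M" "x = y \<odot> u"
    using assms(2) unfolding mult_image_def by blast
  have "x = y \<odot> component M u (j - 1)"
    using component_smult[OF y u(1), of j] component_part[OF assms(1)] u(2) by simp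
  then show thesis using that[OF component_props(1)[OF u(1)]] False by blast
qed

text \<open>One step: the class of \<open>z\<close> in \<open>M/yM\<close> is torsion in a degree where torsion vanishes, so \<open>z = y w\<close>
  with \<open>w\<close> of degree one less, and \<open>w\<close> is killed by a power of \<open>y\<close> as well.\<close>

lemma torsion_divisible:
  assumes "filter_regular n M y" "\<And>j. s < j \<Longrightarrow> koszul_vanishes n Q (int n + 1) j"
    "z \<in> part M j" "y ^ N \<odot> z = \<zero>" "s + int m \<le> j"
  shows "\<exists>z' N'. z' \<in> part M (j - int m) \<and> z = y ^ m \<odot> z' \<and> y ^ N' \<odot> z' = \<zero>"
  using assms(3-)
proof (induction m arbitrary: z j N)
  case 0
  then show ?case
    using power_smult_Suc(4)[OF part_carrier[OF 0(1)]] by (intro exI[of _ z] exI[of _ N]) simp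
next
  case (Suc m)
  note zc = part_carrier[OF Suc.prems(1)]
  obtain k where "z \<in> torsion n M k" using filter_regular_torsion[OF assms(1) y Suc.prems(1,2)] .
  then have "\<pi> z \<in> torsion n Q k" by (rule torsion_hom[OF gmod_axioms Q(1) \<pi>_hom])
  then have "\<pi> z = \<zero>\<^bsub>Q\<^esub>"
    using Suc.prems(3) graded_homD(4)[OF \<pi>_hom Suc.prems(1)]
    by (intro gmod.torsion_zero[OF Q(1) assms(2)]) auto
  then have "z \<in> mult_image M y" using Q(3)[OF zc] by blast
  then obtain w where w: "w \<in> part M (j - 1)" "z = y \<odot> w"
    using mult_image_part[OF Suc.prems(1)] by metis
  note wc = part_carrier[OF w(1)]
  have "y ^ Suc N \<odot> w = \<zero>"
    using power_smult_Suc(2)[OF y_carrier wc, of N] w(2) Suc.prems(2) by simp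
  then obtain z' N' where z': "z' \<in> part M (j - 1 - int m)" "w = y ^ m \<odot> z'" "y ^ N' \<odot> z' = \<zero>"
    using Suc.IH[OF w(1), of "Suc N"] Suc.prems(3) by auto
  have "z = y ^ Suc m \<odot> z'"
    using power_smult_Suc(1)[OF y_carrier part_carrier[OF z'(1)], of m] w(2) z'(2) by simp
  then show ?case using z' by (intro exI[of _ z'] exI[of _ N']) (simp add: algebra_simps)
qed

text \<open>Let \<open>z\<close> be a cycle and \<open>w\<close> the chain with \<open>d w = y z\<close> given by the homotopy. Modulo \<open>y\<close> it is a
  cycle, so \<open>w = d u + y v\<close> and \<open>y z = d w = y d v\<close>. The coefficients of \<open>z - d v\<close> lie in \<open>M\<^sub>j\<close>, where
  \<open>y\<close> is injective, so \<open>z = d v\<close>.\<close>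

lemma vanishes_from_section:
  assumes "koszul_vanishes n Q (p + 1) j"
    "\<And>z. z \<in> part M j \<Longrightarrow> y \<odot> z = \<zero> \<Longrightarrow> z = \<zero>"
  shows "koszul_vanishes n M p j"
  unfolding koszul_vanishes_def
proof (intro ballI impI)
  fix z assume z: "z \<in> koszul_chains (Suc n) M p j" "\<forall>bs. koszul_d M (vars n) z bs = \<zero>"
  note zc = chains_carrier[OF z(1)]
  have "in_var_ideal {..n} y"
    using in_var_ideal_all_iff[OF y_carrier] poly_part_const_term[OF _ y] by simp
  then have "in_var_ideal (set [0..<Suc n]) y" by (metis atLeast_upt lessThan_Suc_atMost)
  then obtain as where as: "length as = Suc n" "set as \<subseteq> poly_part n 0"
    "y = sum_list (map2 (*) as (vars n))"
    using linear_form_expansion[OF y] unfolding vars_def by (metis length_upt diff_zero)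
  have as_c: "set as \<subseteq> carrier (poly_ring n)" using as(2) poly_part_carrier by blast
  let ?w = "koszul_h M as z"
  have w: "?w \<in> koszul_chains (Suc n) M (p + 1) j" using koszul_h_chains[OF as(2), of z p j] z(1) as(1) by simp
  note wc = chains_carrier[OF w]
  have hz: "koszul_h M as (koszul_d M (vars n) z) bs = \<zero>" for bs
  proof -
    have "koszul_d M (vars n) z = (\<lambda>_. \<zero>)" using z(2) by blast
    moreover have "koszul_h M as (\<lambda>_. \<zero>) bs = \<zero>"
      using koszul_h_smult[OF R.zero_closed as_c, of "\<lambda>_. \<zero>" bs]
        smult_l_null[OF koszul_h_closed[OF as_c, of "\<lambda>_. \<zero>" bs]] smult_l_null[OF M.zero_closed]
      by simp
    ultimately show ?thesis by simp
  qed
  have dw: "koszul_d M (vars n) ?w bs = y \<odot> z bs" for bs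
  proof (cases "length bs = Suc n")
    case True
    then have "koszul_d M (vars n) ?w bs \<oplus> koszul_h M as (koszul_d M (vars n) z) bs = y \<odot> z bs"
      using koszul_homotopy[OF _ as_c vars_simps(4) zc, of bs] as(1,3) by (simp add: vars_simps)
    then show ?thesis using hz koszul_d_closed[OF vars_simps(4) wc] by simp
  next
    case False
    then show ?thesis
      using chainsD(2)[OF vars_chains[OF w], of bs] chainsD(2)[OF z(1), of bs] y_carrier by simp
  qed
  have "koszul_d Q (vars n) (\<lambda>bs. \<pi> (?w bs)) bs = \<zero>\<^bsub>Q\<^esub>" for bs
  proof -
    have "koszul_d Q (vars n) (\<lambda>bs. \<pi> (?w bs)) bs = \<pi> (y \<odot> z bs)"
      using koszul_d_graded_hom[OF gmod_axioms Q(1) \<pi>_hom, of ?w bs, OF wc] dw by simp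
    then show ?thesis using Q(3)[of "y \<odot> z bs"] zc y_carrier by (simp add: mult_image_def)
  qed
  then obtain u' where u': "u' \<in> koszul_chains (Suc n) Q (p + 1 + 1) (j - 1)"
    "koszul_d Q (vars n) u' = (\<lambda>bs. \<pi> (?w bs))"
    by (rule koszul_vanishesD[OF assms(1) chains_hom[OF gmod_axioms Q(1) \<pi>_hom w]])
  obtain u where u: "u \<in> koszul_chains (Suc n) M (p + 1 + 1) (j - 1)" "\<And>bs. \<pi> (u bs) = u' bs"
    using chains_lift[OF gmod_axioms Q(1,2) u'(1)] by blast
  note uc = chains_carrier[OF u(1)]
  have du: "koszul_d M (vars n) u \<in> koszul_chains (Suc n) M (p + 1) j" using vars_chains[OF u(1)] by (simp add: add.commute)
  note duc = chains_carrier[OF du]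
  let ?e = "\<lambda>bs. ?w bs \<ominus> koszul_d M (vars n) u bs"
  have e: "?e \<in> koszul_chains (Suc n) M (p + 1) j" by (rule chains_diff[OF w du])
  have eI: "?e bs \<in> mult_image M y" for bs
  proof -
    interpret Q: gmod n Q by (rule Q(1))
    interpret \<pi>: abelian_group_hom M Q \<pi>
      by (rule graded_hom_group_hom[OF module_axioms Q.module_axioms \<pi>_hom])
    have "\<pi> (koszul_d M (vars n) u bs) = \<pi> (?w bs)"
      using koszul_d_graded_hom[OF gmod_axioms Q(1) \<pi>_hom, of u bs, OF uc] u(2) fun_cong[OF u'(2), of bs] by simp
    then have "\<pi> (?e bs) = \<zero>\<^bsub>Q\<^esub>"
      using wc[of bs] duc[of bs] \<pi>.hom_add[of "?w bs" "\<ominus> koszul_d M (vars n) u bs"]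
        \<pi>.hom_a_inv[OF duc[of bs]] Q.M.r_neg[OF \<pi>.hom_closed[OF wc[of bs]]]
      by (simp add: a_minus_def)
    then show ?thesis using Q(3)[OF chains_carrier[OF e]] by blast
  qed
  have "\<exists>v. v \<in> part M (j - 1) \<and> ?e bs = y \<odot> v \<and> (?e bs = \<zero> \<longrightarrow> v = \<zero>)" for bs
    using mult_image_part[OF chainsD(1)[OF e] eI] by metis
  then obtain v where v: "\<And>bs. v bs \<in> part M (j - 1)" "\<And>bs. ?e bs = y \<odot> v bs"
    "\<And>bs. ?e bs = \<zero> \<Longrightarrow> v bs = \<zero>"
    by metis
  have vch: "v \<in> koszul_chains (Suc n) M (p + 1) (j - 1)"
    using v(1) v(3)[OF chainsD(2)[OF e]] by (intro chainsI) auto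
  note vc = chains_carrier[OF vch]
  have dv: "koszul_d M (vars n) v \<in> koszul_chains (Suc n) M p j" using vars_chains[OF vch] by simp
  have "koszul_d M (vars n) v bs = z bs" for bs
  proof -
    have "y \<odot> koszul_d M (vars n) v bs = koszul_d M (vars n) ?e bs"
      using koszul_d_smult[OF y_carrier vars_simps(4), of v bs, OF vc] v(2) by simp
    also have "\<dots> = koszul_d M (vars n) ?w bs \<ominus> koszul_d M (vars n) (koszul_d M (vars n) u) bs"
      by (rule koszul_d_diff[OF vars_simps(4) wc duc])
    also have "\<dots> = y \<odot> z bs"
      using koszul_d_d[OF vars_simps(4), of u bs, OF uc] dw zc[of bs] y_carrier by (simp add: a_minus_def)
    finally have "y \<odot> (z bs \<ominus> koszul_d M (vars n) v bs) = \<zero>"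
      using zc[of bs] chains_carrier[OF dv, of bs] y_carrier
      by (simp add: a_minus_def smult_r_distr smult_r_minus M.r_neg)
    then have "z bs \<ominus> koszul_d M (vars n) v bs = \<zero>"
      using assms(2)[OF part_closed_diff[OF chainsD(1)[OF z(1)] chainsD(1)[OF dv]]] by blast
    then show ?thesis
      using zc[of bs] chains_carrier[OF dv, of bs]
        M.minus_equality[of "z bs" "\<ominus> koszul_d M (vars n) v bs"] by (simp add: a_minus_def)
  qed
  then show "\<exists>b \<in> koszul_chains (Suc n) M (p + 1) (j - 1). koszul_d M (vars n) b = z"
    using vch by blast
qed

end

section \<open>Vanishing implies regularity\<close>

definition homogeneous_generators :: "nat \<Rightarrow> ('k::field mpoly, 'm) gmodule \<Rightarrow> 'm set \<Rightarrow> bool" where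
  "homogeneous_generators n M A \<longleftrightarrow> finite A \<and> A \<subseteq> (\<Union>j. part M j) \<and> span_in n M A = carrier M"

context gmod
begin

lemma smult_simps [simp]:
  "x \<in> carrier M \<Longrightarrow> 1 \<odot> x = x" "x \<in> carrier M \<Longrightarrow> 0 \<odot> x = \<zero>"
  using smult_one[of x] smult_l_null[of x] by simp_all

lemma submodule_zero: "submodule N (poly_ring n) M \<Longrightarrow> \<zero> \<in> N"
  using subgroup.one_closed[OF submodule.axioms(1)] by fastforce

lemma finsum_in_submodule:
  assumes "submodule N (poly_ring n) M" "\<And>i. i \<in> A \<Longrightarrow> c i \<in> N"
  shows "finsum M c A \<in> N"
  using assms(2)
proof (induction A rule: infinite_finite_induct)
  case (insert j A)
  then show ?case
    using submoduleE(1,5)[OF assms(1)] by (subst finsum_insert) auto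
qed (auto simp: M.finsum_infinite M.finsum_empty submodule_zero[OF assms(1)])

lemma span_in_eq_carrier:
  assumes "A \<subseteq> carrier M" "\<And>N. submodule N (poly_ring n) M \<Longrightarrow> A \<subseteq> N \<Longrightarrow> carrier M \<subseteq> N"
  shows "span_in n M A = carrier M"
  unfolding span_in_def using assms carrier_is_submodule by blast

lemma homogeneous_generators_exist:
  assumes "fg_graded_module n M"
  obtains A where "homogeneous_generators n M A"
proof -
  obtain A where A: "A \<subseteq> carrier M" "finite A" "span_in n M A = carrier M"
    using assms unfolding fg_graded_module_def by blast
  let ?B = "\<Union>a \<in> A. component M a ` {j. component M a j \<noteq> \<zero>}"
  have "finite ?B" using A component_props(2) by blast
  moreover have B: "?B \<subseteq> (\<Union>j. part M j)" using A(1) component_props(1) by blast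
  moreover have "span_in n M ?B = carrier M"
  proof (rule span_in_eq_carrier)
    show "?B \<subseteq> carrier M" using B part_carrier by blast
    fix N assume N: "submodule N (poly_ring n) M" "?B \<subseteq> N"
    have "a \<in> N" if a: "a \<in> A" for a
    proof -
      have "finsum M (component M a) {j. component M a j \<noteq> \<zero>} \<in> N"
        by (rule finsum_in_submodule[OF N(1)]) (use N(2) a in blast)
      then show ?thesis using component_props(3)[of a] A(1) a by auto
    qed
    then show "carrier M \<subseteq> N"
      using A(3) N(1) unfolding span_in_def by blast
  qed
  ultimately show thesis using that unfolding homogeneous_generators_def by blast
qed

end

lemma free_in_submodule:
  assumes "submodule N (poly_ring n) (free_gmodule n as)" "f \<in> carrier (free_gmodule n as)"
    "\<And>i. i < length as \<Longrightarrow> f i \<odot>\<^bsub>free_gmodule n as\<^esub> unit_vec i \<in> N"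
  shows "f \<in> N"
proof -
  let ?F = "free_gmodule n as"
  interpret gmod n ?F by (rule gmodI[OF free_gmodule_graded])
  have c: "(\<lambda>i. f i \<odot>\<^bsub>?F\<^esub> unit_vec i) \<in> {..<length as} \<rightarrow> carrier ?F"
    using assms(3) submoduleE(1)[OF assms(1)] by blast
  have "finsum ?F (\<lambda>i. f i \<odot>\<^bsub>?F\<^esub> unit_vec i) {..<length as} = f"
  proof
    fix k
    have "finsum ?F (\<lambda>i. f i \<odot>\<^bsub>?F\<^esub> unit_vec i) {..<length as} k = (\<Sum>i < length as. if i = k then f k else 0)"
      unfolding free_gmodule_finsum[OF finite_lessThan c]
      by (intro sum.cong) (auto simp: free_gmodule_simps unit_vec_def)
    also have "\<dots> = f k" using assms(2) by (auto simp: free_gmodule_simps)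
    finally show "finsum ?F (\<lambda>i. f i \<odot>\<^bsub>?F\<^esub> unit_vec i) {..<length as} k = f k" .
  qed
  moreover have "finsum ?F (\<lambda>i. f i \<odot>\<^bsub>?F\<^esub> unit_vec i) {..<length as} \<in> N"
    by (rule finsum_in_submodule[OF assms(1)]) (use assms(3) in simp)
  ultimately show ?thesis by simp
qed

lemma free_generated_in_degrees_le:
  assumes "\<And>a. a \<in> set as \<Longrightarrow> a \<le> s"
  shows "generated_in_degrees_le n (free_gmodule n as :: ('k::field mpoly, _) gmodule) s"
proof -
  let ?F = "free_gmodule n as :: ('k mpoly, _) gmodule"
  interpret gmod n ?F by (rule gmodI[OF free_gmodule_graded])
  show ?thesis
    unfolding generated_in_degrees_le_def
  proof (rule span_in_eq_carrier)
    show "(\<Union>j \<in> {..s}. part ?F j) \<subseteq> carrier ?F" using part_carrier by blast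
    fix N assume N: "submodule N (poly_ring n) ?F" "(\<Union>j \<in> {..s}. part ?F j) \<subseteq> N"
    show "carrier ?F \<subseteq> N"
    proof
      fix f assume f: "f \<in> carrier ?F"
      show "f \<in> N"
      proof (rule free_in_submodule[OF N(1) f])
        fix i assume i: "i < length as"
        then have "unit_vec i \<in> N" using N(2) unit_vec_part[OF i] assms[OF nth_mem[OF i]] by blast
        then show "f i \<odot>\<^bsub>?F\<^esub> unit_vec i \<in> N"
          using submoduleE(4)[OF N(1)] f i by (simp add: free_gmodule_simps(1))
      qed
    qed
  qed
qed

lemma const_free_in_max_ideal_span:
  fixes f :: "nat \<Rightarrow> 'k::field mpoly"
  assumes "f \<in> carrier (free_gmodule n as)" "\<And>i. lookup (f i) 0 = 0"
  shows "f \<in> span_in n (free_gmodule n as)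
     {a \<odot>\<^bsub>free_gmodule n as\<^esub> g | a g. a \<in> max_ideal n \<and> g \<in> carrier (free_gmodule n as)}"
  unfolding span_in_def
proof (intro InterI, elim CollectE conjE)
  let ?F = "free_gmodule n as :: ('k mpoly, _) gmodule"
  interpret gmod n ?F by (rule gmodI[OF free_gmodule_graded])
  fix N assume N: "submodule N (poly_ring n) ?F"
    "{a \<odot>\<^bsub>?F\<^esub> g | a g. a \<in> max_ideal n \<and> g \<in> carrier ?F} \<subseteq> N"
  show "f \<in> N"
  proof (rule free_in_submodule[OF N(1) assms(1)])
    fix i assume i: "i < length as"
    then have "f i \<in> max_ideal n"
      using assms by (intro max_ideal_I) (auto simp: free_gmodule_simps)
    then show "f i \<odot>\<^bsub>?F\<^esub> unit_vec i \<in> N"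
      using N(2) part_carrier[OF unit_vec_part[OF i]] by blast
  qed
qed

subsection \<open>Minimal free covers\<close>

lemma free_cover_of_generators:
  fixes M :: "('k::field mpoly, 'm) gmodule" (structure)
  assumes "gmod n M" "\<And>i. i < length gs \<Longrightarrow> gs ! i \<in> part M (as ! i)" "length as = length gs"
    "span_in n M (set gs) = carrier M"
  defines "\<epsilon> \<equiv> \<lambda>f. \<Oplus>\<^bsub>M\<^esub>i \<in> {..<length gs}. f i \<odot> gs ! i"
  shows "free_cover n M as \<epsilon>" "i < length gs \<Longrightarrow> \<epsilon> (unit_vec i) = gs ! i"
proof -
  interpret gmod n M by fact
  let ?F = "free_gmodule n as :: ('k mpoly, _) gmodule" and ?I = "{..<length gs}"
  interpret F: gmod n ?F by (rule gmodI[OF free_gmodule_graded])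
  have gc: "gs ! i \<in> carrier M" if "i < length gs" for i using part_carrier[OF assms(2)[OF that]] .
  have fc: "f i \<in> carrier (poly_ring n)" if "f \<in> carrier ?F" "i < length gs" for f i
    using that assms(3) by (simp add: free_gmodule_simps)
  have terms: "(\<lambda>i. f i \<odot> gs ! i) \<in> ?I \<rightarrow> carrier M" if "f \<in> carrier ?F" for f
    using that fc gc by auto
  have cl: "\<epsilon> f \<in> carrier M" if "f \<in> carrier ?F" for f
    unfolding \<epsilon>_def by (rule finsum_closed[OF terms[OF that]])
  have add: "\<epsilon> (f \<oplus>\<^bsub>?F\<^esub> g) = \<epsilon> f \<oplus> \<epsilon> g" if "f \<in> carrier ?F" "g \<in> carrier ?F" for f g
  proof -
    have "\<epsilon> f \<oplus> \<epsilon> g = (\<Oplus>\<^bsub>M\<^esub>i \<in> ?I. f i \<odot> gs ! i \<oplus> g i \<odot> gs ! i)"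
      unfolding \<epsilon>_def by (rule finsum_addf[OF terms[OF that(1)] terms[OF that(2)], symmetric])
    also have "\<dots> = \<epsilon> (f \<oplus>\<^bsub>?F\<^esub> g)"
      unfolding \<epsilon>_def
    proof (rule M.finsum_cong')
      show "f i \<odot> gs ! i \<oplus> g i \<odot> gs ! i = (f \<oplus>\<^bsub>?F\<^esub> g) i \<odot> gs ! i" if i: "i \<in> ?I" for i
        using smult_l_distr[of "f i" "g i" "gs ! i"] fc gc i \<open>f \<in> carrier ?F\<close> \<open>g \<in> carrier ?F\<close>
        by (simp add: free_gmodule_simps(3))
      show "(\<lambda>i. (f \<oplus>\<^bsub>?F\<^esub> g) i \<odot> gs ! i) \<in> ?I \<rightarrow> carrier M"
        by (rule terms) (use that in blast)
    qed simp
    finally show ?thesis by simp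
  qed
  have sm: "\<epsilon> (a \<odot>\<^bsub>?F\<^esub> f) = a \<odot> \<epsilon> f" if "a \<in> carrier (poly_ring n)" "f \<in> carrier ?F" for a f
  proof -
    have "a \<odot> \<epsilon> f = (\<Oplus>\<^bsub>M\<^esub>i \<in> ?I. a \<odot> (f i \<odot> gs ! i))"
      unfolding \<epsilon>_def by (rule finsum_smult_ldistr[OF _ that(1) terms[OF that(2)]]) simp
    also have "\<dots> = \<epsilon> (a \<odot>\<^bsub>?F\<^esub> f)"
      unfolding \<epsilon>_def
    proof (rule M.finsum_cong')
      show "a \<odot> (f i \<odot> gs ! i) = (a \<odot>\<^bsub>?F\<^esub> f) i \<odot> gs ! i" if i: "i \<in> ?I" for i
        using smult_assoc1[of a "f i" "gs ! i"] fc gc i \<open>f \<in> carrier ?F\<close> \<open>a \<in> _\<close>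
        by (simp add: free_gmodule_simps(4))
      show "(\<lambda>i. (a \<odot>\<^bsub>?F\<^esub> f) i \<odot> gs ! i) \<in> ?I \<rightarrow> carrier M"
        by (rule terms) (use that in blast)
    qed simp
    finally show ?thesis by simp
  qed
  have part: "\<epsilon> f \<in> part M j" if f: "f \<in> part ?F j" for f j
  proof -
    have t: "f i \<odot> gs ! i \<in> part M j" if "i < length gs" for i
      using part_closed(4)[OF _ assms(2)[OF that], of "f i" "j - as ! i"] f that assms(3)
      by (simp add: free_gmodule_simps)
    have "finsum M (\<lambda>i. f i \<odot> gs ! i) J \<in> part M j" if "finite J" "J \<subseteq> ?I" for J
      using that
    proof (induction J rule: finite_induct)
      case (insert i J)
      then show ?case using t part_carrier by (subst finsum_insert) (auto intro!: part_closed)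
    qed (simp add: part_closed)
    then show ?thesis unfolding \<epsilon>_def by blast
  qed
  have hom: "graded_hom n ?F M \<epsilon>"
    unfolding graded_hom_def using cl add sm part by blast
  interpret h: abelian_group_hom ?F M \<epsilon>
    by (rule graded_hom_group_hom[OF F.module_axioms module_axioms hom])
  show unit: "\<epsilon> (unit_vec i) = gs ! i" if i: "i < length gs" for i
  proof -
    have "\<epsilon> (unit_vec i) = (\<Oplus>\<^bsub>M\<^esub>k \<in> ?I. if i = k then gs ! k else \<zero>)"
      unfolding \<epsilon>_def using gc by (intro M.finsum_cong') (auto simp: unit_vec_def)
    also have "\<dots> = gs ! i" using i gc by (intro M.finsum_singleton) auto
    finally show ?thesis .
  qed
  have "submodule (\<epsilon> ` carrier ?F) (poly_ring n) M"
  proof (rule submoduleI)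
    show "\<epsilon> ` carrier ?F \<subseteq> carrier M" using cl by blast
    show "\<zero> \<in> \<epsilon> ` carrier ?F" using h.hom_zero F.M.zero_closed by (metis imageI)
    show "\<ominus> a \<in> \<epsilon> ` carrier ?F" if a: "a \<in> \<epsilon> ` carrier ?F" for a
    proof -
      obtain f where "f \<in> carrier ?F" "a = \<epsilon> f" using a by blast
      then show ?thesis using h.hom_a_inv[of f] F.M.a_inv_closed[of f] by (metis imageI)
    qed
    show "a \<oplus> b \<in> \<epsilon> ` carrier ?F" if ab: "a \<in> \<epsilon> ` carrier ?F" "b \<in> \<epsilon> ` carrier ?F" for a b
    proof -
      obtain f g where "f \<in> carrier ?F" "a = \<epsilon> f" "g \<in> carrier ?F" "b = \<epsilon> g" using ab by blast
      then show ?thesis using add[of f g] F.M.a_closed[of f g] by (metis imageI)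
    qed
    show "a \<odot> b \<in> \<epsilon> ` carrier ?F" if a: "a \<in> carrier (poly_ring n)" and b: "b \<in> \<epsilon> ` carrier ?F" for a b
    proof -
      obtain f where "f \<in> carrier ?F" "b = \<epsilon> f" using b by blast
      then show ?thesis using sm[OF a, of f] F.smult_closed[OF a, of f] by (metis imageI)
    qed
  qed
  moreover have "set gs \<subseteq> \<epsilon> ` carrier ?F"
  proof
    fix g assume "g \<in> set gs"
    then obtain i where "i < length gs" "g = gs ! i" by (metis in_set_conv_nth)
    then show "g \<in> \<epsilon> ` carrier ?F"
      using unit F.part_carrier[OF unit_vec_part[of i as n]] assms(3) by (metis imageI)
  qed
  ultimately have "carrier M \<subseteq> \<epsilon> ` carrier ?F"
    using assms(4) unfolding span_in_def by blast
  then show "free_cover n M as \<epsilon>"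
    unfolding free_cover_def graded_epi_def using assms(1) hom cl by blast
qed

text \<open>The generators are chosen with least cardinality. An element of the kernel with a nonzero
  constant entry could be made homogeneous and solved for one of them. If the degree \<open>a\<close> of a
  generator were one with \<open>M\<^sub>a \<subseteq> \<mm> M\<close>, writing the generator as an element of \<open>\<mm> M\<close> would yield such
  an element of the kernel.\<close>

lemma minimal_free_cover:
  fixes M :: "('k::field mpoly, 'm) gmodule" (structure)
  assumes "gmod n M" "homogeneous_generators n M A0"
  obtains as \<epsilon> where "free_cover n M as \<epsilon>"
    "\<And>f i. f \<in> a_kernel (free_gmodule n as) M \<epsilon> \<Longrightarrow> lookup (f i) 0 = 0"
    "\<And>a. a \<in> set as \<Longrightarrow> \<not> koszul_vanishes n M 0 a"
proof -
  interpret gmod n M by fact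
  obtain A where A: "homogeneous_generators n M A"
    and least: "\<And>B. homogeneous_generators n M B \<Longrightarrow> card A \<le> card B"
    using ex_has_least_nat[of "homogeneous_generators n M" A0 card] assms(2) by blast
  obtain gs where gs: "set gs = A" "distinct gs"
    using A finite_distinct_list unfolding homogeneous_generators_def by blast
  obtain d where d: "\<And>g. g \<in> A \<Longrightarrow> g \<in> part M (d g)"
    using A unfolding homogeneous_generators_def by (metis UN_E subsetD)
  define as where "as = map d gs"
  define \<epsilon> where "\<epsilon> f = (\<Oplus>\<^bsub>M\<^esub>i \<in> {..<length gs}. f i \<odot> gs ! i)" for f
  have len: "length as = length gs" by (simp add: as_def)
  have part: "gs ! i \<in> part M (as ! i)" if "i < length gs" for i
    using that d[of "gs ! i"] gs(1) nth_mem[OF that] by (simp add: as_def)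
  have span: "span_in n M (set gs) = carrier M"
    using A gs(1) unfolding homogeneous_generators_def by simp
  note cover = free_cover_of_generators[OF assms(1) part len span, folded \<epsilon>_def]
  have is_cover: "free_cover n M as \<epsilon>" by (rule cover(1))
  have unit: "\<epsilon> (unit_vec i) = gs ! i" if "i < length gs" for i
    using that by (intro cover(2))
  interpret free_cover n M as \<epsilon> by (rule is_cover)
  have gc: "gs ! i \<in> carrier M" if "i < length gs" for i using part_carrier[OF part[OF that]] .
  have minimal: "lookup (f i) 0 = 0" if f: "f \<in> Ker" for f i
  proof (rule ccontr)
    assume c: "lookup (f i) 0 \<noteq> 0"
    let ?c = "lookup (f i) 0"
    have fF: "f \<in> carrier F" using f Ker_carrier by blast
    have i: "i < length gs" using c fF len by (metis free_gmodule_simps(1) lookup_zero not_le)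
    \<comment> \<open>In the degree of the \<open>i\<close>-th generator, the \<open>i\<close>-th entry of \<open>f\<close> is reduced to its constant term.\<close>
    define h where "h = component F f (as ! i)"
    have h: "h \<in> carrier F" "\<epsilon> h = \<zero>"
      using F.component_carrier[OF fF] component_hom[OF F M hom fF, of "as ! i"] f component_part[OF part_closed(1), of 0]
      unfolding h_def Ker_iff by auto
    have "h i = poly_component 0 (f i)"
      unfolding h_def component_free_gmodule[OF fF] using i len by simp
    then have "h i \<in> poly_part n 0" "lookup (h i) 0 = ?c"
      using fF i len poly_component_part[of "f i" n 0] by (auto simp: free_gmodule_simps poly_component_def)
    then have hi: "h i = single 0 ?c" using poly_part_0_const by metis
    define h' where "h' = single 0 (inverse ?c) \<odot>\<^bsub>F\<^esub> h"
    have h': "h' \<in> carrier F" "\<epsilon> h' = \<zero>"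
      using h graded_homD(3)[OF hom, of "single 0 (inverse ?c)" h] by (auto simp: h'_def)
    have h'i: "h' i = 1"
      using c by (simp add: h'_def free_gmodule_simps(4) hi mult_single)
    have tc: "h' k \<odot> gs ! k \<in> carrier M" if "k < length gs" for k
      using h'(1) gc that len by (simp add: free_gmodule_simps)
    let ?J = "{..<length gs} - {i}"
    have "\<epsilon> h' = finsum M (\<lambda>k. h' k \<odot> gs ! k) (insert i ?J)"
      unfolding \<epsilon>_def using i by (simp add: insert_absorb)
    also have "\<dots> = gs ! i \<oplus> finsum M (\<lambda>k. h' k \<odot> gs ! k) ?J"
      using tc i gc[OF i] h'i by (subst finsum_insert) auto
    finally have eq: "gs ! i \<oplus> finsum M (\<lambda>k. h' k \<odot> gs ! k) ?J = \<zero>" using h'(2) by simp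
    have sc: "finsum M (\<lambda>k. h' k \<odot> gs ! k) ?J \<in> carrier M" using tc by (intro finsum_closed) auto
    have "homogeneous_generators n M (A - {gs ! i})"
      unfolding homogeneous_generators_def
    proof (intro conjI span_in_eq_carrier)
      show "finite (A - {gs ! i})" "A - {gs ! i} \<subseteq> (\<Union>j. part M j)"
        using A unfolding homogeneous_generators_def by auto
      then show "A - {gs ! i} \<subseteq> carrier M" using part_carrier by blast
      fix N assume N: "submodule N (poly_ring n) M" "A - {gs ! i} \<subseteq> N"
      have "finsum M (\<lambda>k. h' k \<odot> gs ! k) ?J \<in> N"
      proof (rule finsum_in_submodule[OF N(1)])
        fix k assume k: "k \<in> ?J"
        then have "gs ! k \<in> A - {gs ! i}"
          using gs i by (auto simp: nth_eq_iff_index_eq)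
        then show "h' k \<odot> gs ! k \<in> N"
          using N(2) submoduleE(4)[OF N(1)] h'(1) k len by (auto simp: free_gmodule_simps)
      qed
      then have "\<ominus> finsum M (\<lambda>k. h' k \<odot> gs ! k) ?J \<in> N" by (rule submoduleE(3)[OF N(1)])
      moreover have "\<ominus> finsum M (\<lambda>k. h' k \<odot> gs ! k) ?J = gs ! i"
        by (rule M.minus_equality[OF eq sc gc[OF i]])
      ultimately have "A \<subseteq> N" using N(2) by auto
      then show "carrier M \<subseteq> N"
        using A N(1) unfolding homogeneous_generators_def span_in_def by blast
    qed
    then have "card A \<le> card (A - {gs ! i})" by (rule least)
    moreover have "gs ! i \<in> A" "finite A"
      using gs(1) i A unfolding homogeneous_generators_def by auto
    ultimately show False by (metis card_Diff1_less not_le)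
  qed
  have "\<not> koszul_vanishes n M 0 a" if a: "a \<in> set as" for a
  proof
    assume v: "koszul_vanishes n M 0 a"
    obtain i where i: "i < length gs" "a = as ! i" using a len by (metis in_set_conv_nth)
    let ?r = "replicate (Suc n) False"
    obtain b where b: "b \<in> koszul_chains (Suc n) M 1 (a - 1)" "koszul_d M (vars n) b ?r = gs ! i"
      using degree_zero_boundary[OF v] part[OF i(1)] i(2) by blast
    obtain u where u: "u \<in> koszul_chains (Suc n) F 1 (a - 1)" "\<And>bs. \<epsilon> (u bs) = b bs"
      using chains_lift[OF F M epi b(1)] by blast
    note uc = F.chains_carrier[OF u(1)]
    let ?w = "koszul_d F (vars n) u ?r"
    have wc: "?w \<in> carrier F" by (rule F.koszul_d_closed[OF vars_simps(4) uc])
    have uv: "unit_vec i \<in> carrier F" using F.part_carrier[OF unit_vec_part] i(1) len by simp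
    have ew: "\<epsilon> ?w = gs ! i"
      using koszul_d_\<epsilon>[of u ?r, OF uc] u(2) b(2) by simp
    have "unit_vec i \<ominus>\<^bsub>F\<^esub> ?w \<in> Ker"
      unfolding Ker_iff using uv wc ew unit[OF i(1)] gc[OF i(1)] by (simp add: a_minus_def M.r_neg)
    from minimal[OF this, of i] have "lookup (?w i) 0 = 1"
      using free_gmodule_uminus[OF wc]
      by (simp add: a_minus_def free_gmodule_simps(3) unit_vec_def lookup_add)
    moreover have "in_var_ideal (set [0..<Suc n]) (?w i)"
      unfolding vars_def by (rule koszul_d_free_in_var_ideal[OF uc]) auto
    then have "in_var_ideal {..n} (?w i)" by (metis atLeast_upt lessThan_Suc_atMost)
    moreover have "?w i \<in> carrier (poly_ring n)" using wc i(1) len by (simp add: free_gmodule_simps)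
    ultimately show False using in_var_ideal_all_iff by (metis zero_neq_one)
  qed
  then show thesis using that[OF is_cover] minimal by blast
qed

subsection \<open>Finite generation of syzygies\<close>

lemma lookup_const_mult: "lookup (single 0 s * p) e = s * lookup p e"
  by (simp add: mult_map_scale_conv_mult[symmetric] map.rep_eq when_def)

text \<open>A subspace separated by finitely many coordinates has a finite spanning set: a vector with
  nonzero entry at one coordinate eliminates that coordinate from all others.\<close>

lemma finite_coordinates_generate:
  fixes V :: "(nat \<Rightarrow> 'k::field mpoly) set"
  assumes "finite E"
    "\<And>v w s. v \<in> V \<Longrightarrow> w \<in> V \<Longrightarrow> (\<lambda>i. v i + single 0 s * w i) \<in> V"
    "\<And>v. v \<in> V \<Longrightarrow> (\<And>i e. (i, e) \<in> E \<Longrightarrow> lookup (v i) e = 0) \<Longrightarrow> v = (\<lambda>_. 0)"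
  shows "\<exists>B. finite B \<and> B \<subseteq> V \<and> (\<forall>N. B \<subseteq> N \<and> (\<lambda>_. 0) \<in> N \<and>
     (\<forall>v \<in> N. \<forall>w \<in> N. \<forall>s. (\<lambda>i. v i + single 0 s * w i) \<in> N) \<longrightarrow> V \<subseteq> N)"
  using assms
proof (induction E arbitrary: V rule: finite_induct)
  case empty
  then have "V \<subseteq> {\<lambda>_. 0}" by blast
  then show ?case by (intro exI[of _ "{}"]) blast
next
  case (insert x E)
  obtain i0 e0 where x: "x = (i0, e0)" by fastforce
  let ?V0 = "{v \<in> V. lookup (v i0) e0 = 0}"
  have "\<exists>B. finite B \<and> B \<subseteq> ?V0 \<and> (\<forall>N. B \<subseteq> N \<and> (\<lambda>_. 0) \<in> N \<and>
     (\<forall>v \<in> N. \<forall>w \<in> N. \<forall>s. (\<lambda>i. v i + single 0 s * w i) \<in> N) \<longrightarrow> ?V0 \<subseteq> N)"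
  proof (rule insert.IH)
    show "(\<lambda>i. v i + single 0 s * w i) \<in> ?V0" if "v \<in> ?V0" "w \<in> ?V0" for v w s
      using that insert.prems(1) by (simp add: lookup_add lookup_const_mult)
    show "v = (\<lambda>_. 0)" if "v \<in> ?V0" "\<And>i e. (i, e) \<in> E \<Longrightarrow> lookup (v i) e = 0" for v
      using that by (intro insert.prems(2)) (auto simp: x)
  qed
  then obtain B where B: "finite B" "B \<subseteq> ?V0"
    "\<forall>N. B \<subseteq> N \<and> (\<lambda>_. 0) \<in> N \<and>
     (\<forall>v \<in> N. \<forall>w \<in> N. \<forall>s. (\<lambda>i. v i + single 0 s * w i) \<in> N) \<longrightarrow> ?V0 \<subseteq> N"
    by (elim exE conjE)
  show ?case
  proof (cases "V = ?V0")
    case True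
    then show ?thesis using B by (intro exI[of _ B]) blast
  next
    case False
    then obtain w where w: "w \<in> V" "lookup (w i0) e0 \<noteq> 0" by blast
    show ?thesis
    proof (intro exI[of _ "insert w B"] conjI allI impI)
      fix N assume N: "insert w B \<subseteq> N \<and> (\<lambda>_. 0) \<in> N \<and>
        (\<forall>v \<in> N. \<forall>w \<in> N. \<forall>s. (\<lambda>i. v i + single 0 s * w i) \<in> N)"
      have closed: "(\<lambda>i. v i + single 0 s * w i) \<in> N" if "v \<in> N" "w \<in> N" for v w s
        using N that by simp
      have V0: "?V0 \<subseteq> N"
        by (rule B(3)[THEN spec, THEN mp]) (use N in simp)
      show "V \<subseteq> N"
      proof
        fix v assume v: "v \<in> V"
        let ?s = "lookup (v i0) e0 / lookup (w i0) e0"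
        let ?u = "\<lambda>i. v i + single 0 (- ?s) * w i"
        have "?u \<in> ?V0"
          using insert.prems(1)[OF v w(1), of "- ?s"] w(2) by (simp add: lookup_add lookup_const_mult)
        then have "?u \<in> N" by (rule subsetD[OF V0])
        moreover have "w \<in> N" using N by simp
        ultimately have "(\<lambda>i. ?u i + single 0 ?s * w i) \<in> N" by (rule closed)
        moreover have "(\<lambda>i. ?u i + single 0 ?s * w i) = v"
          by (simp add: single_uminus)
        ultimately show "v \<in> N" by simp
      qed
    qed (use B w in auto)
  qed
qed

text \<open>The vanishing of \<open>H\<^sub>0\<close> above degree \<open>D\<close> says \<open>M\<^sub>j \<subseteq> \<mm> M\<^sub>j\<^sub>-\<^sub>1\<close> for \<open>j > D\<close>.\<close>

lemma (in gmod) generated_by_low_degrees: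
  assumes "\<And>j. D < j \<Longrightarrow> koszul_vanishes n M 0 j" "submodule N (poly_ring n) M"
    "\<And>j. j \<le> D \<Longrightarrow> part M j \<subseteq> N"
  shows "carrier M \<subseteq> N"
proof (rule submodule_of_parts[OF assms(2)])
  have "part M (D + int k) \<subseteq> N" for k
  proof (induction k)
    case 0
    then show ?case using assms(3) by simp
  next
    case (Suc k)
    show ?case
    proof
      fix z assume z: "z \<in> part M (D + int (Suc k))"
      let ?r = "replicate (Suc n) False"
      obtain b where b: "b \<in> koszul_chains (Suc n) M 1 (D + int (Suc k) - 1)" "koszul_d M (vars n) b ?r = z"
        by (rule degree_zero_boundary[OF assms(1) z]) auto
      have "b bs \<in> N" for bs using chainsD(1)[OF b(1), of bs] Suc.IH by auto
      then have "koszul_d M (vars n) b ?r \<in> N"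
        using submoduleE(4)[OF assms(2)] vars_simps(4)[of n] by (intro koszul_d_in_submodule[OF assms(2)]) blast
      then show "z \<in> N" using b(2) by simp
    qed
  qed
  then have "part M j \<subseteq> N" if "D < j" for j
    using that by (metis less_imp_le zle_iff_zadd)
  then show "part M j \<subseteq> N" for j
    using assms(3) by (cases "D < j") auto
qed

text \<open>Generators are needed in degrees up to \<open>D\<close> only. As the degrees of \<open>F\<close> are bounded below, these
  are finitely many, and in each of them \<open>F\<close> is a finite-dimensional vector space.\<close>

lemma (in free_cover) kernel_generators:
  assumes "\<And>j. D < j \<Longrightarrow> koszul_vanishes n K 0 j"
  obtains A where "homogeneous_generators n K A"
proof -
  define lo where "lo = Min (insert 0 (set as))"
  have low: "f = (\<lambda>_. 0)" if f: "f \<in> part F j" "j < lo" for f j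
  proof
    fix i
    show "f i = 0"
    proof (cases "i < length as")
      case True
      then have "lo \<le> as ! i" unfolding lo_def by (intro Min_le) auto
      then show ?thesis
        using f True by (intro poly_part_neg[of "j - as ! i" _ n]) (auto simp: free_gmodule_simps)
    qed (use f in \<open>simp add: free_gmodule_simps\<close>)
  qed
  have "\<exists>B. finite B \<and> B \<subseteq> part K j \<and> (\<forall>N. submodule N (poly_ring n) K \<and> B \<subseteq> N \<longrightarrow> part K j \<subseteq> N)" for j
  proof -
    let ?d = "\<Sum>i < length as. nat (j - as ! i)"
    let ?X = "{..<length as} \<times> {e. keys e \<subseteq> {..n} \<and> monom_degree e \<le> ?d}"
    have comb: "(\<lambda>i. v i + single 0 s * w i) = v \<oplus>\<^bsub>K\<^esub> single 0 s \<odot>\<^bsub>K\<^esub> w" for v w s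
      by (simp add: free_gmodule_simps)
    have "\<exists>B. finite B \<and> B \<subseteq> part K j \<and> (\<forall>N. B \<subseteq> N \<and> (\<lambda>_. 0) \<in> N \<and>
     (\<forall>v \<in> N. \<forall>w \<in> N. \<forall>s. (\<lambda>i. v i + single 0 s * w i) \<in> N) \<longrightarrow> part K j \<subseteq> N)"
    proof (rule finite_coordinates_generate[of ?X])
      show "finite ?X" using finite_bounded_exponents by blast
      show "(\<lambda>i. v i + single 0 s * w i) \<in> part K j" if "v \<in> part K j" "w \<in> part K j" for v w s
        unfolding comb
        using K.part_closed(2)[OF that(1) K.part_closed(4)[OF poly_part_const that(2), unfolded add_0]] .
      fix v assume v: "v \<in> part K j" "\<And>i e. (i, e) \<in> ?X \<Longrightarrow> lookup (v i) e = 0"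
      have vF: "v \<in> part F j" using v(1) by simp
      have "v i = 0" for i
      proof (cases "i < length as")
        case True
        have "keys (v i) = {}"
        proof (rule equals0I)
          fix e assume e: "e \<in> keys (v i)"
          then have "keys e \<subseteq> {..n}" "int (monom_degree e) = j - as ! i"
            using vF True by (auto simp: free_gmodule_simps poly_part_iff)
          moreover have "nat (j - as ! i) \<le> ?d"
            using True by (intro member_le_sum) auto
          ultimately have "(i, e) \<in> ?X" using True by auto
          then show False using v(2) e by (simp add: in_keys_iff)
        qed
        then show ?thesis by simp
      qed (use vF in \<open>simp add: free_gmodule_simps\<close>)
      then show "v = (\<lambda>_. 0)" by blast
    qed
    then obtain B where B: "finite B" "B \<subseteq> part K j" "\<forall>N. B \<subseteq> N \<and> (\<lambda>_. 0) \<in> N \<and>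
     (\<forall>v \<in> N. \<forall>w \<in> N. \<forall>s. (\<lambda>i. v i + single 0 s * w i) \<in> N) \<longrightarrow> part K j \<subseteq> N"
      by (elim exE conjE)
    have "part K j \<subseteq> N" if N: "submodule N (poly_ring n) K" "B \<subseteq> N" for N
    proof (rule B(3)[THEN spec, THEN mp], intro conjI)
      show "B \<subseteq> N" by (rule N(2))
      show "(\<lambda>_. 0) \<in> N" using K.submodule_zero[OF N(1)] by (simp add: free_gmodule_simps)
      show "\<forall>v \<in> N. \<forall>w \<in> N. \<forall>s. (\<lambda>i. v i + single 0 s * w i) \<in> N"
        unfolding comb using K.submoduleE(4,5)[OF N(1)] carrier_poly_const by blast
    qed
    then show ?thesis using B by blast
  qed
  then obtain B where B: "\<And>j. finite (B j)" "\<And>j. B j \<subseteq> part K j"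
    "\<And>j N. submodule N (poly_ring n) K \<Longrightarrow> B j \<subseteq> N \<Longrightarrow> part K j \<subseteq> N"
    by metis
  have "homogeneous_generators n K (\<Union>j \<in> {lo..D}. B j)"
    unfolding homogeneous_generators_def
  proof (intro conjI K.span_in_eq_carrier)
    show "finite (\<Union>j \<in> {lo..D}. B j)" using B(1) by blast
    show "(\<Union>j \<in> {lo..D}. B j) \<subseteq> (\<Union>j. part K j)" using B(2) by blast
    then show "(\<Union>j \<in> {lo..D}. B j) \<subseteq> carrier K" using K.part_carrier by blast
    fix N assume N: "submodule N (poly_ring n) K" "(\<Union>j \<in> {lo..D}. B j) \<subseteq> N"
    show "carrier K \<subseteq> N"
    proof (rule K.generated_by_low_degrees[OF assms N(1)])
      fix j assume j: "j \<le> D"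
      show "part K j \<subseteq> N"
      proof (cases "lo \<le> j")
        case True
        then show ?thesis using B(3)[OF N(1), of j] N(2) j by (meson SUP_le_iff atLeastAtMost_iff)
      next
        case False
        have "f \<in> N" if "f \<in> part K j" for f
          using low[of f j] that False K.submodule_zero[OF N(1)] by (simp add: free_gmodule_simps(2))
        then show ?thesis by blast
      qed
    qed
  qed
  then show thesis by (rule that)
qed

subsection \<open>Building the resolution\<close>

lemma regular_of_zero_cover:
  assumes "free_cover n M [] \<epsilon>"
  shows "regular n r M"
proof -
  interpret free_cover n M "[]" \<epsilon> by fact
  have F0: "carrier F = {\<lambda>_. 0}" by (auto simp: free_gmodule_simps)
  have "Ker = {\<lambda>_. 0}"
    using F0 \<epsilon>.hom_zero unfolding kernel_iff set_eq_iff by (auto simp: free_gmodule_simps(2))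
  moreover have "a_kernel F F (\<lambda>_ _. 0) = {\<lambda>_. 0}"
    unfolding set_eq_iff kernel_iff F0 by (simp add: free_gmodule_simps(2))
  moreover have "graded_hom n F F (\<lambda>_ _. 0)"
    by (auto simp: graded_hom_def free_gmodule_simps)
  moreover have "(\<lambda>_. 0) \<in> span_in n F S" for S
    using F.submodule_zero unfolding span_in_def by (auto simp: free_gmodule_simps(2))
  ultimately have "minimal_graded_free_resolution n M 0 (\<lambda>_. []) (\<lambda>_ _ _. 0) \<epsilon>"
    unfolding minimal_graded_free_resolution_def Let_def using epi F0 by auto
  then show ?thesis
    unfolding regular_def using free_generated_in_degrees_le[of "[]"] by force
qed

lemma (in free_cover) regular_of_kernel:
  assumes "\<And>f i. f \<in> Ker \<Longrightarrow> lookup (f i) 0 = 0" "\<And>a. a \<in> set as \<Longrightarrow> a \<le> r"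
    "regular n (r + 1) K"
  shows "regular n r M"
proof -
  obtain l as' \<delta> \<epsilon>' where res: "minimal_graded_free_resolution n K l as' \<delta> \<epsilon>'"
    and gen: "\<And>i. i \<le> l \<Longrightarrow> generated_in_degrees_le n
        (free_gmodule n (as' i) :: ('k mpoly, nat \<Rightarrow> 'k mpoly) gmodule) (r + 1 + int i)"
    using assms(3) unfolding regular_def by blast
  define G where "G i = (free_gmodule n (as' i) :: ('k mpoly, nat \<Rightarrow> 'k mpoly) gmodule)" for i
  have res': "\<And>i. i > l \<Longrightarrow> as' i = []" "graded_epi n (G 0) K \<epsilon>'"
    "\<And>i. graded_hom n (G (Suc i)) (G i) (\<delta> i)"
    "\<delta> 0 ` carrier (G 1) = a_kernel (G 0) K \<epsilon>'"
    "\<And>i. \<delta> (Suc i) ` carrier (G (Suc (Suc i))) = a_kernel (G (Suc i)) (G i) (\<delta> i)"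
    "\<And>i. \<delta> i ` carrier (G (Suc i)) \<subseteq>
          span_in n (G i) {a \<odot>\<^bsub>G i\<^esub> f | a f. a \<in> max_ideal n \<and> f \<in> carrier (G i)}"
    using res unfolding minimal_graded_free_resolution_def Let_def G_def by blast+
  define bs where "bs i = (case i of 0 \<Rightarrow> as | Suc i \<Rightarrow> as' i)" for i
  define d where "d i = (case i of 0 \<Rightarrow> \<epsilon>' | Suc i \<Rightarrow> \<delta> i)" for i
  define H where "H i = (free_gmodule n (bs i) :: ('k mpoly, nat \<Rightarrow> 'k mpoly) gmodule)" for i
  have H: "H 0 = F" "H (Suc i) = G i" for i by (simp_all add: H_def bs_def G_def)
  have d: "d 0 = \<epsilon>'" "d (Suc i) = \<delta> i" for i by (simp_all add: d_def)
  have hom': "graded_hom n (G 0) K \<epsilon>'" and im: "\<epsilon>' ` carrier (G 0) = Ker"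
    using res'(2) by (auto simp: graded_epi_def)
  have "graded_hom n (G 0) F \<epsilon>'"
    using hom' Ker_carrier unfolding graded_hom_def by auto
  then have homs: "graded_hom n (H (Suc i)) (H i) (d i)" for i
    using res'(3) by (cases i) (simp_all add: H d)
  have exact: "d (Suc i) ` carrier (H (Suc (Suc i))) = a_kernel (H (Suc i)) (H i) (d i)" for i
  proof (cases i)
    case 0
    have "a_kernel (G 0) K \<epsilon>' = a_kernel (G 0) F \<epsilon>'" unfolding set_eq_iff kernel_iff by simp
    then show ?thesis using 0 res'(4) by (simp add: H d)
  next
    case (Suc i')
    then show ?thesis using res'(5) by (simp add: H d)
  qed
  have min: "d i ` carrier (H (Suc i)) \<subseteq>
      span_in n (H i) {a \<odot>\<^bsub>H i\<^esub> f | a f. a \<in> max_ideal n \<and> f \<in> carrier (H i)}" for i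
  proof (cases i)
    case 0
    have "f \<in> span_in n F {a \<odot>\<^bsub>F\<^esub> g | a g. a \<in> max_ideal n \<and> g \<in> carrier F}" if "f \<in> Ker" for f
      using that Ker_carrier assms(1) by (intro const_free_in_max_ideal_span) auto
    then show ?thesis using 0 im by (auto simp: H d)
  next
    case (Suc i')
    then show ?thesis using res'(6)[of i'] by (simp add: H d)
  qed
  have zero: "bs i = []" if "i > Suc l" for i
    using that res'(1) by (cases i) (auto simp: bs_def)
  have "minimal_graded_free_resolution n M (Suc l) bs d \<epsilon>"
    unfolding minimal_graded_free_resolution_def Let_def H_def[symmetric]
  proof (intro conjI allI impI)
    show "graded_epi n (H 0) M \<epsilon>" using epi by (simp add: H)
    show "d 0 ` carrier (H 1) = a_kernel (H 0) M \<epsilon>" using im by (simp add: H d)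
  qed (use zero homs exact min in blast)+
  moreover have "generated_in_degrees_le n (H i) (r + int i)" if "i \<le> Suc l" for i
  proof (cases i)
    case 0
    then show ?thesis using free_generated_in_degrees_le[OF assms(2)] by (simp add: H)
  next
    case (Suc i')
    then show ?thesis using gen[of i'] that by (simp add: H G_def algebra_simps)
  qed
  ultimately show ?thesis unfolding regular_def H_def by blast
qed

text \<open>The syzygy module of a minimal cover satisfies the hypotheses with \<open>r\<close> raised and the length
  bound \<open>q\<close> lowered by one. It lives in a fixed type, whereas \<open>M\<close> need not; thus the induction on \<open>q\<close>
  runs over syzygy modules and this step is applied once more to \<open>M\<close>.\<close>

lemma regular_step:
  fixes M :: "('k::field mpoly, 'm) gmodule"
  assumes "gmod n M" "homogeneous_generators n M A"
    "\<And>p j. r < j \<or> int (Suc q) \<le> p \<Longrightarrow> koszul_vanishes n M p j"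
    "\<And>K A. gmod n K \<Longrightarrow> homogeneous_generators n K A \<Longrightarrow>
       (\<And>p j. r + 1 < j \<or> int q \<le> p \<Longrightarrow> koszul_vanishes n K p j) \<Longrightarrow>
       regular n (r + 1) (K :: ('k mpoly, nat \<Rightarrow> 'k mpoly) gmodule)"
  shows "regular n r M"
proof -
  obtain as \<epsilon> where cover: "free_cover n M as \<epsilon>"
    and min: "\<And>f i. f \<in> a_kernel (free_gmodule n as) M \<epsilon> \<Longrightarrow> lookup (f i) 0 = 0"
    and deg: "\<And>a. a \<in> set as \<Longrightarrow> \<not> koszul_vanishes n M 0 a"
    using minimal_free_cover[OF assms(1,2)] by metis
  interpret free_cover n M as \<epsilon> by fact
  have K_vanishes: "koszul_vanishes n K p j" if "r + 1 < j \<or> int q \<le> p" for p j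
  proof (rule kernel_vanishes)
    show "koszul_vanishes n M (p + 1) (j - 1)" using that by (intro assms(3)) auto
  qed (rule min)
  obtain B where "homogeneous_generators n K B"
    by (rule kernel_generators[of "r + 1"]) (use K_vanishes in auto)
  then have "regular n (r + 1) K"
    by (rule assms(4)[OF K _ K_vanishes])
  moreover have "a \<le> r" if "a \<in> set as" for a
    using deg[OF that] assms(3)[of a 0] by (meson not_le)
  ultimately show ?thesis
    by (intro regular_of_kernel min)
qed

lemma regular_of_koszul_vanishes_aux:
  fixes K :: "('k::field mpoly, nat \<Rightarrow> 'k mpoly) gmodule"
  assumes "gmod n K" "homogeneous_generators n K A"
    "\<And>p j. r < j \<or> int q \<le> p \<Longrightarrow> koszul_vanishes n K p j"
  shows "regular n r K"
  using assms
proof (induction q arbitrary: K A r)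
  case 0
  obtain as \<epsilon> where "free_cover n K as \<epsilon>" and deg: "\<And>a. a \<in> set as \<Longrightarrow> \<not> koszul_vanishes n K 0 a"
    using minimal_free_cover[OF 0(1,2)] by metis
  moreover have "as = []" using deg 0(3)[of _ 0] by (cases as) auto
  ultimately show ?case using regular_of_zero_cover by blast
next
  case (Suc q)
  show ?case by (rule regular_step[OF Suc.prems Suc.IH])
qed

lemma regular_of_koszul_vanishes:
  assumes "gmod n M" "fg_graded_module n M" "\<And>p j. r < j \<Longrightarrow> koszul_vanishes n M p j"
  shows "regular n r M"
proof -
  obtain A where A: "homogeneous_generators n M A"
    using gmod.homogeneous_generators_exist[OF assms(1,2)] .
  show ?thesis
  proof (rule regular_step[OF assms(1) A])
    show "koszul_vanishes n M p j" if "r < j \<or> int (Suc (Suc n)) \<le> p" for p j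
      using that assms(3) gmod.koszul_vanishes_trivial[OF assms(1)] by auto
  qed (rule regular_of_koszul_vanishes_aux)
qed

section \<open>Ideals of an approximation system\<close>

text \<open>The infimum of a set of integers, if finite, belongs to it; if it is \<open>- \<infinity>\<close>, the set contains
  arbitrarily small integers.\<close>

lemma reg_le_iff:
  "reg n M \<le> ereal (real_of_int r) \<longleftrightarrow> (\<exists>r' \<le> r. regular n r' M)"
proof
  assume "reg n M \<le> ereal (real_of_int r)"
  also have "\<dots> < ereal (real_of_int (r + 1))" by simp
  finally obtain r' where "regular n r' M" "ereal (real_of_int r') < ereal (real_of_int (r + 1))"
    unfolding reg_def Inf_less_iff by blast
  then have "r' \<le> r" by simp
  then show "\<exists>r' \<le> r. regular n r' M" using \<open>regular n r' M\<close> by blast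
next
  assume "\<exists>r' \<le> r. regular n r' M"
  then obtain r' where "r' \<le> r" "regular n r' M" by blast
  then have "reg n M \<le> ereal (real_of_int r')" unfolding reg_def by (intro Inf_lower) blast
  also have "\<dots> \<le> ereal (real_of_int r)" using \<open>r' \<le> r\<close> by simp
  finally show "reg n M \<le> ereal (real_of_int r)" .
qed

lemma ideals_set_finsum_subset:
  fixes J :: "'k::field mpoly set"
  assumes "finite A" "\<And>i. i \<in> A \<Longrightarrow> ideal (I i) (poly_ring n)" "\<And>i. i \<in> A \<Longrightarrow> I i \<subseteq> J"
    "ideal J (poly_ring n)"
  shows "(\<Oplus>\<^bsub>ideals_set (poly_ring n)\<^esub>i \<in> A. I i) \<subseteq> J"
  using assms(1-3)
proof (induction A rule: finite_induct)
  interpret cring "poly_ring n :: 'k mpoly ring" by (rule poly_ring_cring)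
  interpret S: abelian_monoid "ideals_set (poly_ring n :: 'k mpoly ring)"
    using ideals_set_is_semiring by (simp add: semiring_def)
  interpret J: additive_subgroup J "poly_ring n" by (rule ideal.axioms(1)[OF assms(4)])
  { case empty
    then show ?case using J.zero_closed unfolding S.finsum_empty by (simp add: ideals_set_def) }
  { case (insert i A)
    have "(\<Oplus>\<^bsub>ideals_set (poly_ring n)\<^esub>i \<in> insert i A. I i) =
        I i \<oplus>\<^bsub>ideals_set (poly_ring n)\<^esub> (\<Oplus>\<^bsub>ideals_set (poly_ring n)\<^esub>i \<in> A. I i)"
      using insert by (intro S.finsum_insert) (auto simp: ideals_set_def)
    also have "\<dots> \<subseteq> J"
    proof -
      have "(\<Oplus>\<^bsub>ideals_set (poly_ring n)\<^esub>i \<in> A. I i) \<subseteq> J" using insert by auto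
      moreover have "I i \<subseteq> J" using insert.prems(2) by auto
      moreover have "x + x' \<in> J" if "x \<in> J" "x' \<in> J" for x x' using J.a_closed that by simp
      ultimately show ?thesis unfolding ideals_set_def ring_record_simps set_add_def' poly_ring_simps by blast
    qed
    finally show ?case . }
qed

lemma power_in_ideal_power:
  fixes y :: "'k::field mpoly"
  assumes "y \<in> I"
  shows "y ^ k \<in> I [^]\<^bsub>ideals_set (poly_ring n)\<^esub> k"
proof (induction k)
  case 0
  then show ?case by (simp add: ideals_set_def nat_pow_def)
next
  case (Suc k)
  have "y ^ k * y \<in> ideal_prod (poly_ring n) (I [^]\<^bsub>ideals_set (poly_ring n)\<^esub> k) I"
    using ideal_prod.prod[OF Suc.IH assms, of "poly_ring n"] by simp
  then show ?case by (simp add: ideals_set_def nat_pow_def mult.commute)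
qed

text \<open>A homogeneous generator with a nonzero constant term would be a unit.\<close>

lemma proper_homogeneous_ideal_const_free:
  assumes "homogeneous_ideal n I" "I \<noteq> carrier (poly_ring n)"
  shows "I \<subseteq> {p \<in> carrier (poly_ring n). lookup p 0 = 0}"
proof -
  interpret ideal I "poly_ring n" using assms(1) by (simp add: homogeneous_ideal_def)
  obtain A where A: "A \<subseteq> (\<Union>j. poly_part n j)" "I = Idl\<^bsub>poly_ring n\<^esub> A"
    using assms(1) by (auto simp: homogeneous_ideal_def)
  have Ac: "A \<subseteq> carrier (poly_ring n)" using A(1) poly_part_carrier by blast
  have "lookup a 0 = 0" if a: "a \<in> A" for a
  proof (rule ccontr)
    assume c: "lookup a 0 \<noteq> 0"
    let ?c = "lookup a 0"
    obtain j where "a \<in> poly_part n j" using a A(1) by blast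
    then have "a \<in> poly_part n 0" using poly_part_const_term c by metis
    then have "a = single 0 ?c" by (rule poly_part_0_const)
    then have "single 0 (inverse ?c) * a = 1"
      using c by (metis mult_single add_0 left_inverse single_one)
    moreover have "a \<in> I" using genideal_self[OF Ac] a A(2) by blast
    ultimately have "1 \<in> I" using I_l_closed[of a "single 0 (inverse ?c)"] by simp
    then show False using one_imp_carrier assms(2) by simp
  qed
  then show ?thesis
    unfolding A(2) using Ac by (intro genideal_minimal const_free_ideal) auto
qed

lemma (in gmod) annihilator_ideal:
  assumes z: "z \<in> carrier M"
  shows "ideal {a \<in> carrier (poly_ring n). a \<odot> z = \<zero>} (poly_ring n)" (is "ideal ?J _")
proof (rule idealI[OF R.ring_axioms])
  show "subgroup ?J (add_monoid (poly_ring n))"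
  proof (rule R.add.subgroupI)
    show "?J \<noteq> {}" using z by (auto intro!: exI[of _ 0])
    show "\<ominus>\<^bsub>poly_ring n\<^esub> a \<in> ?J" if "a \<in> ?J" for a
      using that smult_l_minus[of a z] z by simp
    show "a \<oplus>\<^bsub>poly_ring n\<^esub> b \<in> ?J" if "a \<in> ?J" "b \<in> ?J" for a b
      using that smult_l_distr[of a b z] z by (simp add: carrier_poly_closed)
  qed auto
  show "x \<otimes>\<^bsub>poly_ring n\<^esub> a \<in> ?J" "a \<otimes>\<^bsub>poly_ring n\<^esub> x \<in> ?J"
    if "a \<in> ?J" "x \<in> carrier (poly_ring n)" for a x
    using that smult_assoc1[of x a z] z by (simp_all add: carrier_poly_closed mult.commute)
qed

theorem theorem3p3:
  fixes n d t :: nat and r :: int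
    and M :: "('k::field mpoly, 'm) gmodule"
    and Ms :: "nat \<Rightarrow> ('k mpoly, 'p) gmodule"
    and y :: "'k mpoly"
  assumes "infinite (UNIV :: 'k set)"
    and "fg_graded_module n M"
    and "approximation_system n M d Ms t"
    and "y \<in> poly_part n 1"
    and "filter_regular n M y"
    and "\<forall>i \<in> {1..d}. filter_regular n (Ms i) y"
    and "\<forall>i \<in> {1..d}. reg n (Ms i) \<le> ereal (real_of_int (r - int t))"
    and "reg n (quot_module M (mult_image M y)) \<le> ereal (real_of_int (r - int t + 1))"
  shows "reg n M \<le> ereal (real_of_int r)"
proof -
  have M: "gmod n M" using assms(2) by (intro gmodI) (simp add: fg_graded_module_def)
  interpret hyperplane n M y
    using M assms(4) by (intro hyperplane.intro hyperplane_axioms.intro)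
  obtain \<phi> I where approx: "\<And>i. i \<in> {1..d} \<Longrightarrow> approximation_via n M (Ms i) (\<phi> i) (I i)"
    and cover: "max_ideal n [^]\<^bsub>ideals_set (poly_ring n)\<^esub> t
          \<subseteq> (\<Oplus>\<^bsub>ideals_set (poly_ring n)\<^esub>i \<in> {1..d}. I i)"
    using assms(3) unfolding approximation_system_def by blast
  have ideals: "ideal (I i) (poly_ring n)" if "i \<in> {1..d}" for i
    using approx[OF that] by (simp add: approximation_via_def homogeneous_ideal_def)
  have "y \<in> max_ideal n"
    using max_ideal_I[OF y_carrier] poly_part_const_term[OF _ y] by simp
  then have yt: "y ^ t \<in> (\<Oplus>\<^bsub>ideals_set (poly_ring n)\<^esub>i \<in> {1..d}. I i)"
    using power_in_ideal_power cover by blast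
  have "t \<noteq> 0"
  proof
    assume "t = 0"
    have "(\<Oplus>\<^bsub>ideals_set (poly_ring n)\<^esub>i \<in> {1..d}. I i) \<subseteq>
        {p \<in> carrier (poly_ring n). lookup p 0 = 0}"
    proof (intro ideals_set_finsum_subset const_free_ideal ideals)
      show "I i \<subseteq> {p \<in> carrier (poly_ring n). lookup p 0 = 0}" if "i \<in> {1..d}" for i
        using approx[OF that] unfolding approximation_via_def
        by (intro proper_homogeneous_ideal_const_free) blast+
    qed auto
    then show False using yt \<open>t = 0\<close> by auto
  qed
  obtain s where s: "s \<le> r - int t + 1" "regular n s Q"
    using assms(8) unfolding reg_le_iff by blast
  have Qv: "koszul_vanishes n Q p j" if "r - int t + 1 < j" for p j
    using regular_koszul_vanishes[OF Q(1) s(2)] s(1) that by simp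
  have torsion_free: "z = \<zero>\<^bsub>M\<^esub>" if z: "z \<in> part M j" "y \<odot>\<^bsub>M\<^esub> z = \<zero>\<^bsub>M\<^esub>" and j: "r < j" for z j
  proof -
    have "y ^ 1 \<odot>\<^bsub>M\<^esub> z = \<zero>\<^bsub>M\<^esub>" using z(2) by simp
    then obtain z' N where z': "z' \<in> part M (j - int t)" "z = y ^ t \<odot>\<^bsub>M\<^esub> z'" "y ^ N \<odot>\<^bsub>M\<^esub> z' = \<zero>\<^bsub>M\<^esub>"
      using torsion_divisible[where s = "r - int t + 1" and m = t and N = 1, OF assms(5) Qv z(1)] j by auto
    obtain k where k: "z' \<in> torsion n M k" using filter_regular_torsion[OF assms(5) y z'(1,3)] .
    have "z' \<in> a_kernel M (Ms i) (\<phi> i)" if i: "i \<in> {1..d}" for i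
    proof -
      have Mi: "gmod n (Ms i)" and hom: "graded_hom n M (Ms i) (\<phi> i)"
        using approx[OF i] by (auto simp: approximation_via_def fg_graded_module_def graded_epi_def intro: gmodI)
      obtain r' where r': "r' \<le> r - int t" "regular n r' (Ms i)"
        using assms(7) i unfolding reg_le_iff by blast
      have "\<phi> i z' = \<zero>\<^bsub>Ms i\<^esub>"
      proof (rule gmod.torsion_zero[OF Mi])
        show "koszul_vanishes n (Ms i) (int n + 1) j" if "r - int t < j" for j
          using regular_koszul_vanishes[OF Mi r'(2)] r'(1) that by simp
        show "\<phi> i z' \<in> torsion n (Ms i) k" by (rule torsion_hom[OF M Mi hom k])
        show "\<phi> i z' \<in> part (Ms i) (j - int t)" by (rule graded_homD(4)[OF hom z'(1)])
      qed (use j in simp)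
      then show ?thesis unfolding kernel_iff using part_carrier[OF z'(1)] by blast
    qed
    then have "I i \<subseteq> {a \<in> carrier (poly_ring n). a \<odot>\<^bsub>M\<^esub> z' = \<zero>\<^bsub>M\<^esub>}" if "i \<in> {1..d}" for i
      using approx[OF that] that additive_subgroup.a_subset[OF ideal.axioms(1)[OF ideals[OF that]]]
      unfolding approximation_via_def by blast
    then have "(\<Oplus>\<^bsub>ideals_set (poly_ring n)\<^esub>i \<in> {1..d}. I i) \<subseteq>
        {a \<in> carrier (poly_ring n). a \<odot>\<^bsub>M\<^esub> z' = \<zero>\<^bsub>M\<^esub>}"
      by (intro ideals_set_finsum_subset ideals annihilator_ideal part_carrier[OF z'(1)]) auto
    then show ?thesis using yt z'(2) by auto
  qed
  have "koszul_vanishes n M p j" if "r < j" for p j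
  proof (rule vanishes_from_section)
    show "koszul_vanishes n Q (p + 1) j" using that \<open>t \<noteq> 0\<close> by (intro Qv) simp
  qed (use torsion_free that in blast)
  then have "regular n r M" by (rule regular_of_koszul_vanishes[OF M assms(2)])
  then show ?thesis unfolding reg_le_iff by blast
qed

end
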